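(* Let $G$ be a finite group and let $K$ be a field of characteristic $p>0$ such that $\operatorname{Ext}^1_{KG}(K,K)\neq 0$, where $K$ denotes the trivial $KG$-module. Then the following hold. (1) $\operatorname{Ext}^n_{KG}(K,K)\neq 0$ for every integer $n\geq 1$. (2) If $M$ is a finite-dimensional $KG$-module and $p\nmid \dim_K M$, then $\operatorname{Ext}^n_{KG}(M,M)\neq 0$ for every integer $n\geq 1$.
   Context: $KG$ is the group algebra of $G$ over $K$. Modules are right modules. The trivial $KG$-module is $K$ with every element of $G$ acting as the identity. *)

theory Defs
  imports "HOL-Algebra.Coset" "Jordan_Normal_Form.Missing_VectorSpace"
begin

section \<open>Right modules over a ring\<close>

text \<open>HOL-Algebra only has modules over commutative rings.  The record \<open>module\<close> is reused here for
  right modules over an arbitrary ring: \<open>a \<odot>\<^bsub>M\<^esub> x\<close> stands for the product \<open>x a\<close>, so the order of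
  the factors is reversed in \<open>smult_assoc\<close>.  The components \<open>mult\<close> and \<open>one\<close> of the record carry no
  meaning.  Homomorphisms are given by the library constant \<open>module_hom\<close>.\<close>

locale right_module = R?: ring R + M?: abelian_group M
  for R :: "('r, 'c) ring_scheme" (structure) and M :: "('r, 'm, 'e) module_scheme" (structure) +
  assumes smult_closed [simp, intro]:
      "\<lbrakk>a \<in> carrier R; x \<in> carrier M\<rbrakk> \<Longrightarrow> a \<odot>\<^bsub>M\<^esub> x \<in> carrier M"
    and smult_l_distr:
      "\<lbrakk>a \<in> carrier R; b \<in> carrier R; x \<in> carrier M\<rbrakk>
        \<Longrightarrow> (a \<oplus>\<^bsub>R\<^esub> b) \<odot>\<^bsub>M\<^esub> x = a \<odot>\<^bsub>M\<^esub> x \<oplus>\<^bsub>M\<^esub> b \<odot>\<^bsub>M\<^esub> x"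
    and smult_r_distr:
      "\<lbrakk>a \<in> carrier R; x \<in> carrier M; y \<in> carrier M\<rbrakk>
        \<Longrightarrow> a \<odot>\<^bsub>M\<^esub> (x \<oplus>\<^bsub>M\<^esub> y) = a \<odot>\<^bsub>M\<^esub> x \<oplus>\<^bsub>M\<^esub> a \<odot>\<^bsub>M\<^esub> y"
    and smult_assoc:
      "\<lbrakk>a \<in> carrier R; b \<in> carrier R; x \<in> carrier M\<rbrakk>
        \<Longrightarrow> (a \<otimes>\<^bsub>R\<^esub> b) \<odot>\<^bsub>M\<^esub> x = b \<odot>\<^bsub>M\<^esub> (a \<odot>\<^bsub>M\<^esub> x)"
    and smult_one [simp]:
      "x \<in> carrier M \<Longrightarrow> \<one>\<^bsub>R\<^esub> \<odot>\<^bsub>M\<^esub> x = x"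

definition free_right_module :: "('r, 'c) ring_scheme \<Rightarrow> 'x set \<Rightarrow> ('r, 'x \<Rightarrow> 'r) module" where
  "free_right_module R X =
    \<lparr>carrier = {f \<in> X \<rightarrow>\<^sub>E carrier R. finite {x \<in> X. f x \<noteq> \<zero>\<^bsub>R\<^esub>}},
     mult = undefined, one = undefined,
     zero = (\<lambda>x\<in>X. \<zero>\<^bsub>R\<^esub>),
     add = (\<lambda>f g. \<lambda>x\<in>X. f x \<oplus>\<^bsub>R\<^esub> g x),
     smult = (\<lambda>a f. \<lambda>x\<in>X. f x \<otimes>\<^bsub>R\<^esub> a)\<rparr>"

text \<open>Projective: a direct summand of a free module.  A generating set of \<open>P\<close> always suffices as
  the basis, so it is no loss to take the basis in the element type of \<open>P\<close>.\<close>

definition projective_module :: "('r, 'c) ring_scheme \<Rightarrow> ('r, 'p) module \<Rightarrow> bool" where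
  "projective_module R P \<longleftrightarrow> right_module R P \<and>
    (\<exists>(X :: 'p set) i r. i \<in> module_hom R P (free_right_module R X) \<and>
       r \<in> module_hom R (free_right_module R X) P \<and> (\<forall>x\<in>carrier P. r (i x) = x))"

definition projective_resolution ::
  "('r, 'c) ring_scheme \<Rightarrow> ('r, 'm) module \<Rightarrow> (nat \<Rightarrow> ('r, 'p) module) \<Rightarrow>
    (nat \<Rightarrow> 'p \<Rightarrow> 'p) \<Rightarrow> ('p \<Rightarrow> 'm) \<Rightarrow> bool" where
  "projective_resolution R M P d \<epsilon> \<longleftrightarrow>
    (\<forall>n. projective_module R (P n)) \<and>
    (\<forall>n. d n \<in> module_hom R (P (Suc n)) (P n)) \<and>
    \<epsilon> \<in> module_hom R (P 0) M \<and>
    \<epsilon> ` carrier (P 0) = carrier M \<and>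
    d 0 ` carrier (P (Suc 0)) = {x \<in> carrier (P 0). \<epsilon> x = \<zero>\<^bsub>M\<^esub>} \<and>
    (\<forall>n. d (Suc n) ` carrier (P (Suc (Suc n))) = {x \<in> carrier (P (Suc n)). d n x = \<zero>\<^bsub>P n\<^esub>})"


section \<open>Ext groups\<close>

text \<open>Abelian groups are written multiplicatively below, so as to use the library quotient \<open>Mod\<close>.\<close>

definition Hom_group ::
  "('r, 'c) ring_scheme \<Rightarrow> ('r, 'p) module \<Rightarrow> ('r, 'n) module \<Rightarrow> ('p \<Rightarrow> 'n) monoid" where
  "Hom_group R P N =
    \<lparr>carrier = module_hom R P N \<inter> extensional (carrier P),
     mult = (\<lambda>f g. \<lambda>x\<in>carrier P. f x \<oplus>\<^bsub>N\<^esub> g x),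
     one = (\<lambda>x\<in>carrier P. \<zero>\<^bsub>N\<^esub>)\<rparr>"

definition Hom_diff ::
  "(nat \<Rightarrow> ('r, 'p) module) \<Rightarrow> (nat \<Rightarrow> 'p \<Rightarrow> 'p) \<Rightarrow> nat \<Rightarrow> ('p \<Rightarrow> 'n) \<Rightarrow> 'p \<Rightarrow> 'n" where
  "Hom_diff P d n f = (\<lambda>x\<in>carrier (P (Suc n)). f (d n x))"

definition Ext_cocycles ::
  "('r, 'c) ring_scheme \<Rightarrow> (nat \<Rightarrow> ('r, 'p) module) \<Rightarrow> (nat \<Rightarrow> 'p \<Rightarrow> 'p) \<Rightarrow>
    ('r, 'n) module \<Rightarrow> nat \<Rightarrow> ('p \<Rightarrow> 'n) set" where
  "Ext_cocycles R P d N n =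
    {f \<in> carrier (Hom_group R (P n) N). Hom_diff P d n f = \<one>\<^bsub>Hom_group R (P (Suc n)) N\<^esub>}"

definition Ext_coboundaries ::
  "('r, 'c) ring_scheme \<Rightarrow> (nat \<Rightarrow> ('r, 'p) module) \<Rightarrow> (nat \<Rightarrow> 'p \<Rightarrow> 'p) \<Rightarrow>
    ('r, 'n) module \<Rightarrow> nat \<Rightarrow> ('p \<Rightarrow> 'n) set" where
  "Ext_coboundaries R P d N n =
    (case n of 0 \<Rightarrow> {\<one>\<^bsub>Hom_group R (P 0) N\<^esub>}
     | Suc m \<Rightarrow> Hom_diff P d m ` carrier (Hom_group R (P m) N))"

definition Ext_of_resolution ::
  "('r, 'c) ring_scheme \<Rightarrow> (nat \<Rightarrow> ('r, 'p) module) \<Rightarrow> (nat \<Rightarrow> 'p \<Rightarrow> 'p) \<Rightarrow>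
    ('r, 'n) module \<Rightarrow> nat \<Rightarrow> ('p \<Rightarrow> 'n) set monoid" where
  "Ext_of_resolution R P d N n =
    (Hom_group R (P n) N)\<lparr>carrier := Ext_cocycles R P d N n\<rparr> Mod Ext_coboundaries R P d N n"

text \<open>\<open>Ext\<close> uses an arbitrary projective resolution whose terms consist of functions
  \<open>('m, 'r) syz \<Rightarrow> 'r\<close>.  The type \<open>syz\<close> of basis labels is chosen such that every right module over
  every ring has a resolution of this kind, see \<open>projective_resolution_exists\<close> below: \<open>Gen x\<close> labels
  a generator \<open>x\<close> of the module, and \<open>Rel\<close> labels a relation, given by its list of coefficients,
  between previous basis elements.\<close>

datatype ('m, 'r) syz = Gen 'm | Rel "(('m, 'r) syz \<times> 'r) list"

definition Ext ::
  "('r, 'c) ring_scheme \<Rightarrow> ('r, 'm) module \<Rightarrow> ('r, 'n) module \<Rightarrow> nat \<Rightarrow>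
    ((('m, 'r) syz \<Rightarrow> 'r) \<Rightarrow> 'n) set monoid" where
  "Ext R M N n =
    (let (P, d) = (SOME (P, d). \<exists>\<epsilon>. projective_resolution R M P d \<epsilon>)
     in Ext_of_resolution R P d N n)"

definition Ext_nonzero ::
  "('r, 'c) ring_scheme \<Rightarrow> ('r, 'm) module \<Rightarrow> ('r, 'n) module \<Rightarrow> nat \<Rightarrow> bool" where
  "Ext_nonzero R M N n \<longleftrightarrow> carrier (Ext R M N n) \<noteq> {\<one>\<^bsub>Ext R M N n\<^esub>}"


section \<open>Group algebras\<close>

text \<open>The group algebra of a finite group: an element is the family of its coefficients.\<close>

definition group_algebra ::
  "('k, 'a) ring_scheme \<Rightarrow> ('g, 'b) monoid_scheme \<Rightarrow> ('g \<Rightarrow> 'k) ring" where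
  "group_algebra K G =
    \<lparr>carrier = carrier G \<rightarrow>\<^sub>E carrier K,
     mult = (\<lambda>a b. \<lambda>g\<in>carrier G. \<Oplus>\<^bsub>K\<^esub>h\<in>carrier G. a h \<otimes>\<^bsub>K\<^esub> b (inv\<^bsub>G\<^esub> h \<otimes>\<^bsub>G\<^esub> g)),
     one = (\<lambda>g\<in>carrier G. if g = \<one>\<^bsub>G\<^esub> then \<one>\<^bsub>K\<^esub> else \<zero>\<^bsub>K\<^esub>),
     zero = (\<lambda>g\<in>carrier G. \<zero>\<^bsub>K\<^esub>),
     add = (\<lambda>a b. \<lambda>g\<in>carrier G. a g \<oplus>\<^bsub>K\<^esub> b g)\<rparr>"

definition group_algebra_scalar ::
  "('k, 'a) ring_scheme \<Rightarrow> ('g, 'b) monoid_scheme \<Rightarrow> 'k \<Rightarrow> 'g \<Rightarrow> 'k" where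
  "group_algebra_scalar K G c = (\<lambda>g\<in>carrier G. if g = \<one>\<^bsub>G\<^esub> then c else \<zero>\<^bsub>K\<^esub>)"

definition underlying_space ::
  "('k, 'a) ring_scheme \<Rightarrow> ('g, 'b) monoid_scheme \<Rightarrow> ('g \<Rightarrow> 'k, 'm) module \<Rightarrow> ('k, 'm) module" where
  "underlying_space K G M =
    \<lparr>carrier = carrier M, mult = mult M, one = one M, zero = zero M, add = add M,
     smult = (\<lambda>c x. group_algebra_scalar K G c \<odot>\<^bsub>M\<^esub> x)\<rparr>"

text \<open>Since every \<open>g\<close> acts as the identity on \<open>K\<close>, an element \<open>a\<close> of the group algebra acts as
  multiplication by the sum of its coefficients.\<close>

definition trivial_module ::
  "('k, 'a) ring_scheme \<Rightarrow> ('g, 'b) monoid_scheme \<Rightarrow> ('g \<Rightarrow> 'k, 'k) module" where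
  "trivial_module K G =
    \<lparr>carrier = carrier K, mult = mult K, one = one K, zero = zero K, add = add K,
     smult = (\<lambda>a x. x \<otimes>\<^bsub>K\<^esub> (\<Oplus>\<^bsub>K\<^esub>g\<in>carrier G. a g))\<rparr>"

definition has_characteristic :: "('k, 'a) ring_scheme \<Rightarrow> nat \<Rightarrow> bool" where
  "has_characteristic K p \<longleftrightarrow> (\<forall>n::nat. [n] \<cdot>\<^bsub>K\<^esub> \<one>\<^bsub>K\<^esub> = \<zero>\<^bsub>K\<^esub> \<longleftrightarrow> p dvd n)"


section \<open>Every right module has a projective resolution\<close>

lemma free_right_module_simps [simp]:
  "carrier (free_right_module R X) = {f \<in> X \<rightarrow>\<^sub>E carrier R. finite {x \<in> X. f x \<noteq> \<zero>\<^bsub>R\<^esub>}}"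
  "zero (free_right_module R X) = (\<lambda>x\<in>X. \<zero>\<^bsub>R\<^esub>)"
  "add (free_right_module R X) f g = (\<lambda>x\<in>X. f x \<oplus>\<^bsub>R\<^esub> g x)"
  "smult (free_right_module R X) a f = (\<lambda>x\<in>X. f x \<otimes>\<^bsub>R\<^esub> a)"
  by (simp_all add: free_right_module_def)

lemma right_module_free:
  assumes "ring R"
  shows "right_module R (free_right_module R X)"
proof -
  interpret ring R by fact
  let ?F = "free_right_module R X"
  have fin_add: "finite {x \<in> X. f x \<oplus>\<^bsub>R\<^esub> g x \<noteq> \<zero>\<^bsub>R\<^esub>}"
    if "finite {x \<in> X. f x \<noteq> \<zero>\<^bsub>R\<^esub>}" "finite {x \<in> X. g x \<noteq> \<zero>\<^bsub>R\<^esub>}" for f g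
    by (rule finite_subset[OF _ finite_UnI[OF that]]) auto
  have fin_smult: "finite {x \<in> X. f x \<otimes>\<^bsub>R\<^esub> a \<noteq> \<zero>\<^bsub>R\<^esub>}"
    if "finite {x \<in> X. f x \<noteq> \<zero>\<^bsub>R\<^esub>}" "a \<in> carrier R" for f a
    by (rule finite_subset[OF _ that(1)]) (use that(2) in auto)
  have "abelian_group ?F"
  proof (rule abelian_groupI)
    fix f g assume "f \<in> carrier ?F" "g \<in> carrier ?F"
    then show "f \<oplus>\<^bsub>?F\<^esub> g \<in> carrier ?F"
      using fin_add[of f g] by (auto simp: PiE_iff cong: conj_cong)
  next
    show "\<zero>\<^bsub>?F\<^esub> \<in> carrier ?F" by (auto cong: conj_cong)
  next
    fix f g h assume "f \<in> carrier ?F" "g \<in> carrier ?F" "h \<in> carrier ?F"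
    then show "(f \<oplus>\<^bsub>?F\<^esub> g) \<oplus>\<^bsub>?F\<^esub> h = f \<oplus>\<^bsub>?F\<^esub> (g \<oplus>\<^bsub>?F\<^esub> h)"
      by (auto simp: fun_eq_iff PiE_iff a_assoc)
  next
    fix f g assume "f \<in> carrier ?F" "g \<in> carrier ?F"
    then show "f \<oplus>\<^bsub>?F\<^esub> g = g \<oplus>\<^bsub>?F\<^esub> f"
      by (auto simp: fun_eq_iff PiE_iff a_comm)
  next
    fix f assume "f \<in> carrier ?F"
    then show "\<zero>\<^bsub>?F\<^esub> \<oplus>\<^bsub>?F\<^esub> f = f"
      by (auto simp: fun_eq_iff PiE_iff extensional_def)
  next
    fix f assume f: "f \<in> carrier ?F"
    let ?g = "\<lambda>x\<in>X. \<ominus>\<^bsub>R\<^esub> f x"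
    have "finite {x \<in> X. ?g x \<noteq> \<zero>\<^bsub>R\<^esub>}"
      by (rule finite_subset[of _ "{x \<in> X. f x \<noteq> \<zero>\<^bsub>R\<^esub>}"]) (use f in auto)
    then have "?g \<in> carrier ?F" using f by (auto simp: PiE_iff)
    moreover have "?g \<oplus>\<^bsub>?F\<^esub> f = \<zero>\<^bsub>?F\<^esub>"
      using f by (auto simp: fun_eq_iff PiE_iff l_neg)
    ultimately show "\<exists>g\<in>carrier ?F. g \<oplus>\<^bsub>?F\<^esub> f = \<zero>\<^bsub>?F\<^esub>" by blast
  qed
  then show ?thesis
  proof (intro right_module.intro right_module_axioms.intro assms)
    fix a f assume "a \<in> carrier R" "f \<in> carrier ?F"
    then show "a \<odot>\<^bsub>?F\<^esub> f \<in> carrier ?F"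
      using fin_smult[of f a] by (auto simp: PiE_iff cong: conj_cong)
  next
    fix a b f assume "a \<in> carrier R" "b \<in> carrier R" "f \<in> carrier ?F"
    then show "(a \<oplus>\<^bsub>R\<^esub> b) \<odot>\<^bsub>?F\<^esub> f = a \<odot>\<^bsub>?F\<^esub> f \<oplus>\<^bsub>?F\<^esub> b \<odot>\<^bsub>?F\<^esub> f"
      by (auto simp: fun_eq_iff PiE_iff r_distr)
  next
    fix a f g assume "a \<in> carrier R" "f \<in> carrier ?F" "g \<in> carrier ?F"
    then show "a \<odot>\<^bsub>?F\<^esub> (f \<oplus>\<^bsub>?F\<^esub> g) = a \<odot>\<^bsub>?F\<^esub> f \<oplus>\<^bsub>?F\<^esub> a \<odot>\<^bsub>?F\<^esub> g"
      by (auto simp: fun_eq_iff PiE_iff l_distr)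
  next
    fix a b f assume "a \<in> carrier R" "b \<in> carrier R" "f \<in> carrier ?F"
    then show "(a \<otimes>\<^bsub>R\<^esub> b) \<odot>\<^bsub>?F\<^esub> f = b \<odot>\<^bsub>?F\<^esub> (a \<odot>\<^bsub>?F\<^esub> f)"
      by (auto simp: fun_eq_iff PiE_iff m_assoc)
  next
    fix f assume "f \<in> carrier ?F"
    then show "\<one>\<^bsub>R\<^esub> \<odot>\<^bsub>?F\<^esub> f = f"
      by (auto simp: fun_eq_iff PiE_iff extensional_def)
  qed
qed

lemma projective_module_free:
  assumes "ring R"
  shows "projective_module R (free_right_module R X)"
proof -
  interpret ring R by fact
  let ?F = "free_right_module R X"
  define e where "e = (\<lambda>x. \<lambda>y\<in>X. if y = x then \<one>\<^bsub>R\<^esub> else \<zero>\<^bsub>R\<^esub>)"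
  define E where "E = e ` X"
  let ?E = "free_right_module R E"
  define i where "i = (\<lambda>f. \<lambda>u\<in>E. f (inv_into X e u) :: 'a)"
  define r where "r = (\<lambda>g. \<lambda>x\<in>X. g (e x) :: 'a)"
  have inj: "inj_on e X" if "\<one>\<^bsub>R\<^esub> \<noteq> \<zero>\<^bsub>R\<^esub>"
    using that by (auto simp: inj_on_def e_def fun_eq_iff restrict_def split: if_splits)
  have triv: "a = \<zero>\<^bsub>R\<^esub>" if "\<one>\<^bsub>R\<^esub> = \<zero>\<^bsub>R\<^esub>" "a \<in> carrier R" for a
    using that by (metis l_null l_one)
  have inv: "inv_into X e u \<in> X" if "u \<in> E" for u
    using that by (auto simp: E_def inv_into_into)
  have i_closed: "i f \<in> carrier ?E" if f: "f \<in> carrier ?F" for f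
  proof -
    have "{u \<in> E. i f u \<noteq> \<zero>\<^bsub>R\<^esub>} \<subseteq> e ` {x \<in> X. f x \<noteq> \<zero>\<^bsub>R\<^esub>}"
    proof
      fix u assume "u \<in> {u \<in> E. i f u \<noteq> \<zero>\<^bsub>R\<^esub>}"
      then have "u = e (inv_into X e u)" "inv_into X e u \<in> {x \<in> X. f x \<noteq> \<zero>\<^bsub>R\<^esub>}"
        using inv[of u] f_inv_into_f[of u e X] by (auto simp: i_def E_def)
      then show "u \<in> e ` {x \<in> X. f x \<noteq> \<zero>\<^bsub>R\<^esub>}" by (rule image_eqI)
    qed
    then have "finite {u \<in> E. i f u \<noteq> \<zero>\<^bsub>R\<^esub>}"
      by (rule finite_subset) (use f in auto)
    then show ?thesis using f inv by (auto simp: i_def PiE_iff)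
  qed
  have r_closed: "r g \<in> carrier ?F" if g: "g \<in> carrier ?E" for g
  proof -
    have "finite {x \<in> X. r g x \<noteq> \<zero>\<^bsub>R\<^esub>}"
    proof (cases "\<one>\<^bsub>R\<^esub> = \<zero>\<^bsub>R\<^esub>")
      case True
      then have "{x \<in> X. r g x \<noteq> \<zero>\<^bsub>R\<^esub>} = {}"
        using g triv by (auto simp: r_def E_def PiE_iff)
      then show ?thesis by (simp only: finite.emptyI)
    next
      case False
      have "{x \<in> X. r g x \<noteq> \<zero>\<^bsub>R\<^esub>} \<subseteq> X \<inter> e -` {u \<in> E. g u \<noteq> \<zero>\<^bsub>R\<^esub>}"
        by (auto simp: r_def E_def)
      then show ?thesis
        by (rule finite_subset, subst Int_commute, intro finite_vimage_IntI inj False)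
          (use g in simp)
    qed
    then show ?thesis using g by (auto simp: r_def E_def PiE_iff)
  qed
  have "i \<in> module_hom R ?F ?E"
    using i_closed inv by (auto simp: module_hom_def) (auto simp: i_def)
  moreover have "r \<in> module_hom R ?E ?F"
    using r_closed by (auto simp: module_hom_def) (auto simp: r_def E_def)
  moreover have "r (i f) = f" if f: "f \<in> carrier ?F" for f
  proof
    fix x show "r (i f) x = f x"
    proof (cases "x \<in> X")
      case x: True
      then have ex: "e x \<in> E" by (auto simp: E_def)
      show ?thesis
      proof (cases "\<one>\<^bsub>R\<^esub> = \<zero>\<^bsub>R\<^esub>")
        case True
        have "f y = \<zero>\<^bsub>R\<^esub>" if "y \<in> X" for y using f that triv[OF True] by auto
        then show ?thesis using x ex inv[OF ex] by (simp add: r_def i_def)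
      next
        case False
        then show ?thesis using f x ex inv_into_f_f[OF inj x] by (auto simp: r_def i_def)
      qed
    qed (use f in \<open>auto simp: r_def PiE_iff extensional_def\<close>)
  qed
  ultimately show ?thesis
    unfolding projective_module_def using right_module_free[OF assms] by blast
qed

definition lin_ext ::
  "('r, 'c) ring_scheme \<Rightarrow> ('r, 'm) module \<Rightarrow> 'x set \<Rightarrow> ('x \<Rightarrow> 'm) \<Rightarrow> ('x \<Rightarrow> 'r) \<Rightarrow> 'm" where
  "lin_ext R M X \<phi> f = (\<Oplus>\<^bsub>M\<^esub>x\<in>{x \<in> X. f x \<noteq> \<zero>\<^bsub>R\<^esub>}. f x \<odot>\<^bsub>M\<^esub> \<phi> x)"

context right_module
begin

lemma smult_l_null [simp]:
  assumes "x \<in> carrier M" shows "\<zero>\<^bsub>R\<^esub> \<odot>\<^bsub>M\<^esub> x = \<zero>\<^bsub>M\<^esub>"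
proof -
  have "\<zero>\<^bsub>R\<^esub> \<odot>\<^bsub>M\<^esub> x \<oplus>\<^bsub>M\<^esub> \<zero>\<^bsub>R\<^esub> \<odot>\<^bsub>M\<^esub> x = \<zero>\<^bsub>R\<^esub> \<odot>\<^bsub>M\<^esub> x \<oplus>\<^bsub>M\<^esub> \<zero>\<^bsub>M\<^esub>"
    using smult_l_distr[of "\<zero>\<^bsub>R\<^esub>" "\<zero>\<^bsub>R\<^esub>" x] assms by simp
  then show ?thesis using assms by (simp del: M.r_zero)
qed

lemma smult_r_null [simp]:
  assumes "a \<in> carrier R" shows "a \<odot>\<^bsub>M\<^esub> \<zero>\<^bsub>M\<^esub> = \<zero>\<^bsub>M\<^esub>"
proof -
  have "a \<odot>\<^bsub>M\<^esub> \<zero>\<^bsub>M\<^esub> \<oplus>\<^bsub>M\<^esub> a \<odot>\<^bsub>M\<^esub> \<zero>\<^bsub>M\<^esub> = a \<odot>\<^bsub>M\<^esub> \<zero>\<^bsub>M\<^esub> \<oplus>\<^bsub>M\<^esub> \<zero>\<^bsub>M\<^esub>"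
    using smult_r_distr[of a "\<zero>\<^bsub>M\<^esub>" "\<zero>\<^bsub>M\<^esub>"] assms by simp
  then show ?thesis using assms by (simp del: M.r_zero)
qed

lemma smult_finsum:
  assumes "finite A" "a \<in> carrier R" "h \<in> A \<rightarrow> carrier M"
  shows "a \<odot>\<^bsub>M\<^esub> (\<Oplus>\<^bsub>M\<^esub>x\<in>A. h x) = (\<Oplus>\<^bsub>M\<^esub>x\<in>A. a \<odot>\<^bsub>M\<^esub> h x)"
  using assms by (induction A) (auto simp: Pi_iff smult_r_distr)

end

lemma lin_ext_superset:
  assumes "right_module R M" "f \<in> carrier (free_right_module R X)" "\<phi> \<in> X \<rightarrow> carrier M"
    "finite A" "{x \<in> X. f x \<noteq> \<zero>\<^bsub>R\<^esub>} \<subseteq> A" "A \<subseteq> X"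
  shows "lin_ext R M X \<phi> f = (\<Oplus>\<^bsub>M\<^esub>x\<in>A. f x \<odot>\<^bsub>M\<^esub> \<phi> x)"
proof -
  interpret right_module R M by fact
  have "f x \<odot>\<^bsub>M\<^esub> \<phi> x \<in> carrier M" if "x \<in> X" for x
    using assms that by (auto simp: PiE_iff)
  then show ?thesis
    unfolding lin_ext_def using assms
    by (intro M.add.finprod_mono_neutral_cong_left) (auto simp: Pi_iff subset_iff)
qed

lemma lin_ext_hom:
  assumes "right_module R M" and \<phi>: "\<phi> \<in> X \<rightarrow> carrier M"
  shows "lin_ext R M X \<phi> \<in> module_hom R (free_right_module R X) M"
proof -
  interpret right_module R M by fact
  let ?F = "free_right_module R X"
  interpret F: right_module R ?F by (rule right_module_free) (rule R.ring_axioms)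
  have tm: "f x \<odot>\<^bsub>M\<^esub> \<phi> x \<in> carrier M" if "x \<in> X" "f \<in> carrier ?F" for x f
    using \<phi> that by (auto simp: PiE_iff)
  have 1: "lin_ext R M X \<phi> f \<in> carrier M" if "f \<in> carrier ?F" for f
    unfolding lin_ext_def using tm that by (intro M.finsum_closed) blast
  have 2: "lin_ext R M X \<phi> (f \<oplus>\<^bsub>?F\<^esub> g) = lin_ext R M X \<phi> f \<oplus>\<^bsub>M\<^esub> lin_ext R M X \<phi> g"
    if f: "f \<in> carrier ?F" and g: "g \<in> carrier ?F" for f g
  proof -
    define A where "A = {x \<in> X. f x \<noteq> \<zero>\<^bsub>R\<^esub>} \<union> {x \<in> X. g x \<noteq> \<zero>\<^bsub>R\<^esub>}"
    have A: "finite A" "A \<subseteq> X" using f g by (auto simp: A_def)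
    have fg: "f \<oplus>\<^bsub>?F\<^esub> g \<in> carrier ?F" using f g by (rule F.M.a_closed)
    have "lin_ext R M X \<phi> (f \<oplus>\<^bsub>?F\<^esub> g) = (\<Oplus>\<^bsub>M\<^esub>x\<in>A. (f \<oplus>\<^bsub>?F\<^esub> g) x \<odot>\<^bsub>M\<^esub> \<phi> x)"
      using fg \<phi> A by (intro lin_ext_superset assms) (auto simp: A_def)
    also have "\<dots> = (\<Oplus>\<^bsub>M\<^esub>x\<in>A. f x \<odot>\<^bsub>M\<^esub> \<phi> x \<oplus>\<^bsub>M\<^esub> g x \<odot>\<^bsub>M\<^esub> \<phi> x)"
    proof (rule M.add.finprod_cong')
      show "(\<lambda>x. f x \<odot>\<^bsub>M\<^esub> \<phi> x \<oplus>\<^bsub>M\<^esub> g x \<odot>\<^bsub>M\<^esub> \<phi> x) \<in> A \<rightarrow> carrier M"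
        using tm[OF _ f] tm[OF _ g] A by (auto simp del: free_right_module_simps)
      show "(f \<oplus>\<^bsub>?F\<^esub> g) x \<odot>\<^bsub>M\<^esub> \<phi> x = f x \<odot>\<^bsub>M\<^esub> \<phi> x \<oplus>\<^bsub>M\<^esub> g x \<odot>\<^bsub>M\<^esub> \<phi> x" if "x \<in> A" for x
        using that A f g \<phi> by (auto simp: PiE_iff Pi_iff subset_iff intro!: smult_l_distr)
    qed simp
    also have "\<dots> = (\<Oplus>\<^bsub>M\<^esub>x\<in>A. f x \<odot>\<^bsub>M\<^esub> \<phi> x) \<oplus>\<^bsub>M\<^esub> (\<Oplus>\<^bsub>M\<^esub>x\<in>A. g x \<odot>\<^bsub>M\<^esub> \<phi> x)"
      using tm[OF _ f] tm[OF _ g] A by (intro M.finsum_addf) (auto simp del: free_right_module_simps)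
    also have "(\<Oplus>\<^bsub>M\<^esub>x\<in>A. f x \<odot>\<^bsub>M\<^esub> \<phi> x) = lin_ext R M X \<phi> f"
      by (rule lin_ext_superset[symmetric, OF assms(1) f \<phi>]) (use A in \<open>auto simp: A_def\<close>)
    also have "(\<Oplus>\<^bsub>M\<^esub>x\<in>A. g x \<odot>\<^bsub>M\<^esub> \<phi> x) = lin_ext R M X \<phi> g"
      by (rule lin_ext_superset[symmetric, OF assms(1) g \<phi>]) (use A in \<open>auto simp: A_def\<close>)
    finally show ?thesis .
  qed
  have 3: "lin_ext R M X \<phi> (a \<odot>\<^bsub>?F\<^esub> f) = a \<odot>\<^bsub>M\<^esub> lin_ext R M X \<phi> f"
    if a: "a \<in> carrier R" and f: "f \<in> carrier ?F" for a f
  proof -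
    define A where "A = {x \<in> X. f x \<noteq> \<zero>\<^bsub>R\<^esub>}"
    have A: "finite A" "A \<subseteq> X" using f by (auto simp: A_def)
    have af: "a \<odot>\<^bsub>?F\<^esub> f \<in> carrier ?F" using a f by (rule F.smult_closed)
    have "lin_ext R M X \<phi> (a \<odot>\<^bsub>?F\<^esub> f) = (\<Oplus>\<^bsub>M\<^esub>x\<in>A. (a \<odot>\<^bsub>?F\<^esub> f) x \<odot>\<^bsub>M\<^esub> \<phi> x)"
      using af \<phi> A a by (intro lin_ext_superset assms) (auto simp: A_def)
    also have "\<dots> = (\<Oplus>\<^bsub>M\<^esub>x\<in>A. a \<odot>\<^bsub>M\<^esub> (f x \<odot>\<^bsub>M\<^esub> \<phi> x))"
    proof (rule M.add.finprod_cong')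
      show "(\<lambda>x. a \<odot>\<^bsub>M\<^esub> (f x \<odot>\<^bsub>M\<^esub> \<phi> x)) \<in> A \<rightarrow> carrier M"
        using tm[OF _ f] a A by (auto simp del: free_right_module_simps)
      show "(a \<odot>\<^bsub>?F\<^esub> f) x \<odot>\<^bsub>M\<^esub> \<phi> x = a \<odot>\<^bsub>M\<^esub> (f x \<odot>\<^bsub>M\<^esub> \<phi> x)" if "x \<in> A" for x
        using that A a f \<phi> by (auto simp: PiE_iff Pi_iff subset_iff intro!: smult_assoc)
    qed simp
    also have "\<dots> = a \<odot>\<^bsub>M\<^esub> lin_ext R M X \<phi> f"
      unfolding lin_ext_def A_def[symmetric]
      using tm[OF _ f] a A by (intro smult_finsum[symmetric]) (auto simp del: free_right_module_simps)
    finally show ?thesis .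
  qed
  show ?thesis
    unfolding module_hom_def using 1 2 3 by (auto simp del: free_right_module_simps)
qed

lemma lin_ext_basis:
  assumes "right_module R M" and \<phi>: "\<phi> \<in> X \<rightarrow> carrier M" and x: "x \<in> X"
  defines "e \<equiv> \<lambda>y\<in>X. if y = x then \<one>\<^bsub>R\<^esub> else \<zero>\<^bsub>R\<^esub>"
  shows "e \<in> carrier (free_right_module R X)" "lin_ext R M X \<phi> e = \<phi> x"
proof -
  interpret right_module R M by fact
  have sub: "{y \<in> X. e y \<noteq> \<zero>\<^bsub>R\<^esub>} \<subseteq> {x}" by (auto simp: e_def)
  then show e: "e \<in> carrier (free_right_module R X)"
    using finite_subset[OF sub] by (auto simp: e_def)
  have "lin_ext R M X \<phi> e = (\<Oplus>\<^bsub>M\<^esub>y\<in>{x}. e y \<odot>\<^bsub>M\<^esub> \<phi> y)"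
    by (rule lin_ext_superset[OF assms(1) e \<phi>]) (use sub x in auto)
  also have "\<dots> = \<phi> x" using x \<phi> by (auto simp: e_def Pi_iff)
  finally show "lin_ext R M X \<phi> e = \<phi> x" .
qed

text \<open>A coefficient list, read as an element of a free module.\<close>

definition syz_decode ::
  "('r, 'c) ring_scheme \<Rightarrow> ('m, 'r) syz set \<Rightarrow> ('m, 'r) syz \<Rightarrow> ('m, 'r) syz \<Rightarrow> 'r" where
  "syz_decode R X s =
    (case s of Rel l \<Rightarrow> (\<lambda>x\<in>X. case map_of l x of None \<Rightarrow> \<zero>\<^bsub>R\<^esub> | Some a \<Rightarrow> a) | Gen _ \<Rightarrow> undefined)"

lemma syz_decode_surj:
  assumes f: "f \<in> carrier (free_right_module R X)"
  shows "\<exists>l. syz_decode R X (Rel l) = f"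
proof -
  have "finite {x \<in> X. f x \<noteq> \<zero>\<^bsub>R\<^esub>}" using f by simp
  then obtain xs where xs: "set xs = {x \<in> X. f x \<noteq> \<zero>\<^bsub>R\<^esub>}" using finite_list by blast
  have "syz_decode R X (Rel (map (\<lambda>x. (x, f x)) xs)) = f"
    using f xs by (auto simp: fun_eq_iff syz_decode_def map_of_map_restrict restrict_map_def
        extensional_def PiE_iff split: option.splits)
  then show ?thesis by blast
qed

lemma projective_resolution_exists:
  fixes R :: "('r, 'c) ring_scheme" and M :: "('r, 'm) module"
  assumes "right_module R M"
  shows "\<exists>(P :: nat \<Rightarrow> ('r, ('m, 'r) syz \<Rightarrow> 'r) module) d \<epsilon>. projective_resolution R M P d \<epsilon>"
proof -
  interpret right_module R M by fact
  have ring: "ring R" by (rule R.ring_axioms)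
  define F where "F = (free_right_module R :: ('m, 'r) syz set \<Rightarrow> _)"
  have mod_F: "right_module R (F X)" for X
    unfolding F_def by (rule right_module_free[OF ring])
  define X0 where "X0 = (Gen :: 'm \<Rightarrow> ('m, 'r) syz) ` carrier M"
  define ungen where "ungen = (\<lambda>s :: ('m, 'r) syz. case s of Gen x \<Rightarrow> x | Rel _ \<Rightarrow> undefined)"
  define \<epsilon> where "\<epsilon> = lin_ext R M X0 ungen"
  define Z0 where "Z0 = {f \<in> carrier (F X0). \<epsilon> f = \<zero>\<^bsub>M\<^esub>}"
  define rels where "rels = (\<lambda>X Z. {s :: ('m, 'r) syz. s \<in> range Rel \<and> syz_decode R X s \<in> Z})"
  define bd where "bd = (\<lambda>X Y. lin_ext R (F X) Y (syz_decode R X))"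
  define step where "step = (\<lambda>(X, Z). (rels X Z,
      {f \<in> carrier (F (rels X Z)). bd X (rels X Z) f = \<zero>\<^bsub>F X\<^esub>}))"
  define st where "st = (\<lambda>n. (step ^^ n) (X0, Z0))"
  define X where "X = (\<lambda>n. fst (st n))"
  define Z where "Z = (\<lambda>n. snd (st n))"
  define d where "d = (\<lambda>n. bd (X n) (X (Suc n)))"
  have X_0: "X 0 = X0" and Z_0: "Z 0 = Z0" by (simp_all add: X_def Z_def st_def)
  have X_Suc: "X (Suc n) = rels (X n) (Z n)" for n
    by (simp add: X_def Z_def st_def step_def split: prod.splits)
  have Z_Suc: "Z (Suc n) = {f \<in> carrier (F (X (Suc n))). d n f = \<zero>\<^bsub>F (X n)\<^esub>}" for n
    by (simp add: X_def Z_def st_def step_def d_def split: prod.splits)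
  have Z_sub: "Z n \<subseteq> carrier (F (X n))" for n
    by (cases n) (auto simp: Z_0 Z0_def X_0 Z_Suc)
  have ungen: "ungen \<in> X0 \<rightarrow> carrier M" by (auto simp: X0_def ungen_def)
  have eps_hom: "\<epsilon> \<in> module_hom R (F (X 0)) M"
    unfolding \<epsilon>_def F_def X_0 by (rule lin_ext_hom[OF assms ungen])
  have dec: "syz_decode R (X n) \<in> X (Suc n) \<rightarrow> Z n" for n
    by (auto simp: X_Suc rels_def)
  then have dec': "syz_decode R (X n) \<in> X (Suc n) \<rightarrow> carrier (F (X n))" for n
    using Z_sub by blast
  have d_hom: "d n \<in> module_hom R (F (X (Suc n))) (F (X n))" for n
    unfolding d_def bd_def by (subst (1) F_def) (rule lin_ext_hom[OF mod_F dec'])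
  have eps_surj: "\<epsilon> ` carrier (F (X 0)) = carrier M"
  proof
    show "\<epsilon> ` carrier (F (X 0)) \<subseteq> carrier M" using eps_hom by (auto simp: module_hom_def)
    show "carrier M \<subseteq> \<epsilon> ` carrier (F (X 0))"
    proof
      fix x assume x: "x \<in> carrier M"
      then have "Gen x \<in> X0" by (simp add: X0_def)
      from lin_ext_basis[OF assms ungen this] show "x \<in> \<epsilon> ` carrier (F (X 0))"
        unfolding \<epsilon>_def F_def X_0 by (auto simp: ungen_def simp del: free_right_module_simps intro!: image_eqI)
    qed
  qed
  have closed: "lin_ext R (F (X n)) Y \<phi> f \<in> Z n"
    if "f \<in> carrier (F Y)" "\<phi> \<in> Y \<rightarrow> Z n" for n Y \<phi> f
  proof -
    interpret Fn: right_module R "F (X n)" by (rule mod_F)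
    have ker: "\<zero>\<^bsub>F (X n)\<^esub> \<in> Z n \<and> (\<forall>g\<in>Z n. \<forall>h\<in>Z n. g \<oplus>\<^bsub>F (X n)\<^esub> h \<in> Z n) \<and>
        (\<forall>a\<in>carrier R. \<forall>g\<in>Z n. a \<odot>\<^bsub>F (X n)\<^esub> g \<in> Z n)"
      if h: "h \<in> module_hom R (F (X n)) N" and N: "right_module R N"
        and Z: "Z n = {f \<in> carrier (F (X n)). h f = \<zero>\<^bsub>N\<^esub>}"
      for h and N :: "('r, 'z) module"
    proof -
      interpret N: right_module R N by fact
      have "h \<zero>\<^bsub>F (X n)\<^esub> = h (\<zero>\<^bsub>R\<^esub> \<odot>\<^bsub>F (X n)\<^esub> \<zero>\<^bsub>F (X n)\<^esub>)"
        by (simp del: free_right_module_simps)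
      also have "\<dots> = \<zero>\<^bsub>R\<^esub> \<odot>\<^bsub>N\<^esub> h \<zero>\<^bsub>F (X n)\<^esub>"
        using h unfolding module_hom_def by blast
      also have "\<dots> = \<zero>\<^bsub>N\<^esub>"
        using h unfolding module_hom_def by (intro N.smult_l_null) blast
      finally have "h \<zero>\<^bsub>F (X n)\<^esub> = \<zero>\<^bsub>N\<^esub>" .
      then show ?thesis
        using h unfolding Z module_hom_def by auto
    qed
    have sub: "\<zero>\<^bsub>F (X n)\<^esub> \<in> Z n" "\<And>g h. g \<in> Z n \<Longrightarrow> h \<in> Z n \<Longrightarrow> g \<oplus>\<^bsub>F (X n)\<^esub> h \<in> Z n"
      "\<And>a g. a \<in> carrier R \<Longrightarrow> g \<in> Z n \<Longrightarrow> a \<odot>\<^bsub>F (X n)\<^esub> g \<in> Z n"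
    proof -
      have "\<zero>\<^bsub>F (X n)\<^esub> \<in> Z n \<and> (\<forall>g\<in>Z n. \<forall>h\<in>Z n. g \<oplus>\<^bsub>F (X n)\<^esub> h \<in> Z n) \<and>
        (\<forall>a\<in>carrier R. \<forall>g\<in>Z n. a \<odot>\<^bsub>F (X n)\<^esub> g \<in> Z n)"
      proof (cases n)
        case 0
        show ?thesis
          using ker[of \<epsilon> M] eps_hom assms unfolding 0 by (simp add: Z_0 Z0_def X_0)
      next
        case (Suc m)
        show ?thesis
          using ker[of "d m" "F (X m)"] d_hom[of m] mod_F unfolding Suc by (simp add: Z_Suc)
      qed
      then show "\<zero>\<^bsub>F (X n)\<^esub> \<in> Z n" "\<And>g h. g \<in> Z n \<Longrightarrow> h \<in> Z n \<Longrightarrow> g \<oplus>\<^bsub>F (X n)\<^esub> h \<in> Z n"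
      "\<And>a g. a \<in> carrier R \<Longrightarrow> g \<in> Z n \<Longrightarrow> a \<odot>\<^bsub>F (X n)\<^esub> g \<in> Z n" by blast+
    qed
    have "finsum (F (X n)) t A \<in> Z n" if "finite A" "t \<in> A \<rightarrow> Z n" for t and A :: "('m, 'r) syz set"
      using that
    proof (induction A)
      case (insert a A)
      then have "t \<in> A \<rightarrow> carrier (F (X n))" "t a \<in> carrier (F (X n))" using Z_sub by blast+
      then have "finsum (F (X n)) t (insert a A) = t a \<oplus>\<^bsub>F (X n)\<^esub> finsum (F (X n)) t A"
        using insert by (intro Fn.finsum_insert) auto
      then show ?case using insert sub(2) by auto
    qed (use sub(1) in simp)
    moreover have "(\<lambda>x. f x \<odot>\<^bsub>F (X n)\<^esub> \<phi> x) \<in> {x \<in> Y. f x \<noteq> \<zero>\<^bsub>R\<^esub>} \<rightarrow> Z n"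
      using that by (auto simp: F_def PiE_iff Pi_iff simp del: free_right_module_simps(4)
          intro!: sub(3)[unfolded F_def])
    ultimately show ?thesis
      unfolding lin_ext_def using that(1) by (auto simp: F_def)
  qed
  have d_image: "d n ` carrier (F (X (Suc n))) = Z n" for n
  proof
    show "d n ` carrier (F (X (Suc n))) \<subseteq> Z n"
      unfolding d_def bd_def using closed[OF _ dec] by blast
    show "Z n \<subseteq> d n ` carrier (F (X (Suc n)))"
    proof
      fix f assume f: "f \<in> Z n"
      then obtain l where l: "syz_decode R (X n) (Rel l) = f"
        using syz_decode_surj[of f R "X n"] Z_sub unfolding F_def by blast
      then have "Rel l \<in> X (Suc n)" using f by (auto simp: X_Suc rels_def)
      note basis = lin_ext_basis[OF mod_F dec' this]
      show "f \<in> d n ` carrier (F (X (Suc n)))"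
        unfolding d_def bd_def
        by (rule image_eqI[OF _ basis(1)[folded F_def]]) (simp only: basis(2) l)
    qed
  qed
  have proj: "projective_module R (F Y)" for Y
    unfolding F_def by (rule projective_module_free[OF ring])
  have "projective_resolution R M (\<lambda>n. F (X n)) d \<epsilon>"
    unfolding projective_resolution_def
    using d_hom eps_hom eps_surj d_image Z_0 X_0 Z_Suc proj by (simp add: Z0_def)
  then show ?thesis by blast
qed


section \<open>The group algebra is a ring, and the modules over it are vector spaces\<close>

locale finite_group_algebra = G?: group G + K?: ring K
  for G :: "('g, 'b) monoid_scheme" (structure) and K :: "('k, 'a) ring_scheme" (structure) +
  assumes finite_G [simp, intro]: "finite (carrier G)"
begin

abbreviation KG where "KG \<equiv> group_algebra K G"

lemma group_algebra_simps [simp]: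
  "carrier KG = carrier G \<rightarrow>\<^sub>E carrier K"
  "zero KG = (\<lambda>g\<in>carrier G. \<zero>\<^bsub>K\<^esub>)"
  "add KG a b = (\<lambda>g\<in>carrier G. a g \<oplus>\<^bsub>K\<^esub> b g)"
  "one KG = group_algebra_scalar K G \<one>\<^bsub>K\<^esub>"
  by (simp_all add: group_algebra_def group_algebra_scalar_def)

lemma group_algebra_mult:
  assumes "g \<in> carrier G"
  shows "(a \<otimes>\<^bsub>KG\<^esub> b) g = (\<Oplus>\<^bsub>K\<^esub>h\<in>carrier G. a h \<otimes>\<^bsub>K\<^esub> b (inv\<^bsub>G\<^esub> h \<otimes>\<^bsub>G\<^esub> g))"
  using assms by (simp add: group_algebra_def)

lemma finsum_translate:
  assumes "f \<in> carrier G \<rightarrow> carrier K" "h \<in> carrier G"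
  shows "(\<Oplus>\<^bsub>K\<^esub>g\<in>carrier G. f (h \<otimes>\<^bsub>G\<^esub> g)) = (\<Oplus>\<^bsub>K\<^esub>g\<in>carrier G. f g)"
  using K.finsum_reindex[of f "\<lambda>g. h \<otimes>\<^bsub>G\<^esub> g" "carrier G"] assms
  by (simp add: G.surj_const_mult G.inj_on_cmult)

lemma group_algebra_mult_closed:
  assumes "a \<in> carrier KG" "b \<in> carrier KG"
  shows "a \<otimes>\<^bsub>KG\<^esub> b \<in> carrier KG"
proof -
  have "(\<Oplus>\<^bsub>K\<^esub>h\<in>carrier G. a h \<otimes>\<^bsub>K\<^esub> b (inv\<^bsub>G\<^esub> h \<otimes>\<^bsub>G\<^esub> g)) \<in> carrier K" if "g \<in> carrier G" for g
    using assms that by (intro K.finsum_closed) (auto simp: PiE_iff)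
  then show ?thesis by (simp add: group_algebra_def)
qed

lemma group_algebra_ext:
  assumes "a \<in> carrier KG" "b \<in> carrier KG" "\<And>g. g \<in> carrier G \<Longrightarrow> a g = b g"
  shows "a = b"
  using assms PiE_ext[of a "carrier G" "\<lambda>_. carrier K" b] by simp

lemma group_algebra_scalar_closed [simp]:
  "c \<in> carrier K \<Longrightarrow> group_algebra_scalar K G c \<in> carrier KG"
  by (simp add: group_algebra_scalar_def)

lemma group_algebra_scalar_mult:
  assumes "c \<in> carrier K" "b \<in> carrier KG" "g \<in> carrier G"
  shows "(group_algebra_scalar K G c \<otimes>\<^bsub>KG\<^esub> b) g = c \<otimes>\<^bsub>K\<^esub> b g"
proof -
  have "(group_algebra_scalar K G c \<otimes>\<^bsub>KG\<^esub> b) g =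
      (\<Oplus>\<^bsub>K\<^esub>h\<in>carrier G. if \<one>\<^bsub>G\<^esub> = h then c \<otimes>\<^bsub>K\<^esub> b (inv\<^bsub>G\<^esub> h \<otimes>\<^bsub>G\<^esub> g) else \<zero>\<^bsub>K\<^esub>)"
    unfolding group_algebra_mult[OF assms(3)] using assms
    by (intro K.add.finprod_cong') (auto simp: group_algebra_scalar_def PiE_iff)
  also have "\<dots> = c \<otimes>\<^bsub>K\<^esub> b (inv\<^bsub>G\<^esub> \<one>\<^bsub>G\<^esub> \<otimes>\<^bsub>G\<^esub> g)"
    using assms by (intro K.finsum_singleton) (auto simp: PiE_iff)
  finally show ?thesis using assms by simp
qed

lemma group_algebra_mult_one:
  assumes b: "b \<in> carrier KG" and g: "g \<in> carrier G"
  shows "(b \<otimes>\<^bsub>KG\<^esub> \<one>\<^bsub>KG\<^esub>) g = b g"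
proof -
  have "(b \<otimes>\<^bsub>KG\<^esub> \<one>\<^bsub>KG\<^esub>) g = (\<Oplus>\<^bsub>K\<^esub>h\<in>carrier G. if g = h then b h else \<zero>\<^bsub>K\<^esub>)"
    unfolding group_algebra_mult[OF g]
  proof (intro K.add.finprod_cong')
    fix h assume h: "h \<in> carrier G"
    have "inv\<^bsub>G\<^esub> h \<otimes>\<^bsub>G\<^esub> g = \<one>\<^bsub>G\<^esub> \<longleftrightarrow> g = h"
      using g h by (metis G.inv_closed G.inv_equality G.inv_inv G.l_inv)
    then show "b h \<otimes>\<^bsub>K\<^esub> \<one>\<^bsub>KG\<^esub> (inv\<^bsub>G\<^esub> h \<otimes>\<^bsub>G\<^esub> g) = (if g = h then b h else \<zero>\<^bsub>K\<^esub>)"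
      using b g h by (auto simp: group_algebra_scalar_def PiE_iff)
  qed (use b in \<open>auto simp: PiE_iff\<close>)
  also have "\<dots> = b g"
    using b g by (intro K.finsum_singleton) (auto simp: PiE_iff)
  finally show ?thesis .
qed

lemma group_algebra_mult_assoc:
  assumes a: "a \<in> carrier KG" and b: "b \<in> carrier KG" and c: "c \<in> carrier KG"
  shows "(a \<otimes>\<^bsub>KG\<^esub> b) \<otimes>\<^bsub>KG\<^esub> c = a \<otimes>\<^bsub>KG\<^esub> (b \<otimes>\<^bsub>KG\<^esub> c)"
proof (rule group_algebra_ext)
  fix g assume g: "g \<in> carrier G"
  have cl [simp]: "\<And>h. h \<in> carrier G \<Longrightarrow> a h \<in> carrier K" "\<And>h. h \<in> carrier G \<Longrightarrow> b h \<in> carrier K"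
    "\<And>h. h \<in> carrier G \<Longrightarrow> c h \<in> carrier K" using a b c by auto
  have bc: "(b \<otimes>\<^bsub>KG\<^esub> c) h \<in> carrier K" if "h \<in> carrier G" for h
    using group_algebra_mult_closed[OF b c] that by auto
  let ?t = "\<lambda>h k. a h \<otimes>\<^bsub>K\<^esub> (b (inv\<^bsub>G\<^esub> h \<otimes>\<^bsub>G\<^esub> k) \<otimes>\<^bsub>K\<^esub> c (inv\<^bsub>G\<^esub> k \<otimes>\<^bsub>G\<^esub> g))"
  have "((a \<otimes>\<^bsub>KG\<^esub> b) \<otimes>\<^bsub>KG\<^esub> c) g =
      (\<Oplus>\<^bsub>K\<^esub>k\<in>carrier G. (a \<otimes>\<^bsub>KG\<^esub> b) k \<otimes>\<^bsub>K\<^esub> c (inv\<^bsub>G\<^esub> k \<otimes>\<^bsub>G\<^esub> g))"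
    by (rule group_algebra_mult[OF g])
  also have "\<dots> = (\<Oplus>\<^bsub>K\<^esub>k\<in>carrier G. \<Oplus>\<^bsub>K\<^esub>h\<in>carrier G. ?t h k)"
    using g by (intro K.add.finprod_cong')
      (auto simp: group_algebra_mult K.finsum_ldistr K.m_assoc intro!: K.finsum_closed K.add.finprod_cong')
  also have "\<dots> = (\<Oplus>\<^bsub>K\<^esub>h\<in>carrier G. \<Oplus>\<^bsub>K\<^esub>k\<in>carrier G. ?t h k)"
    using g by (intro K.finsum_finsum_swap) auto
  also have "\<dots> = (\<Oplus>\<^bsub>K\<^esub>h\<in>carrier G. a h \<otimes>\<^bsub>K\<^esub> (b \<otimes>\<^bsub>KG\<^esub> c) (inv\<^bsub>G\<^esub> h \<otimes>\<^bsub>G\<^esub> g))"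
  proof (intro K.add.finprod_cong')
    fix h assume h: "h \<in> carrier G"
    have "(\<Oplus>\<^bsub>K\<^esub>k\<in>carrier G. ?t h k) = (\<Oplus>\<^bsub>K\<^esub>l\<in>carrier G. ?t h (h \<otimes>\<^bsub>G\<^esub> l))"
      using g h by (intro finsum_translate[symmetric]) auto
    also have "\<dots> = (\<Oplus>\<^bsub>K\<^esub>l\<in>carrier G. a h \<otimes>\<^bsub>K\<^esub>
        (b l \<otimes>\<^bsub>K\<^esub> c (inv\<^bsub>G\<^esub> l \<otimes>\<^bsub>G\<^esub> (inv\<^bsub>G\<^esub> h \<otimes>\<^bsub>G\<^esub> g))))"
      using g h by (intro K.add.finprod_cong') (auto simp: G.inv_mult_group G.m_assoc[symmetric])
    also have "\<dots> = a h \<otimes>\<^bsub>K\<^esub> (b \<otimes>\<^bsub>KG\<^esub> c) (inv\<^bsub>G\<^esub> h \<otimes>\<^bsub>G\<^esub> g)"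
      using g h by (subst group_algebra_mult) (auto intro!: K.finsum_rdistr[symmetric])
    finally show "(\<Oplus>\<^bsub>K\<^esub>k\<in>carrier G. ?t h k) = a h \<otimes>\<^bsub>K\<^esub> (b \<otimes>\<^bsub>KG\<^esub> c) (inv\<^bsub>G\<^esub> h \<otimes>\<^bsub>G\<^esub> g)" .
  qed (use g bc in auto)
  also have "\<dots> = (a \<otimes>\<^bsub>KG\<^esub> (b \<otimes>\<^bsub>KG\<^esub> c)) g"
    by (rule group_algebra_mult[OF g, symmetric])
  finally show "((a \<otimes>\<^bsub>KG\<^esub> b) \<otimes>\<^bsub>KG\<^esub> c) g = (a \<otimes>\<^bsub>KG\<^esub> (b \<otimes>\<^bsub>KG\<^esub> c)) g" .
qed (intro group_algebra_mult_closed assms)+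

lemma ring_group_algebra: "ring KG"
proof (rule ringI)
  show "abelian_group KG"
  proof (rule abelian_groupI)
    fix a assume a: "a \<in> carrier KG"
    then show "\<exists>b\<in>carrier KG. b \<oplus>\<^bsub>KG\<^esub> a = \<zero>\<^bsub>KG\<^esub>"
      by (intro bexI[of _ "\<lambda>g\<in>carrier G. \<ominus>\<^bsub>K\<^esub> a g"]) (auto simp: fun_eq_iff PiE_iff K.l_neg)
  qed (auto simp: fun_eq_iff PiE_iff extensional_def K.a_ac)
  have one: "\<one>\<^bsub>KG\<^esub> \<in> carrier KG"
    using group_algebra_scalar_closed[of "\<one>\<^bsub>K\<^esub>"] by simp
  show "monoid KG"
  proof (rule monoidI)
    show "\<one>\<^bsub>KG\<^esub> \<in> carrier KG" by (rule one)
    fix a assume a: "a \<in> carrier KG"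
    show "\<one>\<^bsub>KG\<^esub> \<otimes>\<^bsub>KG\<^esub> a = a"
      using group_algebra_scalar_mult[of "\<one>\<^bsub>K\<^esub>" a] a
      by (intro group_algebra_ext group_algebra_mult_closed one a) (auto simp: PiE_iff)
    show "a \<otimes>\<^bsub>KG\<^esub> \<one>\<^bsub>KG\<^esub> = a"
      by (intro group_algebra_ext group_algebra_mult_closed one a group_algebra_mult_one)
  qed (auto simp del: group_algebra_simps intro: group_algebra_mult_closed group_algebra_mult_assoc)
next
  fix a b c assume a: "a \<in> carrier KG" and b: "b \<in> carrier KG" and c: "c \<in> carrier KG"
  have cl [simp]: "\<And>h. h \<in> carrier G \<Longrightarrow> a h \<in> carrier K" "\<And>h. h \<in> carrier G \<Longrightarrow> b h \<in> carrier K"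
    "\<And>h. h \<in> carrier G \<Longrightarrow> c h \<in> carrier K" using a b c by auto
  have add: "x \<oplus>\<^bsub>KG\<^esub> y \<in> carrier KG" if "x \<in> carrier KG" "y \<in> carrier KG" for x y
    using that by auto
  note closed = group_algebra_mult_closed add a b c
  have tm: "(\<lambda>h. x h \<otimes>\<^bsub>K\<^esub> y (inv\<^bsub>G\<^esub> h \<otimes>\<^bsub>G\<^esub> g)) \<in> carrier G \<rightarrow> carrier K"
    if "g \<in> carrier G" "x \<in> carrier KG" "y \<in> carrier KG" for x y g
    using that by (auto simp: PiE_iff)
  show "(a \<oplus>\<^bsub>KG\<^esub> b) \<otimes>\<^bsub>KG\<^esub> c = a \<otimes>\<^bsub>KG\<^esub> c \<oplus>\<^bsub>KG\<^esub> b \<otimes>\<^bsub>KG\<^esub> c"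
  proof (intro group_algebra_ext closed)
    fix g assume g: "g \<in> carrier G"
    have "(\<Oplus>\<^bsub>K\<^esub>h\<in>carrier G. (a \<oplus>\<^bsub>KG\<^esub> b) h \<otimes>\<^bsub>K\<^esub> c (inv\<^bsub>G\<^esub> h \<otimes>\<^bsub>G\<^esub> g)) =
       (\<Oplus>\<^bsub>K\<^esub>h\<in>carrier G. a h \<otimes>\<^bsub>K\<^esub> c (inv\<^bsub>G\<^esub> h \<otimes>\<^bsub>G\<^esub> g) \<oplus>\<^bsub>K\<^esub> b h \<otimes>\<^bsub>K\<^esub> c (inv\<^bsub>G\<^esub> h \<otimes>\<^bsub>G\<^esub> g))"
      using g by (intro K.add.finprod_cong') (auto simp: K.l_distr)
    then show "((a \<oplus>\<^bsub>KG\<^esub> b) \<otimes>\<^bsub>KG\<^esub> c) g = (a \<otimes>\<^bsub>KG\<^esub> c \<oplus>\<^bsub>KG\<^esub> b \<otimes>\<^bsub>KG\<^esub> c) g"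
      using g tm[OF g a c] tm[OF g b c] by (simp only: group_algebra_mult K.finsum_addf) (simp add: g group_algebra_mult)
  qed
  show "c \<otimes>\<^bsub>KG\<^esub> (a \<oplus>\<^bsub>KG\<^esub> b) = c \<otimes>\<^bsub>KG\<^esub> a \<oplus>\<^bsub>KG\<^esub> c \<otimes>\<^bsub>KG\<^esub> b"
  proof (intro group_algebra_ext closed)
    fix g assume g: "g \<in> carrier G"
    have "(\<Oplus>\<^bsub>K\<^esub>h\<in>carrier G. c h \<otimes>\<^bsub>K\<^esub> (a \<oplus>\<^bsub>KG\<^esub> b) (inv\<^bsub>G\<^esub> h \<otimes>\<^bsub>G\<^esub> g)) =
       (\<Oplus>\<^bsub>K\<^esub>h\<in>carrier G. c h \<otimes>\<^bsub>K\<^esub> a (inv\<^bsub>G\<^esub> h \<otimes>\<^bsub>G\<^esub> g) \<oplus>\<^bsub>K\<^esub> c h \<otimes>\<^bsub>K\<^esub> b (inv\<^bsub>G\<^esub> h \<otimes>\<^bsub>G\<^esub> g))"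
      using g by (intro K.add.finprod_cong') (auto simp: K.r_distr)
    then show "(c \<otimes>\<^bsub>KG\<^esub> (a \<oplus>\<^bsub>KG\<^esub> b)) g = (c \<otimes>\<^bsub>KG\<^esub> a \<oplus>\<^bsub>KG\<^esub> c \<otimes>\<^bsub>KG\<^esub> b) g"
      using g tm[OF g c a] tm[OF g c b] by (simp only: group_algebra_mult K.finsum_addf) (simp add: g group_algebra_mult)
  qed
qed

lemma coefficient_sum_mult:
  assumes a: "a \<in> carrier KG" and b: "b \<in> carrier KG"
  shows "(\<Oplus>\<^bsub>K\<^esub>g\<in>carrier G. (a \<otimes>\<^bsub>KG\<^esub> b) g) =
    (\<Oplus>\<^bsub>K\<^esub>g\<in>carrier G. a g) \<otimes>\<^bsub>K\<^esub> (\<Oplus>\<^bsub>K\<^esub>g\<in>carrier G. b g)"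
proof -
  have cl [simp]: "\<And>h. h \<in> carrier G \<Longrightarrow> a h \<in> carrier K" "\<And>h. h \<in> carrier G \<Longrightarrow> b h \<in> carrier K"
    using a b by auto
  have sb: "(\<Oplus>\<^bsub>K\<^esub>g\<in>carrier G. b g) \<in> carrier K" by (intro K.finsum_closed) auto
  have "(\<Oplus>\<^bsub>K\<^esub>g\<in>carrier G. (a \<otimes>\<^bsub>KG\<^esub> b) g) =
      (\<Oplus>\<^bsub>K\<^esub>g\<in>carrier G. \<Oplus>\<^bsub>K\<^esub>h\<in>carrier G. a h \<otimes>\<^bsub>K\<^esub> b (inv\<^bsub>G\<^esub> h \<otimes>\<^bsub>G\<^esub> g))"
    by (intro K.add.finprod_cong') (auto simp: group_algebra_mult intro!: K.finsum_closed)
  also have "\<dots> = (\<Oplus>\<^bsub>K\<^esub>h\<in>carrier G. \<Oplus>\<^bsub>K\<^esub>g\<in>carrier G. a h \<otimes>\<^bsub>K\<^esub> b (inv\<^bsub>G\<^esub> h \<otimes>\<^bsub>G\<^esub> g))"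
    by (intro K.finsum_finsum_swap) auto
  also have "\<dots> = (\<Oplus>\<^bsub>K\<^esub>h\<in>carrier G. a h \<otimes>\<^bsub>K\<^esub> (\<Oplus>\<^bsub>K\<^esub>g\<in>carrier G. b g))"
  proof (intro K.add.finprod_cong')
    fix h assume h: "h \<in> carrier G"
    have "(\<Oplus>\<^bsub>K\<^esub>g\<in>carrier G. a h \<otimes>\<^bsub>K\<^esub> b (inv\<^bsub>G\<^esub> h \<otimes>\<^bsub>G\<^esub> g)) =
        a h \<otimes>\<^bsub>K\<^esub> (\<Oplus>\<^bsub>K\<^esub>g\<in>carrier G. b (inv\<^bsub>G\<^esub> h \<otimes>\<^bsub>G\<^esub> g))"
      using h by (intro K.finsum_rdistr[symmetric]) auto
    also have "(\<Oplus>\<^bsub>K\<^esub>g\<in>carrier G. b (inv\<^bsub>G\<^esub> h \<otimes>\<^bsub>G\<^esub> g)) = (\<Oplus>\<^bsub>K\<^esub>g\<in>carrier G. b g)"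
      using h by (intro finsum_translate) auto
    finally show "(\<Oplus>\<^bsub>K\<^esub>g\<in>carrier G. a h \<otimes>\<^bsub>K\<^esub> b (inv\<^bsub>G\<^esub> h \<otimes>\<^bsub>G\<^esub> g)) =
        a h \<otimes>\<^bsub>K\<^esub> (\<Oplus>\<^bsub>K\<^esub>g\<in>carrier G. b g)" .
  qed (use sb in auto)
  also have "\<dots> = (\<Oplus>\<^bsub>K\<^esub>g\<in>carrier G. a g) \<otimes>\<^bsub>K\<^esub> (\<Oplus>\<^bsub>K\<^esub>g\<in>carrier G. b g)"
    using sb by (intro K.finsum_ldistr[symmetric]) auto
  finally show ?thesis .
qed

lemma right_module_trivial: "right_module KG (trivial_module K G)"
proof -
  let ?T = "trivial_module K G"
  have simps [simp]: "carrier ?T = carrier K" "zero ?T = zero K" "add ?T = add K"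
    "smult ?T a x = x \<otimes>\<^bsub>K\<^esub> (\<Oplus>\<^bsub>K\<^esub>g\<in>carrier G. a g)" for a x
    by (simp_all add: trivial_module_def)
  have s [simp]: "(\<Oplus>\<^bsub>K\<^esub>g\<in>carrier G. a g) \<in> carrier K" if "a \<in> carrier KG" for a
    using that by (intro K.finsum_closed) auto
  have "abelian_group ?T"
    by (rule abelian_groupI) (auto simp: K.a_ac intro: K.add.inv_closed K.l_neg)
  then show ?thesis
  proof (intro right_module.intro right_module_axioms.intro ring_group_algebra)
    fix a b x assume a: "a \<in> carrier KG" and b: "b \<in> carrier KG" and x: "x \<in> carrier ?T"
    have "(\<Oplus>\<^bsub>K\<^esub>g\<in>carrier G. (a \<oplus>\<^bsub>KG\<^esub> b) g) = (\<Oplus>\<^bsub>K\<^esub>g\<in>carrier G. a g \<oplus>\<^bsub>K\<^esub> b g)"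
      using a b by (intro K.add.finprod_cong') auto
    also have "\<dots> = (\<Oplus>\<^bsub>K\<^esub>g\<in>carrier G. a g) \<oplus>\<^bsub>K\<^esub> (\<Oplus>\<^bsub>K\<^esub>g\<in>carrier G. b g)"
      using a b by (intro K.finsum_addf) auto
    finally show "(a \<oplus>\<^bsub>KG\<^esub> b) \<odot>\<^bsub>?T\<^esub> x = a \<odot>\<^bsub>?T\<^esub> x \<oplus>\<^bsub>?T\<^esub> b \<odot>\<^bsub>?T\<^esub> x"
      using s[OF a] s[OF b] x by (simp only: simps K.r_distr)
    show "(a \<otimes>\<^bsub>KG\<^esub> b) \<odot>\<^bsub>?T\<^esub> x = b \<odot>\<^bsub>?T\<^esub> (a \<odot>\<^bsub>?T\<^esub> x)"
      using s[OF a] s[OF b] x by (simp only: simps coefficient_sum_mult[OF a b] K.m_assoc)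
  next
    fix x assume x: "x \<in> carrier ?T"
    have "(\<Oplus>\<^bsub>K\<^esub>g\<in>carrier G. \<one>\<^bsub>KG\<^esub> g) = (\<Oplus>\<^bsub>K\<^esub>g\<in>carrier G. if \<one>\<^bsub>G\<^esub> = g then \<one>\<^bsub>K\<^esub> else \<zero>\<^bsub>K\<^esub>)"
      by (intro K.add.finprod_cong') (auto simp: group_algebra_scalar_def)
    also have "\<dots> = \<one>\<^bsub>K\<^esub>" by (intro K.finsum_singleton) auto
    finally show "\<one>\<^bsub>KG\<^esub> \<odot>\<^bsub>?T\<^esub> x = x" using x by simp
  next
    fix a x assume "a \<in> carrier KG" "x \<in> carrier ?T"
    then show "a \<odot>\<^bsub>?T\<^esub> x \<in> carrier ?T" using s by (simp del: group_algebra_simps)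
  next
    fix a x y assume "a \<in> carrier KG" "x \<in> carrier ?T" "y \<in> carrier ?T"
    then show "a \<odot>\<^bsub>?T\<^esub> (x \<oplus>\<^bsub>?T\<^esub> y) = a \<odot>\<^bsub>?T\<^esub> x \<oplus>\<^bsub>?T\<^esub> a \<odot>\<^bsub>?T\<^esub> y"
      using s by (simp del: group_algebra_simps add: K.l_distr)
  qed
qed

end

lemma vectorspace_underlying_space:
  assumes "group G" "finite (carrier G)" "field K" "right_module (group_algebra K G) M"
  shows "vectorspace K (underlying_space K G M)"
proof -
  interpret K: field K by fact
  interpret A: finite_group_algebra G K
    using assms by (intro finite_group_algebra.intro finite_group_algebra_axioms.intro K.ring_axioms)
  interpret M: right_module "group_algebra K G" M by fact
  let ?U = "underlying_space K G M" and ?s = "group_algebra_scalar K G"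
  have simps [simp]: "carrier ?U = carrier M" "zero ?U = zero M" "add ?U = add M"
    "smult ?U c x = ?s c \<odot>\<^bsub>M\<^esub> x" for c x
    by (simp_all add: underlying_space_def)
  have s_add: "?s (c \<oplus>\<^bsub>K\<^esub> e) = ?s c \<oplus>\<^bsub>group_algebra K G\<^esub> ?s e"
    if "c \<in> carrier K" "e \<in> carrier K" for c e
    using that by (auto simp: group_algebra_scalar_def fun_eq_iff)
  have s_mult: "?s (c \<otimes>\<^bsub>K\<^esub> e) = ?s e \<otimes>\<^bsub>group_algebra K G\<^esub> ?s c"
    if "c \<in> carrier K" "e \<in> carrier K" for c e
  proof (rule A.group_algebra_ext)
    fix g assume "g \<in> carrier G"
    then show "?s (c \<otimes>\<^bsub>K\<^esub> e) g = (?s e \<otimes>\<^bsub>group_algebra K G\<^esub> ?s c) g"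
      using A.group_algebra_scalar_mult[OF that(2) A.group_algebra_scalar_closed[OF that(1)], of g] that
      by (auto simp: group_algebra_scalar_def K.m_comm)
  qed (use that in \<open>simp_all only: A.group_algebra_mult_closed A.group_algebra_scalar_closed K.m_closed\<close>)
  have one: "?s \<one>\<^bsub>K\<^esub> = \<one>\<^bsub>group_algebra K G\<^esub>" by simp
  have "abelian_group ?U"
    by (rule abelian_groupI) (auto simp: M.M.a_ac intro: M.M.add.inv_closed M.M.l_neg)
  then have "module K ?U"
    by (intro moduleI K.cring_axioms)
      (auto simp: s_add s_mult one M.smult_l_distr M.smult_r_distr M.smult_assoc
        simp del: A.group_algebra_simps)
  then show ?thesis by (intro vectorspace.intro K.field_axioms)
qed

end

theory Submission imports Defs "Jordan_Normal_Form.VS_Connect" begin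

text \<open>A nonzero class in \<open>Ext\<^sup>1(K, K)\<close> is a nonzero additive character \<open>\<phi>\<close> from \<open>G\<close> to \<open>K\<close>.
  Let \<open>G\<close> act by translation on the image \<open>X\<close> of \<open>\<phi>\<close>, and suppose \<open>H\<^sup>n(G, K) = 0\<close>.  The functions from
  \<open>X\<close> to \<open>K\<close> are filtered by polynomial degree with trivial quotients \<open>K\<close>; hence \<open>H\<^sup>n(G, K\<^sup>X) = 0\<close>, and the
  space of cocycles with values in \<open>K\<^sup>X\<close> has \<open>|X|\<close> times the dimension of the one with values in \<open>K\<close>.
  The cochains form a permutation complex, whose cocycles have at least the dimension over \<open>K\<close> that
  they have over the rationals; vanishing of the cohomology at one place forces equality there.  The
  rational augmented complexes are acyclic, so the differences \<open>e\<^sub>l = dim Z\<^sub>l(X) - |X| dim Z\<^sub>l(pt)\<close> satisfy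
  \<open>e\<^sub>l\<^sub>+\<^sub>1 = - e\<^sub>l\<close> and \<open>e\<^sub>1 = 1 - |X|\<close>.  Therefore \<open>|X| = 1\<close>, and \<open>\<phi>\<close> vanishes.

  If \<open>Ext\<^sup>n(M, M) = 0\<close>, then \<open>c \<cdot> id\<^sub>M\<close> is a coboundary for every cocycle \<open>c\<close> with values in \<open>K\<close>.  The trace of
  a bounding cochain, divided by \<open>dim M\<close>, bounds \<open>c\<close>, so that \<open>H\<^sup>n(G, K) = 0\<close>.\<close>

section \<open>Dimensions of spaces of functions\<close>

text \<open>Cohomology is assumed to vanish in a single degree, so everything has to be read off
  from the dimensions of the cocycle spaces next to it. Cochain spaces have bases indexed by orbits,
  hence the same dimension over every field. Where the complex over \<open>K\<close> is exact,
  rank-nullity writes this dimension as a sum of two cocycle dimensions. Each summand is at least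
  its rational counterpart, and the rational ones have the same sum, so both inequalities are
  equalities. The set \<open>X\<close> is taken inside \<open>K\<close> itself so that functions on
  it can be treated as polynomials. Translation keeps the leading coefficient of a polynomial; this
  is why the quotients of the filtration are trivial. The counting needs the homogeneous complex,
  whose terms are finite-dimensional, whereas \<open>Ext\<close> comes from an unknown projective
  resolution whose terms may be infinite-dimensional. Dimension shifting through the kernels of the
  resolution links the two, with coefficients in the \<open>K\<close>-linear maps from
  \<open>M\<close> to \<open>N\<close>; the choice of \<open>M\<close> for both arguments makes a
  trace available.\<close>

definition fun_module :: "('f, 'a) ring_scheme \<Rightarrow> ('i \<Rightarrow> 'f) set \<Rightarrow> ('f, 'i \<Rightarrow> 'f) module" where
  "fun_module F W = \<lparr>carrier = W, mult = undefined, one = undefined, zero = (\<lambda>_. \<zero>\<^bsub>F\<^esub>),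
     add = (\<lambda>f g i. f i \<oplus>\<^bsub>F\<^esub> g i), smult = (\<lambda>a f i. a \<otimes>\<^bsub>F\<^esub> f i)\<rparr>"

lemma fun_module_simps [simp]:
  "carrier (fun_module F W) = W"
  "zero (fun_module F W) = (\<lambda>_. \<zero>\<^bsub>F\<^esub>)"
  "add (fun_module F W) = (\<lambda>f g i. f i \<oplus>\<^bsub>F\<^esub> g i)"
  "smult (fun_module F W) = (\<lambda>a f i. a \<otimes>\<^bsub>F\<^esub> f i)"
  by (simp_all add: fun_module_def)

definition fun_subspace :: "('f, 'a) ring_scheme \<Rightarrow> ('i \<Rightarrow> 'f) set \<Rightarrow> bool" where
  "fun_subspace F W \<longleftrightarrow> (\<forall>f\<in>W. \<forall>i. f i \<in> carrier F) \<and> (\<lambda>_. \<zero>\<^bsub>F\<^esub>) \<in> W \<and>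
     (\<forall>f\<in>W. \<forall>g\<in>W. (\<lambda>i. f i \<oplus>\<^bsub>F\<^esub> g i) \<in> W) \<and> (\<forall>a\<in>carrier F. \<forall>f\<in>W. (\<lambda>i. a \<otimes>\<^bsub>F\<^esub> f i) \<in> W)"

abbreviation fun_dim :: "('f, 'a) ring_scheme \<Rightarrow> ('i \<Rightarrow> 'f) set \<Rightarrow> nat" where
  "fun_dim F W \<equiv> vectorspace.dim F (fun_module F W)"

text \<open>Restriction of \<open>W\<close> to the coordinates in \<open>J\<close> is injective.
  Dimension bounds are phrased through coordinate sets because such a set makes sense over every
  field at once, so a bound over one field can be carried to another.\<close>

definition determines :: "('f, 'a) ring_scheme \<Rightarrow> 'i set \<Rightarrow> ('i \<Rightarrow> 'f) set \<Rightarrow> bool" where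
  "determines F J W \<longleftrightarrow> (\<forall>w\<in>W. (\<forall>j\<in>J. w j = \<zero>\<^bsub>F\<^esub>) \<longrightarrow> w = (\<lambda>_. \<zero>\<^bsub>F\<^esub>))"

context field
begin

lemma fun_subspaceD:
  assumes "fun_subspace R W"
  shows "\<And>f i. f \<in> W \<Longrightarrow> f i \<in> carrier R" "(\<lambda>_. \<zero>) \<in> W"
    "\<And>f g. f \<in> W \<Longrightarrow> g \<in> W \<Longrightarrow> (\<lambda>i. f i \<oplus> g i) \<in> W"
    "\<And>a f. a \<in> carrier R \<Longrightarrow> f \<in> W \<Longrightarrow> (\<lambda>i. a \<otimes> f i) \<in> W"
    "\<And>f g. f \<in> W \<Longrightarrow> g \<in> W \<Longrightarrow> (\<lambda>i. f i \<ominus> g i) \<in> W"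
proof -
  show *: "\<And>f i. f \<in> W \<Longrightarrow> f i \<in> carrier R" "(\<lambda>_. \<zero>) \<in> W"
    "\<And>f g. f \<in> W \<Longrightarrow> g \<in> W \<Longrightarrow> (\<lambda>i. f i \<oplus> g i) \<in> W"
    "\<And>a f. a \<in> carrier R \<Longrightarrow> f \<in> W \<Longrightarrow> (\<lambda>i. a \<otimes> f i) \<in> W"
    using assms unfolding fun_subspace_def by blast+
  fix f g assume f: "f \<in> W" and g: "g \<in> W"
  have "(\<lambda>i. f i \<oplus> (\<lambda>i. (\<ominus> \<one>) \<otimes> g i) i) \<in> W"
    using *(3)[OF f *(4)[of "\<ominus> \<one>" g]] g by simp
  then show "(\<lambda>i. f i \<ominus> g i) \<in> W" using *(1)[OF g] by (simp add: a_minus_def l_minus)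
qed

lemma vectorspace_fun_module:
  assumes W: "fun_subspace R W"
  shows "vectorspace R (fun_module R W)"
proof -
  note * = fun_subspaceD[OF W]
  have "abelian_group (fun_module R W)"
  proof (rule abelian_groupI)
    fix f assume f: "f \<in> carrier (fun_module R W)"
    then have "(\<lambda>i. (\<ominus> \<one>) \<otimes> f i) \<in> W" using *(4)[of "\<ominus> \<one>" f] by simp
    then have "(\<lambda>i. \<ominus> f i) \<in> W" using f *(1) by (simp add: l_minus)
    then show "\<exists>g\<in>carrier (fun_module R W). g \<oplus>\<^bsub>fun_module R W\<^esub> f = \<zero>\<^bsub>fun_module R W\<^esub>"
      using f *(1) by (intro bexI[of _ "\<lambda>i. \<ominus> f i"]) (auto simp: l_neg)
  qed (use * in \<open>auto simp: fun_eq_iff a_ac\<close>)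
  then have "module R (fun_module R W)"
    using * by (intro moduleI is_cring) (auto simp: fun_eq_iff l_distr r_distr m_assoc)
  then show ?thesis by (intro vectorspace.intro field_axioms)
qed

lemma fun_module_lincomb:
  assumes W: "fun_subspace R W" and A: "finite A" "A \<subseteq> W" "a \<in> A \<rightarrow> carrier R"
  shows "module.lincomb (fun_module R W) a A = (\<lambda>i. \<Oplus>w\<in>A. a w \<otimes> w i)"
proof -
  interpret V: vectorspace R "fun_module R W" by (rule vectorspace_fun_module[OF W])
  note * = fun_subspaceD[OF W]
  show ?thesis
    using A
  proof (induction A)
    case empty
    then show ?case by (simp add: V.lincomb_def)
  next
    case (insert v A)
    have "module.lincomb (fun_module R W) a (A \<union> {v}) =
        a v \<odot>\<^bsub>fun_module R W\<^esub> v \<oplus>\<^bsub>fun_module R W\<^esub> module.lincomb (fun_module R W) a A"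
      using insert by (intro V.lincomb_insert) auto
    also have "\<dots> = (\<lambda>i. a v \<otimes> v i \<oplus> (\<Oplus>w\<in>A. a w \<otimes> w i))"
      using insert by (simp add: Pi_iff)
    also have "\<dots> = (\<lambda>i. \<Oplus>w\<in>insert v A. a w \<otimes> w i)"
      using insert *(1) by (intro ext finsum_insert[symmetric]) (auto simp: Pi_iff subset_iff)
    finally show ?case by simp
  qed
qed

text \<open>Evaluation at the points of \<open>J\<close> shows that the \<open>e j\<close> are
  independent. They span because \<open>w\<close> and the combination of the \<open>e j\<close> with
  coefficients \<open>w j\<close> agree on \<open>J\<close>, and \<open>J\<close> determines
  elements of \<open>W\<close>.\<close>

lemma fun_dim_eq_card:
  assumes W: "fun_subspace R W" and J: "finite J" "determines R J W"
    and dual: "\<And>j. j \<in> J \<Longrightarrow> e j \<in> W \<and> e j j = \<one> \<and> (\<forall>i\<in>J - {j}. e j i = \<zero>)"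
  shows "vectorspace.fin_dim R (fun_module R W)" "fun_dim R W = card J"
proof -
  interpret V: vectorspace R "fun_module R W" by (rule vectorspace_fun_module[OF W])
  note * = fun_subspaceD[OF W]
  have inj: "inj_on e J"
    using dual by (intro inj_onI) (metis DiffI singletonD zero_not_one)
  have E: "finite (e ` J)" "e ` J \<subseteq> W" using J dual by auto
  have lc: "module.lincomb (fun_module R W) a (e ` J) j = a (e j)"
    if a: "a \<in> e ` J \<rightarrow> carrier R" and j: "j \<in> J" for a j
  proof -
    have "module.lincomb (fun_module R W) a (e ` J) j = (\<Oplus>w\<in>e ` J. a w \<otimes> w j)"
      using fun_module_lincomb[OF W E a] by simp
    also have "\<dots> = (\<Oplus>w\<in>e ` J. if e j = w then a w else \<zero>)"
    proof (intro add.finprod_cong')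
      fix w assume "w \<in> e ` J"
      then obtain i where i: "i \<in> J" "w = e i" by blast
      then show "a w \<otimes> w j = (if e j = w then a w else \<zero>)"
        using a j dual[OF i(1)] dual[OF j] by (cases "i = j") (auto simp: Pi_iff)
    qed (use a in auto)
    also have "\<dots> = a (e j)"
      using E j a by (intro finsum_singleton) auto
    finally show ?thesis .
  qed
  have lc_closed: "module.lincomb (fun_module R W) a (e ` J) \<in> W" if "a \<in> e ` J \<rightarrow> carrier R" for a
    using V.lincomb_closed[of "e ` J" a] that E by simp
  have "V.lin_indpt (e ` J)"
  proof (rule V.finite_lin_indpt2)
    fix a assume a: "a \<in> e ` J \<rightarrow> carrier R" "V.lincomb a (e ` J) = \<zero>\<^bsub>fun_module R W\<^esub>"
    show "\<forall>v\<in>e ` J. a v = \<zero>"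
    proof
      fix v assume "v \<in> e ` J"
      then obtain j where "j \<in> J" "v = e j" by blast
      then show "a v = \<zero>" using lc[OF a(1)] a(2) by simp
    qed
  qed (use E in auto)
  moreover have gen: "V.gen_set (e ` J)"
  proof
    show "V.span (e ` J) \<subseteq> carrier (fun_module R W)"
      using E by (intro V.span_is_subset2) auto
    show "carrier (fun_module R W) \<subseteq> V.span (e ` J)"
    proof
      fix w assume "w \<in> carrier (fun_module R W)"
      then have w: "w \<in> W" by simp
      \<comment> \<open>The basis is an image set, so coefficients are indexed by functions
        \<open>v\<close>; injectivity of \<open>e\<close> on \<open>J\<close> recovers the point of
        \<open>J\<close> that belongs to \<open>v\<close>.\<close>
      define a where "a = (\<lambda>v. w (inv_into J e v))"
      have a: "a \<in> e ` J \<rightarrow> carrier R" using w *(1) by (auto simp: a_def)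
      let ?l = "V.lincomb a (e ` J)"
      have l: "?l \<in> W" by (rule lc_closed[OF a])
      have "?l j = w j" if "j \<in> J" for j
        using lc[OF a that] inj that by (simp add: a_def inv_into_f_f)
      then have "(\<lambda>i. ?l i \<ominus> w i) = (\<lambda>_. \<zero>)"
        using J(2) *(5)[OF l w] *(1)[OF l] *(1)[OF w] unfolding determines_def by auto
      then have "?l i = w i" for i
        using *(1)[OF l, of i] *(1)[OF w, of i] by (metis minus_other_side)
      then have "w = ?l" by auto
      then show "w \<in> V.span (e ` J)"
        using E a unfolding V.span_def by blast
    qed
  qed
  ultimately have "V.basis (e ` J)" using E by (auto simp: V.basis_def)
  then show "V.dim = card J"
    using V.dim_basis[OF E(1)] card_image[OF inj] by simp
  show "V.fin_dim" unfolding V.fin_dim_def using E gen by auto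
qed

text \<open>Removing \<open>j\<close> from a minimal set leaves a nonzero function that vanishes on
  the rest, hence not at \<open>j\<close>. Rescaled, it is dual to \<open>j\<close>, so a minimal
  determining set is a set of pivots.\<close>

lemma determines_minimal:
  assumes W: "fun_subspace R W" and J: "finite J" "determines R J W"
  obtains J' where "J' \<subseteq> J" "determines R J' W" "vectorspace.fin_dim R (fun_module R W)"
    "fun_dim R W = card J'"
proof -
  note * = fun_subspaceD[OF W]
  obtain J' where J': "J' \<subseteq> J" "minimal J' (\<lambda>J. determines R J W)"
    using minimal_exists[of J "\<lambda>J. determines R J W"] J by blast
  then have det: "determines R J' W" and min: "\<And>I. I \<subset> J' \<Longrightarrow> \<not> determines R I W"
    unfolding minimal_def by auto
  have "\<exists>e. e \<in> W \<and> e j = \<one> \<and> (\<forall>i\<in>J' - {j}. e i = \<zero>)" if j: "j \<in> J'" for j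
  proof -
    have "\<not> determines R (J' - {j}) W" using j by (intro min) auto
    then obtain w where w: "w \<in> W" "\<forall>i\<in>J' - {j}. w i = \<zero>" "w \<noteq> (\<lambda>_. \<zero>)"
      unfolding determines_def by blast
    then have wj: "w j \<noteq> \<zero>" using det j unfolding determines_def by blast
    then have "inv (w j) \<in> carrier R" using *(1)[OF w(1)] by simp
    moreover have "inv (w j) \<otimes> w j = \<one>"
      using wj *(1)[OF w(1), of j] field_Units by (intro Units_l_inv) auto
    ultimately show ?thesis
      using w *(4)[of "inv (w j)" w] by (intro exI[of _ "\<lambda>i. inv (w j) \<otimes> w i"]) auto
  qed
  then obtain e where "\<And>j. j \<in> J' \<Longrightarrow> e j \<in> W \<and> e j j = \<one> \<and> (\<forall>i\<in>J' - {j}. e j i = \<zero>)"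
    by metis
  from fun_dim_eq_card[OF W _ det this] show ?thesis
    using that[of J'] J' det finite_subset[OF J'(1) J(1)] by auto
qed

lemma fun_dim_le:
  assumes "fun_subspace R W" "finite J" "determines R J W"
  shows "fun_dim R W \<le> card J" "vectorspace.fin_dim R (fun_module R W)"
  using determines_minimal[OF assms] card_mono[OF assms(2)] by metis+

text \<open>Image and kernel are plain sets of functions again, so the formula can be applied
  repeatedly along a filtration. The determining set supplies finite dimension.\<close>

lemma fun_rank_nullity:
  assumes W: "fun_subspace R W" and J: "finite J" "determines R J W"
    and W': "fun_subspace R W'" and T: "T ` W = W'"
    and add: "\<And>f g. f \<in> W \<Longrightarrow> g \<in> W \<Longrightarrow> T (\<lambda>i. f i \<oplus> g i) = (\<lambda>i. T f i \<oplus> T g i)"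
    and smult: "\<And>a f. a \<in> carrier R \<Longrightarrow> f \<in> W \<Longrightarrow> T (\<lambda>i. a \<otimes> f i) = (\<lambda>i. a \<otimes> T f i)"
  shows "fun_dim R W = fun_dim R W' + fun_dim R {f \<in> W. T f = (\<lambda>_. \<zero>)}"
proof -
  interpret V: vectorspace R "fun_module R W" by (rule vectorspace_fun_module[OF W])
  interpret V': vectorspace R "fun_module R W'" by (rule vectorspace_fun_module[OF W'])
  interpret T: linear_map R "fun_module R W" "fun_module R W'" T
    by unfold_locales (use T add smult in \<open>auto simp: LinearCombinations.module_hom_def\<close>)
  have "vectorspace.dim R (V'.vs T.imT) + vectorspace.dim R (V.vs T.kerT) = V.dim"
    using fun_dim_le(2)[OF W J] by (rule T.rank_nullity)
  moreover have "T.imT = W'" "T.kerT = {f \<in> W. T f = (\<lambda>_. \<zero>)}"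
    using T by (simp_all add: T.im_def T.ker_def)
  ultimately show ?thesis by (simp add: fun_module_def)
qed

end

section \<open>Homogeneous cochains\<close>

definition tuples :: "'g set \<Rightarrow> nat \<Rightarrow> 'g list set" where
  "tuples S l = {\<sigma>. set \<sigma> \<subseteq> S \<and> length \<sigma> = l}"

lemma tuples_0 [simp]: "tuples S 0 = {[]}"
  by (auto simp: tuples_def)

lemma Nil_in_tuples [simp]: "[] \<in> tuples S l \<longleftrightarrow> l = 0"
  by (auto simp: tuples_def)

lemma Cons_in_tuples [simp]: "g # \<sigma> \<in> tuples S l \<longleftrightarrow> g \<in> S \<and> (\<exists>k. l = Suc k \<and> \<sigma> \<in> tuples S k)"
  by (cases l) (auto simp: tuples_def)

lemma tuples_SucE:
  assumes "\<sigma> \<in> tuples S (Suc l)"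
  obtains g \<tau> where "\<sigma> = g # \<tau>" "g \<in> S" "\<tau> \<in> tuples S l"
  using assms by (cases \<sigma>) auto

lemma finite_tuples: "finite S \<Longrightarrow> finite (tuples S l)"
  unfolding tuples_def by (rule finite_lists_length_eq)

lemma card_tuples: "finite S \<Longrightarrow> card (tuples S l) = card S ^ l"
  unfolding tuples_def by (rule card_lists_length_eq)

text \<open>The alternating sum of \<open>c\<close> over the lists that arise from \<open>\<sigma>\<close> by deleting one entry.  A list of
  length \<open>l\<close> has degree \<open>l - 1\<close>; since \<open>delta V c [g] = c []\<close>, the complex is augmented.\<close>

fun delta :: "('v, 'e) ring_scheme \<Rightarrow> ('g list \<Rightarrow> 'v) \<Rightarrow> 'g list \<Rightarrow> 'v" where
  "delta V c [] = \<zero>\<^bsub>V\<^esub>"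
| "delta V c (g # \<sigma>) = c \<sigma> \<ominus>\<^bsub>V\<^esub> delta V (\<lambda>\<tau>. c (g # \<tau>)) \<sigma>"

lemma delta_cong:
  assumes "\<sigma> \<in> tuples S (Suc l)" "\<And>\<tau>. \<tau> \<in> tuples S l \<Longrightarrow> c \<tau> = c' \<tau>"
  shows "delta V c \<sigma> = delta V c' \<sigma>"
  using assms
proof (induction \<sigma> arbitrary: l c c')
  case (Cons g \<sigma>)
  show ?case
  proof (cases l)
    case (Suc k)
    have "delta V (\<lambda>\<tau>. c (g # \<tau>)) \<sigma> = delta V (\<lambda>\<tau>. c' (g # \<tau>)) \<sigma>"
      using Cons.prems Suc by (intro Cons.IH[of k]) auto
    then show ?thesis using Cons.prems by simp
  qed (use Cons.prems in auto)
qed simp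

lemma delta_map: "delta V c (map f \<sigma>) = delta V (\<lambda>\<tau>. c (map f \<tau>)) \<sigma>"
  by (induction \<sigma> arbitrary: c) simp_all

context abelian_group
begin

lemma diff_zero [simp]: "x \<in> carrier G \<Longrightarrow> x \<ominus> \<zero> = x"
  using minus_equality[of \<zero> \<zero>] by (simp add: a_minus_def)

lemma delta_closed:
  assumes "\<sigma> \<in> tuples S (Suc l)" "\<And>\<tau>. \<tau> \<in> tuples S l \<Longrightarrow> c \<tau> \<in> carrier G"
  shows "delta G c \<sigma> \<in> carrier G"
  using assms
proof (induction \<sigma> arbitrary: l c)
  case (Cons g \<sigma>)
  show ?case
  proof (cases l)
    case (Suc k)
    have "delta G (\<lambda>\<tau>. c (g # \<tau>)) \<sigma> \<in> carrier G"
      using Cons.prems Suc by (intro Cons.IH[of k]) auto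
    then show ?thesis using Cons.prems by simp
  qed (use Cons.prems in auto)
qed simp

lemma delta_zero: "delta G (\<lambda>_. \<zero>) \<sigma> = \<zero>"
  by (induction \<sigma>) (simp_all add: a_minus_def)

lemma delta_add:
  assumes "\<sigma> \<in> tuples S (Suc l)" "\<And>\<tau>. \<tau> \<in> tuples S l \<Longrightarrow> c \<tau> \<in> carrier G"
    "\<And>\<tau>. \<tau> \<in> tuples S l \<Longrightarrow> d \<tau> \<in> carrier G"
  shows "delta G (\<lambda>\<tau>. c \<tau> \<oplus> d \<tau>) \<sigma> = delta G c \<sigma> \<oplus> delta G d \<sigma>"
  using assms
proof (induction \<sigma> arbitrary: l c d)
  case (Cons g \<sigma>)
  show ?case
  proof (cases l)
    case (Suc k)
    have \<sigma>: "\<sigma> \<in> tuples S l" "g \<in> S" using Cons.prems by auto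
    let ?c = "delta G (\<lambda>\<tau>. c (g # \<tau>)) \<sigma>" and ?d = "delta G (\<lambda>\<tau>. d (g # \<tau>)) \<sigma>"
    have cl: "?c \<in> carrier G" "?d \<in> carrier G"
      using Cons.prems Suc by (intro delta_closed[of _ S k]; auto)+
    have "delta G (\<lambda>\<tau>. c (g # \<tau>) \<oplus> d (g # \<tau>)) \<sigma> = ?c \<oplus> ?d"
      using Cons.prems Suc by (intro Cons.IH[of k]) auto
    moreover have "c \<sigma> \<in> carrier G" "d \<sigma> \<in> carrier G" using Cons.prems \<sigma> by auto
    ultimately show ?thesis using cl by (simp add: a_minus_def minus_add a_ac)
  qed (use Cons.prems in \<open>auto\<close>)
qed simp

text \<open>Scalars, group elements, coordinate functions and the passage from integers to a field
  all act as additive maps on the coefficients; each compatibility with the coboundary used later is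
  an instance of this.\<close>

lemma delta_hom:
  assumes "abelian_group H" "T \<in> carrier G \<rightarrow> carrier H"
    and add: "\<And>x y. x \<in> carrier G \<Longrightarrow> y \<in> carrier G \<Longrightarrow> T (x \<oplus> y) = T x \<oplus>\<^bsub>H\<^esub> T y"
    and "\<sigma> \<in> tuples S (Suc l)" "\<And>\<tau>. \<tau> \<in> tuples S l \<Longrightarrow> c \<tau> \<in> carrier G"
  shows "T (delta G c \<sigma>) = delta H (\<lambda>\<tau>. T (c \<tau>)) \<sigma>"
proof -
  interpret H: abelian_group H by fact
  have T [simp]: "T x \<in> carrier H" if "x \<in> carrier G" for x using assms(2) that by auto
  have zero: "T \<zero> = \<zero>\<^bsub>H\<^esub>"
    using add[of \<zero> \<zero>] H.add.r_cancel_one'[of "T \<zero>" "T \<zero>"] by simp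
  have diff: "T (x \<ominus> y) = T x \<ominus>\<^bsub>H\<^esub> T y" if "x \<in> carrier G" "y \<in> carrier G" for x y
  proof -
    have "T (\<ominus> y) \<oplus>\<^bsub>H\<^esub> T y = \<zero>\<^bsub>H\<^esub>"
      using add[of "\<ominus> y" y] that zero by (simp add: l_neg)
    then have "T (\<ominus> y) = \<ominus>\<^bsub>H\<^esub> T y" using that by (intro H.minus_equality[symmetric]) auto
    then show ?thesis using that by (simp add: a_minus_def a_minus_def add)
  qed
  show ?thesis
    using assms(4,5)
  proof (induction \<sigma> arbitrary: l c)
    case (Cons g \<sigma>)
    show ?case
    proof (cases l)
      case 0
      then show ?thesis using Cons.prems by (simp add: diff zero)
    next
      case (Suc k)
      have "T (delta G (\<lambda>\<tau>. c (g # \<tau>)) \<sigma>) = delta H (\<lambda>\<tau>. T (c (g # \<tau>))) \<sigma>"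
        using Cons.prems Suc by (intro Cons.IH[of k]) auto
      moreover have "delta G (\<lambda>\<tau>. c (g # \<tau>)) \<sigma> \<in> carrier G"
        using Cons.prems Suc by (intro delta_closed[of _ S k]) auto
      ultimately show ?thesis using Cons.prems by (simp add: diff)
    qed
  qed (simp add: zero)
qed

lemma delta_minus:
  assumes "\<sigma> \<in> tuples S (Suc l)" "\<And>\<tau>. \<tau> \<in> tuples S l \<Longrightarrow> c \<tau> \<in> carrier G"
    "\<And>\<tau>. \<tau> \<in> tuples S l \<Longrightarrow> d \<tau> \<in> carrier G"
  shows "delta G (\<lambda>\<tau>. c \<tau> \<ominus> d \<tau>) \<sigma> = delta G c \<sigma> \<ominus> delta G d \<sigma>"
proof -
  have "delta G (\<lambda>\<tau>. c \<tau> \<ominus> d \<tau>) \<sigma> = delta G (\<lambda>\<tau>. c \<tau> \<oplus> (\<ominus> d \<tau>)) \<sigma>"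
    by (simp add: a_minus_def)
  also have "\<dots> = delta G c \<sigma> \<oplus> delta G (\<lambda>\<tau>. \<ominus> d \<tau>) \<sigma>"
    using assms by (intro delta_add) auto
  also have "delta G (\<lambda>\<tau>. \<ominus> d \<tau>) \<sigma> = \<ominus> delta G d \<sigma>"
    using assms by (intro delta_hom[symmetric, of G "\<lambda>x. \<ominus> x"])
      (auto simp: minus_add a_ac intro: abelian_group_axioms)
  finally show ?thesis by (simp add: a_minus_def)
qed

lemma delta_finsum:
  assumes "finite I" "\<sigma> \<in> tuples S (Suc l)"
    "\<And>i \<tau>. i \<in> I \<Longrightarrow> \<tau> \<in> tuples S l \<Longrightarrow> c i \<tau> \<in> carrier G"
  shows "delta G (\<lambda>\<tau>. \<Oplus>i\<in>I. c i \<tau>) \<sigma> = (\<Oplus>i\<in>I. delta G (c i) \<sigma>)"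
  using assms(1,3)
proof (induction I)
  case empty
  then show ?case by (simp add: delta_zero)
next
  case (insert j I)
  have "delta G (\<lambda>\<tau>. \<Oplus>i\<in>insert j I. c i \<tau>) \<sigma> = delta G (\<lambda>\<tau>. c j \<tau> \<oplus> (\<Oplus>i\<in>I. c i \<tau>)) \<sigma>"
    using insert by (intro delta_cong[OF assms(2)] finsum_insert) auto
  also have "\<dots> = delta G (c j) \<sigma> \<oplus> delta G (\<lambda>\<tau>. \<Oplus>i\<in>I. c i \<tau>) \<sigma>"
    using insert by (intro delta_add[OF assms(2)] finsum_closed) auto
  also have "\<dots> = delta G (c j) \<sigma> \<oplus> (\<Oplus>i\<in>I. delta G (c i) \<sigma>)"
    using insert by simp
  also have "\<dots> = (\<Oplus>i\<in>insert j I. delta G (c i) \<sigma>)"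
    using insert assms(2) by (intro finsum_insert[symmetric]) (auto intro!: delta_closed)
  finally show ?case .
qed

text \<open>On \<open>g # \<sigma>\<close> the outer recursion subtracts the coboundary of
  \<open>\<lambda>\<tau>. delta G c (g # \<tau>)\<close> from \<open>delta G c \<sigma>\<close>. The
  inner recursion and the induction hypothesis identify the subtracted term with
  \<open>delta G c \<sigma>\<close>.\<close>

lemma delta_delta:
  assumes "\<sigma> \<in> tuples S (Suc (Suc l))" "\<And>\<tau>. \<tau> \<in> tuples S l \<Longrightarrow> c \<tau> \<in> carrier G"
  shows "delta G (delta G c) \<sigma> = \<zero>"
  using assms
proof (induction \<sigma> arbitrary: l c)
  case (Cons g \<sigma>)
  have \<sigma>: "\<sigma> \<in> tuples S (Suc l)" "g \<in> S" using Cons.prems by auto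
  have cl: "delta G c \<sigma> \<in> carrier G" using \<sigma> Cons.prems by (intro delta_closed) auto
  have "delta G (\<lambda>\<tau>. delta G c (g # \<tau>)) \<sigma> = delta G c \<sigma> \<ominus> delta G (delta G (\<lambda>\<tau>. c (g # \<tau>))) \<sigma>"
  proof (cases l)
    case 0
    then show ?thesis
      using \<sigma> Cons.prems(2) by (auto elim!: tuples_SucE)
  next
    case (Suc k)
    have "delta G (\<lambda>\<tau>. c \<tau> \<ominus> delta G (\<lambda>\<tau>. c (g # \<tau>)) \<tau>) \<sigma> =
        delta G c \<sigma> \<ominus> delta G (delta G (\<lambda>\<tau>. c (g # \<tau>))) \<sigma>"
      using \<sigma> Cons.prems Suc by (intro delta_minus) (auto intro!: delta_closed[of _ S k])
    then show ?thesis by simp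
  qed
  also have "delta G (delta G (\<lambda>\<tau>. c (g # \<tau>))) \<sigma> = \<zero>"
  proof (cases l)
    case 0
    then show ?thesis using \<sigma> by (auto elim!: tuples_SucE)
  next
    case (Suc k)
    then show ?thesis using Cons.IH[of k "\<lambda>\<tau>. c (g # \<tau>)"] Cons.prems \<sigma> by auto
  qed
  finally show ?case using cl by simp
qed simp

end

section \<open>Cochains with coefficients in the functions on the image of a character\<close>

locale additive_character = G?: group G + K?: abelian_group K
  for G :: "('g, 'b) monoid_scheme" (structure) and K :: "('k, 'a) ring_scheme" (structure) +
  fixes \<phi> :: "'g \<Rightarrow> 'k"
  assumes finite_G [simp, intro]: "finite (carrier G)"
    and char_closed [simp]: "g \<in> carrier G \<Longrightarrow> \<phi> g \<in> carrier K"
    and char_mult: "g \<in> carrier G \<Longrightarrow> h \<in> carrier G \<Longrightarrow> \<phi> (g \<otimes>\<^bsub>G\<^esub> h) = \<phi> g \<oplus>\<^bsub>K\<^esub> \<phi> h"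
begin

definition index :: "nat \<Rightarrow> ('k \<times> 'g list) set" where
  "index l = \<phi> ` carrier G \<times> tuples (carrier G) l"

definition act :: "'g \<Rightarrow> 'k \<times> 'g list \<Rightarrow> 'k \<times> 'g list" where
  "act h = (\<lambda>(x, \<sigma>). (x \<oplus>\<^bsub>K\<^esub> \<phi> h, map (\<lambda>g. g \<otimes>\<^bsub>G\<^esub> h) \<sigma>))"

text \<open>Equivariant maps from \<open>l\<close>-tuples to functions on the image of
  \<open>\<phi>\<close>, uncurried to invariant functions on a product. The coefficients
  \<open>V\<close> are independent of \<open>K\<close>, so the same index set serves the integers,
  the rationals and \<open>K\<close>. The value zero off the index set makes equality of cochains
  equality of functions.\<close>

definition cochains :: "('v, 'e) ring_scheme \<Rightarrow> nat \<Rightarrow> ('k \<times> 'g list \<Rightarrow> 'v) set" where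
  "cochains V l = {c. (\<forall>i. c i \<in> carrier V) \<and> (\<forall>i. i \<notin> index l \<longrightarrow> c i = \<zero>\<^bsub>V\<^esub>) \<and>
     (\<forall>i\<in>index l. \<forall>h\<in>carrier G. c (act h i) = c i)}"

definition cobd :: "('v, 'e) ring_scheme \<Rightarrow> nat \<Rightarrow> ('k \<times> 'g list \<Rightarrow> 'v) \<Rightarrow> 'k \<times> 'g list \<Rightarrow> 'v" where
  "cobd V l c = (\<lambda>(x, \<sigma>). if (x, \<sigma>) \<in> index (Suc l) then delta V (\<lambda>\<tau>. c (x, \<tau>)) \<sigma> else \<zero>\<^bsub>V\<^esub>)"

definition cocycles :: "('v, 'e) ring_scheme \<Rightarrow> nat \<Rightarrow> ('k \<times> 'g list \<Rightarrow> 'v) set" where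
  "cocycles V l = {c \<in> cochains V l. cobd V l c = (\<lambda>_. \<zero>\<^bsub>V\<^esub>)}"

text \<open>Lists of length \<open>Suc l\<close> have degree \<open>l\<close>, so this is vanishing
  in degree \<open>l\<close> of the augmented complex. In degree zero it says that invariants come
  from the augmentation.\<close>

definition exact_at :: "('v, 'e) ring_scheme \<Rightarrow> nat \<Rightarrow> bool" where
  "exact_at V l \<longleftrightarrow> cocycles V (Suc l) \<subseteq> cobd V l ` cochains V l"

lemma char_one [simp]: "\<phi> \<one>\<^bsub>G\<^esub> = \<zero>\<^bsub>K\<^esub>"
  using char_mult[of "\<one>\<^bsub>G\<^esub>" "\<one>\<^bsub>G\<^esub>"] K.add.r_cancel_one'[of "\<phi> \<one>\<^bsub>G\<^esub>" "\<phi> \<one>\<^bsub>G\<^esub>"] by simp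

lemma finite_index [simp, intro]: "finite (index l)"
  unfolding index_def by (intro finite_cartesian_product finite_tuples) auto

lemma act_closed:
  assumes "i \<in> index l" "h \<in> carrier G"
  shows "act h i \<in> index l"
proof -
  obtain g \<sigma> where i: "i = (\<phi> g, \<sigma>)" "g \<in> carrier G" "\<sigma> \<in> tuples (carrier G) l"
    using assms by (auto simp: index_def)
  then have "act h i = (\<phi> (g \<otimes>\<^bsub>G\<^esub> h), map (\<lambda>g. g \<otimes>\<^bsub>G\<^esub> h) \<sigma>)"
    using assms by (simp add: act_def char_mult)
  then show ?thesis using i assms by (auto simp: index_def tuples_def)
qed

lemma cochainsD:
  assumes "c \<in> cochains V l"
  shows "\<And>i. c i \<in> carrier V" "\<And>i. i \<notin> index l \<Longrightarrow> c i = \<zero>\<^bsub>V\<^esub>"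
    "\<And>i h. i \<in> index l \<Longrightarrow> h \<in> carrier G \<Longrightarrow> c (act h i) = c i"
  using assms unfolding cochains_def by auto

lemma map_mult_closed: "\<sigma> \<in> tuples (carrier G) l \<Longrightarrow> h \<in> carrier G \<Longrightarrow>
    map (\<lambda>g. g \<otimes>\<^bsub>G\<^esub> h) \<sigma> \<in> tuples (carrier G) l"
  by (auto simp: tuples_def)

lemma bij_mult: "h \<in> carrier G \<Longrightarrow> bij_betw (\<lambda>g. g \<otimes>\<^bsub>G\<^esub> h) (carrier G) (carrier G)"
  by (rule bij_betw_byWitness[where f' = "\<lambda>g. g \<otimes>\<^bsub>G\<^esub> inv\<^bsub>G\<^esub> h"]) (auto simp: G.m_assoc)

lemma cobd_cocycle:
  assumes V: "abelian_group V" and c: "c \<in> cochains V l"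
  shows "cobd V l c \<in> cocycles V (Suc l)"
proof -
  interpret V: abelian_group V by fact
  note * = cochainsD[OF c]
  have cl: "delta V (\<lambda>\<tau>. c (x, \<tau>)) \<sigma> \<in> carrier V" if "(x, \<sigma>) \<in> index (Suc l)" for x \<sigma>
    using that *(1) by (intro V.delta_closed[of _ "carrier G" l]) (auto simp: index_def)
  have eqv: "cobd V l c (act h (x, \<sigma>)) = cobd V l c (x, \<sigma>)"
    if i: "(x, \<sigma>) \<in> index (Suc l)" and h: "h \<in> carrier G" for x \<sigma> h
  proof -
    have "cobd V l c (act h (x, \<sigma>)) =
        delta V (\<lambda>\<tau>. c (x \<oplus>\<^bsub>K\<^esub> \<phi> h, \<tau>)) (map (\<lambda>g. g \<otimes>\<^bsub>G\<^esub> h) \<sigma>)"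
      using act_closed[OF i h] by (simp add: cobd_def act_def)
    also have "\<dots> = delta V (\<lambda>\<tau>. c (act h (x, \<tau>))) \<sigma>"
      by (simp add: delta_map act_def)
    also have "\<dots> = delta V (\<lambda>\<tau>. c (x, \<tau>)) \<sigma>"
      using i h *(3) by (intro delta_cong[of _ "carrier G" l]) (auto simp: index_def)
    finally show ?thesis using i by (simp add: cobd_def)
  qed
  have "cobd V (Suc l) (cobd V l c) (x, \<sigma>) = \<zero>\<^bsub>V\<^esub>" for x \<sigma>
  proof (cases "(x, \<sigma>) \<in> index (Suc (Suc l))")
    case True
    then have "cobd V (Suc l) (cobd V l c) (x, \<sigma>) = delta V (\<lambda>\<tau>. cobd V l c (x, \<tau>)) \<sigma>"
      by (simp add: cobd_def)
    also have "\<dots> = delta V (delta V (\<lambda>\<tau>. c (x, \<tau>))) \<sigma>"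
      using True by (intro delta_cong[of _ "carrier G" "Suc l"]) (auto simp: cobd_def index_def)
    also have "\<dots> = \<zero>\<^bsub>V\<^esub>"
      using True *(1) by (intro V.delta_delta[of _ "carrier G" l]) (auto simp: index_def)
    finally show ?thesis .
  qed (simp add: cobd_def)
  then show ?thesis
    unfolding cocycles_def cochains_def
    using cl eqv by (auto simp: cobd_def fun_eq_iff simp del: split_paired_All)
qed

text \<open>The two directions are used in succession: a rational cocycle with integer values is
  pulled back along the embedding of the integers, and the integral cocycle is then pushed into
  another field.\<close>

lemma cocycle_transfer:
  assumes V: "abelian_group V" and V': "abelian_group V'" and T: "T \<in> carrier V \<rightarrow> carrier V'"
    and add: "\<And>x y. x \<in> carrier V \<Longrightarrow> y \<in> carrier V \<Longrightarrow> T (x \<oplus>\<^bsub>V\<^esub> y) = T x \<oplus>\<^bsub>V'\<^esub> T y"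
    and c: "\<And>i. c i \<in> carrier V"
  shows "c \<in> cocycles V l \<Longrightarrow> T \<circ> c \<in> cocycles V' l"
    "inj_on T (carrier V) \<Longrightarrow> T \<circ> c \<in> cocycles V' l \<Longrightarrow> c \<in> cocycles V l"
proof -
  interpret V: abelian_group V by fact
  interpret V': abelian_group V' by fact
  have zero: "T \<zero>\<^bsub>V\<^esub> = \<zero>\<^bsub>V'\<^esub>"
    using add[of "\<zero>\<^bsub>V\<^esub>" "\<zero>\<^bsub>V\<^esub>"] V'.add.r_cancel_one'[of "T \<zero>\<^bsub>V\<^esub>" "T \<zero>\<^bsub>V\<^esub>"] T
    by (simp add: Pi_iff)
  have eq: "cobd V' l (T \<circ> c) = T \<circ> cobd V l c"
  proof (intro ext, clarify)
    fix x \<sigma>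
    show "cobd V' l (T \<circ> c) (x, \<sigma>) = (T \<circ> cobd V l c) (x, \<sigma>)"
      using V.delta_hom[OF V' T add, of \<sigma> "carrier G" l "\<lambda>\<tau>. c (x, \<tau>)"] c
      by (auto simp: cobd_def zero index_def)
  qed
  have cobd_closed: "cobd V l c i \<in> carrier V" for i
    using c by (auto simp: cobd_def index_def split: prod.splits
        intro!: V.delta_closed[of _ "carrier G" l])
  show "T \<circ> c \<in> cocycles V' l" if "c \<in> cocycles V l"
    using that T zero eq by (auto simp: cocycles_def cochains_def Pi_iff fun_eq_iff)
  show "c \<in> cocycles V l" if inj: "inj_on T (carrier V)" and Tc: "T \<circ> c \<in> cocycles V' l"
  proof -
    have T0: "x = \<zero>\<^bsub>V\<^esub>" if "x \<in> carrier V" "T x = \<zero>\<^bsub>V'\<^esub>" for x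
      using inj_onD[OF inj, of x "\<zero>\<^bsub>V\<^esub>"] that zero by simp
    have "T \<circ> cobd V l c = (\<lambda>_. \<zero>\<^bsub>V'\<^esub>)"
      using Tc eq by (simp add: cocycles_def)
    then have "cobd V l c = (\<lambda>_. \<zero>\<^bsub>V\<^esub>)"
      using T0[OF cobd_closed] by (auto simp: fun_eq_iff simp del: split_paired_All)
    moreover have "c \<in> cochains V l"
      using Tc c T0 inj_onD[OF inj] by (auto simp: cocycles_def cochains_def simp del: split_paired_All)
    ultimately show ?thesis by (simp add: cocycles_def)
  qed
qed

section \<open>The complex over a coefficient field: dimensions and exactness\<close>

context
  fixes F :: "('f, 'd) ring_scheme"
  assumes F: "field F"
begin

interpretation F: field F by (rule F)

lemma fun_subspace_cochains: "fun_subspace F (cochains F l)"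
  unfolding fun_subspace_def cochains_def by (auto simp del: split_paired_All)

lemma cobd_add:
  assumes "\<And>i. c i \<in> carrier F" "\<And>i. d i \<in> carrier F"
  shows "cobd F l (\<lambda>i. c i \<oplus>\<^bsub>F\<^esub> d i) = (\<lambda>i. cobd F l c i \<oplus>\<^bsub>F\<^esub> cobd F l d i)"
  using assms by (auto simp: cobd_def fun_eq_iff index_def intro!: F.delta_add)

lemma cobd_smult:
  assumes "\<And>i. c i \<in> carrier F" "a \<in> carrier F"
  shows "cobd F l (\<lambda>i. a \<otimes>\<^bsub>F\<^esub> c i) = (\<lambda>i. a \<otimes>\<^bsub>F\<^esub> cobd F l c i)"
  using assms by (auto simp: cobd_def fun_eq_iff index_def F.r_distr
      intro!: F.delta_hom[symmetric, of F "\<lambda>x. a \<otimes>\<^bsub>F\<^esub> x"] F.abelian_group_axioms)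

lemma fun_subspace_cocycles: "fun_subspace F (cocycles F l)"
proof -
  note * = F.fun_subspaceD[OF fun_subspace_cochains[of l]]
  have "cobd F l (\<lambda>_. \<zero>\<^bsub>F\<^esub>) = (\<lambda>_. \<zero>\<^bsub>F\<^esub>)"
    by (auto simp: cobd_def fun_eq_iff F.delta_zero)
  then show ?thesis
    unfolding fun_subspace_def cocycles_def
    using * cobd_add[of _ _ l] cobd_smult[of _ _ l] by auto
qed

lemma determines_cochains: "W \<subseteq> cochains F l \<Longrightarrow> determines F (index l) W"
  unfolding determines_def cochains_def by (auto simp: fun_eq_iff subset_iff simp del: split_paired_All)

lemma fun_subspace_cobd_image: "fun_subspace F (cobd F l ` cochains F l)"
  unfolding fun_subspace_def
proof (intro conjI ballI allI)
  note * = F.fun_subspaceD[OF fun_subspace_cochains[of l]]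
  note ** = F.fun_subspaceD[OF fun_subspace_cocycles[of "Suc l"]]
  note b = cobd_cocycle[OF F.abelian_group_axioms]
  show "f i \<in> carrier F" if "f \<in> cobd F l ` cochains F l" for f i
    using that b **(1) by blast
  show "(\<lambda>_. \<zero>\<^bsub>F\<^esub>) \<in> cobd F l ` cochains F l"
    by (rule image_eqI[OF _ *(2)]) (auto simp: cobd_def fun_eq_iff F.delta_zero)
  show "(\<lambda>i. f i \<oplus>\<^bsub>F\<^esub> g i) \<in> cobd F l ` cochains F l"
    if fg: "f \<in> cobd F l ` cochains F l" "g \<in> cobd F l ` cochains F l" for f g
  proof -
    obtain c d where "c \<in> cochains F l" "f = cobd F l c" "d \<in> cochains F l" "g = cobd F l d"
      using fg by blast
    then show ?thesis
      using *(1,3) cobd_add[of c d l] by (intro image_eqI[of _ _ "\<lambda>i. c i \<oplus>\<^bsub>F\<^esub> d i"]) auto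
  qed
  show "(\<lambda>i. a \<otimes>\<^bsub>F\<^esub> f i) \<in> cobd F l ` cochains F l"
    if a: "a \<in> carrier F" and f: "f \<in> cobd F l ` cochains F l" for f a
  proof -
    obtain c where "c \<in> cochains F l" "f = cobd F l c" using f by blast
    then show ?thesis
      using a *(1,4) cobd_smult[of c a l] by (intro image_eqI[of _ _ "\<lambda>i. a \<otimes>\<^bsub>F\<^esub> c i"]) auto
  qed
qed

text \<open>By exactness the image of the coboundary is the whole next cocycle space, so
  rank-nullity involves cocycles only.\<close>

lemma fun_dim_cochains:
  assumes "exact_at F l"
  shows "fun_dim F (cochains F l) = fun_dim F (cocycles F (Suc l)) + fun_dim F (cocycles F l)"
proof -
  have "cobd F l ` cochains F l = cocycles F (Suc l)"
    using assms cobd_cocycle[OF F.abelian_group_axioms] by (auto simp: exact_at_def)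
  moreover have "fun_dim F (cochains F l) = fun_dim F (cobd F l ` cochains F l) +
      fun_dim F {c \<in> cochains F l. cobd F l c = (\<lambda>_. \<zero>\<^bsub>F\<^esub>)}"
    by (rule F.fun_rank_nullity[OF fun_subspace_cochains finite_index determines_cochains
          fun_subspace_cobd_image refl])
      (auto intro!: cobd_add cobd_smult dest: cochainsD(1))
  ultimately show ?thesis by (simp add: cocycles_def)
qed

text \<open>\<open>G\<close> acts transitively on the image of \<open>\<phi>\<close>, so an
  invariant function without list entries is a constant, fixed by its value at the image of the
  identity.\<close>

lemma fun_dim_cochains_0: "fun_dim F (cochains F 0) = 1"
proof -
  let ?i = "(\<zero>\<^bsub>K\<^esub>, [])"
  have i: "?i \<in> index 0" by (auto simp: index_def image_iff intro!: bexI[of _ "\<one>\<^bsub>G\<^esub>"])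
  have "determines F {?i} (cochains F 0)"
    unfolding determines_def
  proof (intro ballI impI ext)
    fix c i assume c: "c \<in> cochains F 0" and 0: "\<forall>j\<in>{?i}. c j = \<zero>\<^bsub>F\<^esub>"
    show "c i = \<zero>\<^bsub>F\<^esub>"
    proof (cases "i \<in> index 0")
      case True
      then obtain h where "h \<in> carrier G" "i = act h ?i" by (auto simp: index_def act_def)
      then show ?thesis using cochainsD(3)[OF c i] 0 by simp
    qed (use cochainsD(2)[OF c] in auto)
  qed
  moreover have "(\<lambda>i. if i \<in> index 0 then \<one>\<^bsub>F\<^esub> else \<zero>\<^bsub>F\<^esub>) \<in> cochains F 0"
    using act_closed[of _ 0] by (auto simp: cochains_def simp del: split_paired_All)
  ultimately show ?thesis
    using F.fun_dim_eq_card(2)[OF fun_subspace_cochains, of "{?i}" 0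
        "\<lambda>_ i. if i \<in> index 0 then \<one>\<^bsub>F\<^esub> else \<zero>\<^bsub>F\<^esub>"] i by simp
qed

text \<open>With at least one list entry the action is free, and every orbit has exactly one member
  whose first entry is the identity. Orbit indicators are dual to these representatives; fixing the
  first entry is what lowers the exponent to \<open>l\<close>.\<close>

lemma fun_dim_cochains_Suc:
  "fun_dim F (cochains F (Suc l)) = card (\<phi> ` carrier G) * card (carrier G) ^ l"
proof -
  define J where "J = (\<lambda>(x, \<tau>). (x, \<one>\<^bsub>G\<^esub> # \<tau>)) ` index l"
  have J: "J \<subseteq> index (Suc l)" by (auto simp: J_def index_def)
  have norm: "\<exists>j\<in>J. \<exists>h\<in>carrier G. i = act h j" if i: "i \<in> index (Suc l)" for i
  proof -
    obtain x g \<tau> where g: "i = (x, g # \<tau>)" "g \<in> carrier G" and i': "act (inv\<^bsub>G\<^esub> g) i \<in> index (Suc l)"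
      using i act_closed[OF i] by (auto simp: index_def elim: tuples_SucE)
    have inv: "act g (act (inv\<^bsub>G\<^esub> g) i) = i"
    proof -
      have "x \<in> carrier K" "set \<tau> \<subseteq> carrier G" using i g by (auto simp: index_def tuples_def)
      moreover have "\<phi> (inv\<^bsub>G\<^esub> g) \<oplus>\<^bsub>K\<^esub> \<phi> g = \<zero>\<^bsub>K\<^esub>" using g char_mult[of "inv\<^bsub>G\<^esub> g" g] by simp
      ultimately show ?thesis
        using g by (auto simp: act_def K.a_assoc G.m_assoc subset_iff intro!: map_idI)
    qed
    have "act (inv\<^bsub>G\<^esub> g) i \<in> J"
      using i' g by (auto simp: J_def act_def index_def image_iff)
    then show ?thesis using inv g by (metis)
  qed
  have det: "determines F J (cochains F (Suc l))"
    unfolding determines_def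
  proof (intro ballI impI ext)
    fix c i assume c: "c \<in> cochains F (Suc l)" and 0: "\<forall>j\<in>J. c j = \<zero>\<^bsub>F\<^esub>"
    show "c i = \<zero>\<^bsub>F\<^esub>"
    proof (cases "i \<in> index (Suc l)")
      case True
      then obtain h j where "j \<in> J" "h \<in> carrier G" "i = act h j" using norm by blast
      then show ?thesis using cochainsD(3)[OF c subsetD[OF J]] 0 by metis
    qed (use cochainsD(2)[OF c] in auto)
  qed
  have act_act: "act h (act g i) = act (g \<otimes>\<^bsub>G\<^esub> h) i"
    if "i \<in> index l" "g \<in> carrier G" "h \<in> carrier G" for i g h l
    using that by (auto simp: act_def index_def tuples_def char_mult K.a_assoc G.m_assoc subset_iff)
  have act_1: "act \<one>\<^bsub>G\<^esub> i = i" if "i \<in> index l" for i l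
    using that by (auto simp: act_def index_def tuples_def subset_iff intro!: map_idI)
  define e where "e = (\<lambda>j i. if \<exists>h\<in>carrier G. i = act h j then \<one>\<^bsub>F\<^esub> else \<zero>\<^bsub>F\<^esub>)"
  have dual: "e j \<in> cochains F (Suc l) \<and> e j j = \<one>\<^bsub>F\<^esub> \<and> (\<forall>i\<in>J - {j}. e j i = \<zero>\<^bsub>F\<^esub>)" if j: "j \<in> J" for j
  proof (intro conjI ballI)
    have j': "j \<in> index (Suc l)" using j J by blast
    show "e j j = \<one>\<^bsub>F\<^esub>" using act_1[OF j'] G.one_closed unfolding e_def by metis
    show "e j i = \<zero>\<^bsub>F\<^esub>" if "i \<in> J - {j}" for i
    proof -
      have "i \<noteq> act h j" if h: "h \<in> carrier G" for h
      proof
        assume "i = act h j"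
        \<comment> \<open>Both representatives begin with the identity, while \<open>act h\<close>
          multiplies the first entry by \<open>h\<close>.\<close>
        then have "h = \<one>\<^bsub>G\<^esub>" using \<open>i \<in> J - {j}\<close> j h by (auto simp: J_def act_def)
        then show False using act_1[OF j'] \<open>i = act h j\<close> \<open>i \<in> J - {j}\<close> by simp
      qed
      then show ?thesis by (auto simp: e_def)
    qed
    have "(\<exists>k\<in>carrier G. act h i = act k j) \<longleftrightarrow> (\<exists>k\<in>carrier G. i = act k j)"
      if i: "i \<in> index (Suc l)" and h: "h \<in> carrier G" for i h
    proof
      assume "\<exists>k\<in>carrier G. act h i = act k j"
      then obtain k where k: "k \<in> carrier G" "act h i = act k j" by blast
      then have "act (inv\<^bsub>G\<^esub> h) (act h i) = act (k \<otimes>\<^bsub>G\<^esub> inv\<^bsub>G\<^esub> h) j"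
        using h j' by (simp add: act_act[OF j'])
      then have "i = act (k \<otimes>\<^bsub>G\<^esub> inv\<^bsub>G\<^esub> h) j" using act_act[OF i] act_1[OF i] h by simp
      then show "\<exists>k\<in>carrier G. i = act k j" using k h by blast
    next
      assume "\<exists>k\<in>carrier G. i = act k j"
      then show "\<exists>k\<in>carrier G. act h i = act k j" using act_act[OF j'] h by (metis G.m_closed)
    qed
    then show "e j \<in> cochains F (Suc l)"
      using act_closed[OF j'] by (auto simp: cochains_def e_def simp del: split_paired_All)
  qed
  have "fun_dim F (cochains F (Suc l)) = card J"
    by (rule F.fun_dim_eq_card(2)[OF fun_subspace_cochains finite_subset[OF J finite_index] det dual])
  also have "card J = card (index l)"
    unfolding J_def by (rule card_image) (auto simp: inj_on_def)
  also have "\<dots> = card (\<phi> ` carrier G) * card (carrier G) ^ l"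
    by (simp add: index_def card_cartesian_product card_tuples)
  finally show ?thesis .
qed

text \<open>The augmentation is injective: the coboundary at a list with one entry returns the value
  at the empty list.\<close>

lemma fun_dim_cocycles_0: "fun_dim F (cocycles F 0) = 0"
proof -
  have *: "c (x, []) = \<zero>\<^bsub>F\<^esub>" if c: "c \<in> cocycles F 0" and x: "x \<in> \<phi> ` carrier G" for c x
  proof -
    have "(x, [\<one>\<^bsub>G\<^esub>]) \<in> index (Suc 0)" using x by (auto simp: index_def)
    then have "cobd F 0 c (x, [\<one>\<^bsub>G\<^esub>]) = c (x, []) \<ominus>\<^bsub>F\<^esub> \<zero>\<^bsub>F\<^esub>"
      by (simp add: cobd_def)
    also have "\<dots> = c (x, [])"
      using cochainsD(1)[of c F 0 "(x, [])"] c by (simp add: cocycles_def)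
    finally show ?thesis using c by (simp add: cocycles_def)
  qed
  have "determines F {} (cocycles F 0)"
    unfolding determines_def
  proof (intro ballI impI ext)
    fix c i assume c: "c \<in> cocycles F 0"
    show "c i = \<zero>\<^bsub>F\<^esub>"
    proof (cases "i \<in> index 0")
      case True
      then show ?thesis using *[OF c] by (auto simp: index_def)
    next
      case False
      then show ?thesis using c cochainsD(2)[of c F 0] by (simp add: cocycles_def)
    qed
  qed
  then show ?thesis using F.fun_dim_le(1)[OF fun_subspace_cocycles, of "{}" 0] by simp
qed

text \<open>Prepending a fixed \<open>g\<close> contracts the complex but does not respect the
  action. The mean over all \<open>g\<close> does, with \<open>u\<close> in the role of the inverse
  of the group order.\<close>

lemma exact_if_invertible_order:
  assumes u: "u \<in> carrier F" "(\<Oplus>\<^bsub>F\<^esub>g\<in>carrier G. u) = \<one>\<^bsub>F\<^esub>"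
  shows "exact_at F l"
  unfolding exact_at_def
proof
  fix c assume c: "c \<in> cocycles F (Suc l)"
  then have cc: "c \<in> cochains F (Suc l)" by (simp add: cocycles_def)
  note * = cochainsD[OF cc]
  define b where "b = (\<lambda>(x, \<sigma>). if (x, \<sigma>) \<in> index l
      then \<Oplus>\<^bsub>F\<^esub>g\<in>carrier G. u \<otimes>\<^bsub>F\<^esub> c (x, g # \<sigma>) else \<zero>\<^bsub>F\<^esub>)"
  have "b (act h (x, \<sigma>)) = b (x, \<sigma>)" if i: "(x, \<sigma>) \<in> index l" and h: "h \<in> carrier G" for x \<sigma> h
  proof -
    have "b (act h (x, \<sigma>)) =
        (\<Oplus>\<^bsub>F\<^esub>g\<in>carrier G. u \<otimes>\<^bsub>F\<^esub> c (x \<oplus>\<^bsub>K\<^esub> \<phi> h, g # map (\<lambda>g. g \<otimes>\<^bsub>G\<^esub> h) \<sigma>))"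
      using act_closed[OF i h] by (simp add: b_def act_def)
    also have "\<dots> = (\<Oplus>\<^bsub>F\<^esub>g\<in>carrier G. u \<otimes>\<^bsub>F\<^esub> c (act h (x, g # \<sigma>)))"
      using F.finsum_reindex[of "\<lambda>g. u \<otimes>\<^bsub>F\<^esub> c (x \<oplus>\<^bsub>K\<^esub> \<phi> h, g # map (\<lambda>g. g \<otimes>\<^bsub>G\<^esub> h) \<sigma>)"
          "\<lambda>g. g \<otimes>\<^bsub>G\<^esub> h" "carrier G"] bij_mult[OF h] u *(1)
      by (simp add: bij_betw_def act_def)
    also have "\<dots> = (\<Oplus>\<^bsub>F\<^esub>g\<in>carrier G. u \<otimes>\<^bsub>F\<^esub> c (x, g # \<sigma>))"
      using i h u * by (intro F.add.finprod_cong') (auto simp: index_def)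
    finally show ?thesis using i by (simp add: b_def)
  qed
  then have b: "b \<in> cochains F l"
    using u *(1) by (auto simp: cochains_def b_def simp del: split_paired_All
        intro!: F.finsum_closed split: prod.splits)
  have "cobd F l b (x, \<sigma>) = c (x, \<sigma>)" if i: "(x, \<sigma>) \<in> index (Suc l)" for x \<sigma>
  proof -
    have \<sigma>: "\<sigma> \<in> tuples (carrier G) (Suc l)" using i by (simp add: index_def)
    have cone: "delta F (\<lambda>\<tau>. c (x, g # \<tau>)) \<sigma> = c (x, \<sigma>)" if g: "g \<in> carrier G" for g
    proof -
      have cl: "delta F (\<lambda>\<tau>. c (x, g # \<tau>)) \<sigma> \<in> carrier F"
        using *(1) by (intro F.delta_closed[OF \<sigma>])
      have "(x, g # \<sigma>) \<in> index (Suc (Suc l))" using i g by (simp add: index_def)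
      \<comment> \<open>The cocycle condition on \<open>g # \<sigma>\<close>, expanded at its first
        entry, is exactly the contraction identity.\<close>
      then have "c (x, \<sigma>) \<ominus>\<^bsub>F\<^esub> delta F (\<lambda>\<tau>. c (x, g # \<tau>)) \<sigma> = cobd F (Suc l) c (x, g # \<sigma>)"
        by (simp add: cobd_def)
      also have "\<dots> = \<zero>\<^bsub>F\<^esub>" using c by (simp add: cocycles_def)
      finally show ?thesis using cl *(1)[of "(x, \<sigma>)"] by simp
    qed
    have "cobd F l b (x, \<sigma>) = delta F (\<lambda>\<tau>. \<Oplus>\<^bsub>F\<^esub>g\<in>carrier G. u \<otimes>\<^bsub>F\<^esub> c (x, g # \<tau>)) \<sigma>"
      using i by (auto simp: cobd_def b_def index_def intro!: delta_cong)
    also have "\<dots> = (\<Oplus>\<^bsub>F\<^esub>g\<in>carrier G. delta F (\<lambda>\<tau>. u \<otimes>\<^bsub>F\<^esub> c (x, g # \<tau>)) \<sigma>)"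
      using u *(1) by (intro F.delta_finsum[OF _ \<sigma>]) auto
    also have "\<dots> = (\<Oplus>\<^bsub>F\<^esub>g\<in>carrier G. u \<otimes>\<^bsub>F\<^esub> c (x, \<sigma>))"
    proof (intro F.add.finprod_cong')
      fix g assume g: "g \<in> carrier G"
      have "delta F (\<lambda>\<tau>. u \<otimes>\<^bsub>F\<^esub> c (x, g # \<tau>)) \<sigma> = u \<otimes>\<^bsub>F\<^esub> delta F (\<lambda>\<tau>. c (x, g # \<tau>)) \<sigma>"
        using u *(1) by (intro F.delta_hom[OF F.abelian_group_axioms _ _ \<sigma>, symmetric])
          (auto simp: F.r_distr)
      then show "delta F (\<lambda>\<tau>. u \<otimes>\<^bsub>F\<^esub> c (x, g # \<tau>)) \<sigma> = u \<otimes>\<^bsub>F\<^esub> c (x, \<sigma>)" using cone[OF g] by simp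
    qed (use u *(1) in auto)
    also have "\<dots> = (\<Oplus>\<^bsub>F\<^esub>g\<in>carrier G. u) \<otimes>\<^bsub>F\<^esub> c (x, \<sigma>)"
      using u *(1) by (intro F.finsum_ldistr[symmetric]) auto
    finally show ?thesis using u *(1) by simp
  qed
  then have "c = cobd F l b"
    using *(2) by (auto simp: fun_eq_iff cobd_def)
  then show "c \<in> cobd F l ` cochains F l" using b by blast
qed

end

end

section \<open>Comparison with rational cochains\<close>

text \<open>Multiply by the product \<open>N\<close> of the denominators, then divide by the
  greatest common divisor \<open>D\<close> of the resulting integers. The finite support makes
  \<open>N\<close> a finite product, and the nonzero entry makes \<open>D\<close> nonzero.\<close>

lemma rat_primitive_multiple:
  fixes w :: "'i \<Rightarrow> rat"
  assumes "finite S" "\<And>i. i \<notin> S \<Longrightarrow> w i = 0" "w \<noteq> (\<lambda>_. 0)"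
  obtains q :: rat and n :: "'i \<Rightarrow> int" where "\<And>i. of_int (n i) = q * w i" "Gcd (n ` S) = 1"
proof -
  define den where "den = (\<lambda>i. snd (quotient_of (w i)))"
  define N where "N = (\<Prod>i\<in>S. den i)"
  have den: "den i > 0" for i by (simp add: den_def quotient_of_denom_pos')
  then have N: "N > 0" unfolding N_def by (intro prod_pos) auto
  have "\<exists>k::int. of_int k = of_int N * w i" for i
  proof (cases "i \<in> S")
    case True
    obtain a b where ab: "quotient_of (w i) = (a, b)" by force
    have "N = (\<Prod>j\<in>S - {i}. den j) * b"
      using prod.remove[OF assms(1) True, of den] ab by (simp add: N_def den_def)
    moreover have "w i = of_int a / of_int b" using ab by (rule quotient_of_div)
    moreover have "b > 0" using ab by (rule quotient_of_denom_pos)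
    ultimately have "of_int N * w i = of_int ((\<Prod>j\<in>S - {i}. den j) * a)" by simp
    then show ?thesis by metis
  qed (use assms(2) in \<open>auto intro: exI[of _ 0]\<close>)
  then obtain k :: "'i \<Rightarrow> int" where k: "\<And>i. of_int (k i) = of_int N * w i" by metis
  define D where "D = Gcd (k ` S)"
  obtain i where i: "w i \<noteq> 0" using assms(3) by auto
  then have iS: "i \<in> S" using assms(2) by blast
  have "k i \<noteq> 0" using k[of i] i N by auto
  then have D: "D \<noteq> 0" using iS by (auto simp: D_def)
  have dvd: "D dvd k j" for j
  proof (cases "j \<in> S")
    case False
    then show ?thesis using k[of j] assms(2) by simp
  qed (simp add: D_def)
  show ?thesis
  proof (rule that[of "\<lambda>j. k j div D" "of_int N / of_int D"])
    show "of_int (k j div D) = of_int N / of_int D * w j" for j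
      using dvd[of j] D k[of j] by (auto simp: of_int_div field_simps)
    have "k ` S = (*) D ` ((\<lambda>j. k j div D) ` S)"
      using dvd by (simp add: image_image)
    then have "D = normalize (D * Gcd ((\<lambda>j. k j div D) ` S))"
      unfolding D_def by (metis Gcd_mult)
    also have "\<dots> = D * Gcd ((\<lambda>j. k j div D) ` S)"
      by (simp add: D_def normalize_mult)
    finally show "Gcd ((\<lambda>j. k j div D) ` S) = 1" using D by simp
  qed
qed

text \<open>The integers whose multiple of the unit vanishes form an ideal, which contains greatest
  common divisors by Bezout.\<close>

lemma (in ring) int_multiple_Gcd:
  assumes "finite A" "\<And>a. a \<in> A \<Longrightarrow> [(a::int)] \<cdot> \<one> = \<zero>"
  shows "[(Gcd A)] \<cdot> \<one> = \<zero>"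
  using assms
proof (induction A)
  case (insert a A)
  have mult: "[(u * n)] \<cdot> \<one> = \<zero>" if "[n] \<cdot> \<one> = \<zero>" for u n :: int
    using add.int_pow_pow[of \<one> u n] that by (simp add: mult.commute add.int_pow_one)
  obtain u v where "u * a + v * Gcd A = gcd a (Gcd A)" using bezout_int by blast
  then have "Gcd (insert a A) = u * a + v * Gcd A" by simp
  then have "[(Gcd (insert a A))] \<cdot> \<one> = [(u * a)] \<cdot> \<one> \<oplus> [(v * Gcd A)] \<cdot> \<one>"
    by (simp only: add.int_pow_mult one_closed)
  then show ?case using insert mult by simp
qed (simp add: add_pow_def int_pow_def2)

context additive_character
begin

context
  fixes F :: "('f, 'd) ring_scheme"
  assumes F: "field F"
begin

interpretation F: field F by (rule F)

text \<open>A minimal determining set \<open>J\<close> over \<open>F\<close> also determines the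
  rational cocycles. A nonzero rational cocycle that vanishes on \<open>J\<close> has a primitive
  integral multiple; pushed into \<open>F\<close> this is a cocycle vanishing on \<open>J\<close>,
  hence everywhere. Then all its integer entries are zero in \<open>F\<close>, and so is their
  greatest common divisor one.\<close>

lemma fun_dim_rat_cocycles_le:
  "fun_dim (class_ring :: rat ring) (cocycles class_ring l) \<le> fun_dim F (cocycles F l)"
proof -
  have Q: "field (class_ring :: rat ring)" by (rule class_field.field_axioms)
  have abel: "abelian_group (class_ring :: rat ring)" "abelian_group (class_ring :: int ring)"
    by (rule class_ring.abelian_group_axioms)+
  obtain J where J: "J \<subseteq> index l" "determines F J (cocycles F l)" "fun_dim F (cocycles F l) = card J"
    using F.determines_minimal[OF fun_subspace_cocycles[OF F] finite_index
        determines_cochains[OF F, of "cocycles F l" l]]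
    by (auto simp: cocycles_def)
  have "determines (class_ring :: rat ring) J (cocycles class_ring l)"
    unfolding determines_def
  proof (intro ballI impI, rule ccontr)
    fix w :: "'k \<times> 'g list \<Rightarrow> rat"
    assume w: "w \<in> cocycles class_ring l" and w0: "\<forall>j\<in>J. w j = \<zero>\<^bsub>class_ring\<^esub>"
      and "w \<noteq> (\<lambda>_. \<zero>\<^bsub>class_ring\<^esub>)"
    then have w_nz: "w \<noteq> (\<lambda>_. 0)" by simp
    have supp: "w i = 0" if "i \<notin> index l" for i
      using w cochainsD(2)[of w class_ring l i] that by (simp add: cocycles_def)
    obtain q n where n: "\<And>i. of_int (n i) = q * w i" and gcd: "Gcd (n ` index l) = 1"
      using rat_primitive_multiple[OF finite_index supp w_nz] by blast
    have "(\<lambda>i. q * w i) \<in> cocycles class_ring l"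
      using field.fun_subspaceD(4)[OF Q fun_subspace_cocycles[OF Q] _ w, of q] by simp
    then have "(of_int \<circ> n :: _ \<Rightarrow> rat) \<in> cocycles class_ring l"
      using n by (simp add: comp_def)
    then have nZ: "n \<in> cocycles class_ring l"
      by (intro cocycle_transfer(2)[OF abel(2,1), of of_int]) (auto simp: inj_on_def)
    have "(\<lambda>z. [z] \<cdot>\<^bsub>F\<^esub> \<one>\<^bsub>F\<^esub>) \<circ> n \<in> cocycles F l"
      by (rule cocycle_transfer(1)[OF abel(2) F.abelian_group_axioms _ _ _ nZ])
        (auto simp: F.add.int_pow_mult)
    moreover have "[(n j)] \<cdot>\<^bsub>F\<^esub> \<one>\<^bsub>F\<^esub> = \<zero>\<^bsub>F\<^esub>" if "j \<in> J" for j
      using n[of j] w0 that by (simp add: add_pow_def int_pow_def2)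
    ultimately have "(\<lambda>z. [z] \<cdot>\<^bsub>F\<^esub> \<one>\<^bsub>F\<^esub>) \<circ> n = (\<lambda>_. \<zero>\<^bsub>F\<^esub>)"
      using J(2) by (auto simp: determines_def)
    then have "[(n i)] \<cdot>\<^bsub>F\<^esub> \<one>\<^bsub>F\<^esub> = \<zero>\<^bsub>F\<^esub>" for i by (metis comp_apply)
    then have "[(Gcd (n ` index l))] \<cdot>\<^bsub>F\<^esub> \<one>\<^bsub>F\<^esub> = \<zero>\<^bsub>F\<^esub>"
      by (intro F.int_multiple_Gcd) auto
    then show False using gcd by simp
  qed
  then show ?thesis
    using field.fun_dim_le(1)[OF Q fun_subspace_cocycles[OF Q]] J finite_subset[OF J(1)] by simp
qed

lemma fun_dim_cochains_rat:
  "fun_dim F (cochains F l) = fun_dim (class_ring :: rat ring) (cochains class_ring l)"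
proof -
  have Q: "field (class_ring :: rat ring)" by (rule class_field.field_axioms)
  show ?thesis
    by (cases l) (simp_all only: fun_dim_cochains_0[OF F] fun_dim_cochains_0[OF Q]
        fun_dim_cochains_Suc[OF F] fun_dim_cochains_Suc[OF Q])
qed

lemma exact_at_rat: "exact_at (class_ring :: rat ring) l"
proof (rule exact_if_invertible_order[OF class_field.field_axioms])
  show "(\<Oplus>\<^bsub>class_ring\<^esub>g\<in>carrier G. 1 / of_nat (card (carrier G)) :: rat) = \<one>\<^bsub>class_ring\<^esub>"
    using G.one_closed by (auto simp: class_ring_simps card_gt_0_iff)
qed simp

lemma fun_dim_cocycles_exact:
  assumes "exact_at F l"
  shows "fun_dim F (cocycles F (Suc l)) = fun_dim (class_ring :: rat ring) (cocycles class_ring (Suc l))"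
  using fun_dim_cochains[OF F assms] fun_dim_cochains[OF class_field.field_axioms exact_at_rat, of l]
    fun_dim_rat_cocycles_le[of l] fun_dim_rat_cocycles_le[of "Suc l"] fun_dim_cochains_rat[of l] by linarith

end

lemma rat_cocycles_recursion:
  "fun_dim (class_ring :: rat ring) (cocycles class_ring 0) = 0"
  "fun_dim (class_ring :: rat ring) (cocycles class_ring (Suc 0)) = 1"
  "fun_dim (class_ring :: rat ring) (cocycles class_ring (Suc (Suc l))) +
     fun_dim (class_ring :: rat ring) (cocycles class_ring (Suc l)) =
     card (\<phi> ` carrier G) * card (carrier G) ^ l"
proof -
  have Q: "field (class_ring :: rat ring)" by (rule class_field.field_axioms)
  have ex: "exact_at (class_ring :: rat ring) l" for l by (rule exact_at_rat[OF Q])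
  show 0: "fun_dim (class_ring :: rat ring) (cocycles class_ring 0) = 0"
    by (rule fun_dim_cocycles_0[OF Q])
  show "fun_dim (class_ring :: rat ring) (cocycles class_ring (Suc 0)) = 1"
    using fun_dim_cochains[OF Q ex, of 0] fun_dim_cochains_0[OF Q] 0 by linarith
  show "fun_dim (class_ring :: rat ring) (cocycles class_ring (Suc (Suc l))) +
     fun_dim (class_ring :: rat ring) (cocycles class_ring (Suc l)) =
     card (\<phi> ` carrier G) * card (carrier G) ^ l"
    using fun_dim_cochains[OF Q ex, of "Suc l"] fun_dim_cochains_Suc[OF Q, of l] by linarith
qed

end

section \<open>Polynomial functions on a finite subset of a field\<close>

lemma (in abelian_group) diff_self [simp]: "x \<in> carrier G \<Longrightarrow> x \<ominus> x = \<zero>"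
  by simp

context field
begin

text \<open>Horner form of: on \<open>X\<close>, \<open>f\<close> agrees with a polynomial of degree
  at most \<open>m\<close> whose coefficient in degree \<open>m\<close> is \<open>\<alpha>\<close>,
  where \<open>\<alpha>\<close> may be zero. A relation is used since a function on a finite set
  fixes this coefficient only for \<open>m < card X\<close>.\<close>

primrec polynomial_on :: "'a set \<Rightarrow> nat \<Rightarrow> 'a \<Rightarrow> ('a \<Rightarrow> 'a) \<Rightarrow> bool" where
  "polynomial_on X 0 \<alpha> f \<longleftrightarrow> \<alpha> \<in> carrier R \<and> (\<forall>x\<in>X. f x = \<alpha>)"
| "polynomial_on X (Suc m) \<alpha> f \<longleftrightarrow>
     (\<exists>a\<in>carrier R. \<exists>g. polynomial_on X m \<alpha> g \<and> (\<forall>x\<in>X. f x = a \<oplus> x \<otimes> g x))"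

context
  fixes X
  assumes X: "X \<subseteq> carrier R"
begin

lemma X_closed [simp]: "x \<in> X \<Longrightarrow> x \<in> carrier R"
  using X by blast

lemma polynomial_on_cong:
  "polynomial_on X m \<alpha> f \<Longrightarrow> (\<And>x. x \<in> X \<Longrightarrow> f x = f' x) \<Longrightarrow> polynomial_on X m \<alpha> f'"
  by (cases m) auto

lemma polynomial_on_closed:
  "polynomial_on X m \<alpha> f \<Longrightarrow> \<alpha> \<in> carrier R"
  "polynomial_on X m \<alpha> f \<Longrightarrow> x \<in> X \<Longrightarrow> f x \<in> carrier R"
  by (induction m arbitrary: f) auto

lemma polynomial_on_zero: "polynomial_on X m \<zero> (\<lambda>_. \<zero>)"
proof (induction m)
  case (Suc m)
  then show ?case by (auto intro!: bexI[of _ \<zero>] exI[of _ "\<lambda>_. \<zero>"])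
qed simp

lemma polynomial_on_add:
  assumes "polynomial_on X m \<alpha> f" "polynomial_on X m \<beta> g"
  shows "polynomial_on X m (\<alpha> \<oplus> \<beta>) (\<lambda>x. f x \<oplus> g x)"
  using assms
proof (induction m arbitrary: f g)
  case (Suc m)
  obtain a f' where f: "a \<in> carrier R" "polynomial_on X m \<alpha> f'" "\<And>x. x \<in> X \<Longrightarrow> f x = a \<oplus> x \<otimes> f' x"
    using Suc.prems by auto
  obtain b g' where g: "b \<in> carrier R" "polynomial_on X m \<beta> g'" "\<And>x. x \<in> X \<Longrightarrow> g x = b \<oplus> x \<otimes> g' x"
    using Suc.prems by auto
  have "f x \<oplus> g x = (a \<oplus> b) \<oplus> x \<otimes> (f' x \<oplus> g' x)" if "x \<in> X" for x
    using that f g polynomial_on_closed(2)[OF f(2) that] polynomial_on_closed(2)[OF g(2) that]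
    by (simp add: r_distr a_ac)
  then show ?case using Suc.IH[OF f(2) g(2)] f(1) g(1) by auto
qed auto

lemma polynomial_on_smult:
  assumes "polynomial_on X m \<alpha> f" "c \<in> carrier R"
  shows "polynomial_on X m (c \<otimes> \<alpha>) (\<lambda>x. c \<otimes> f x)"
  using assms
proof (induction m arbitrary: f)
  case (Suc m)
  obtain a f' where f: "a \<in> carrier R" "polynomial_on X m \<alpha> f'" "\<And>x. x \<in> X \<Longrightarrow> f x = a \<oplus> x \<otimes> f' x"
    using Suc.prems by auto
  have "c \<otimes> f x = c \<otimes> a \<oplus> x \<otimes> (c \<otimes> f' x)" if "x \<in> X" for x
    using that f polynomial_on_closed(2)[OF f(2) that] Suc.prems by (simp add: r_distr m_lcomm)
  then show ?case using Suc.IH[OF f(2)] Suc.prems f(1) by auto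
qed auto

lemma polynomial_on_minus:
  assumes f: "polynomial_on X m \<alpha> f" and g: "polynomial_on X m \<beta> g"
  shows "polynomial_on X m (\<alpha> \<ominus> \<beta>) (\<lambda>x. f x \<ominus> g x)"
proof -
  have "polynomial_on X m (\<alpha> \<oplus> (\<ominus> \<one>) \<otimes> \<beta>) (\<lambda>x. f x \<oplus> (\<ominus> \<one>) \<otimes> g x)"
    by (intro polynomial_on_add f polynomial_on_smult g) simp
  moreover have "\<alpha> \<oplus> (\<ominus> \<one>) \<otimes> \<beta> = \<alpha> \<ominus> \<beta>"
    using polynomial_on_closed(1)[OF g] by (simp add: a_minus_def l_minus)
  ultimately show ?thesis
    using polynomial_on_closed(2)[OF g] by (auto elim!: polynomial_on_cong simp: a_minus_def l_minus)
qed

lemma polynomial_on_raise: "polynomial_on X m \<alpha> f \<Longrightarrow> polynomial_on X (Suc m) \<zero> f"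
proof (induction m arbitrary: f)
  case 0
  then show ?case
    by (auto intro!: bexI[of _ \<alpha>] exI[of _ "\<lambda>_. \<zero>"])
next
  case (Suc m)
  then show ?case unfolding polynomial_on.simps(2)[of X "Suc m"] by (metis polynomial_on.simps(2))
qed

text \<open>The top coefficient sits innermost in the Horner form; if it is zero, the last nested
  level collapses to its constant.\<close>

lemma polynomial_on_lower: "polynomial_on X (Suc m) \<zero> f \<Longrightarrow> \<exists>\<beta>. polynomial_on X m \<beta> f"
proof (induction m arbitrary: f)
  case 0
  then obtain a g where "a \<in> carrier R" "polynomial_on X 0 \<zero> g" "\<And>x. x \<in> X \<Longrightarrow> f x = a \<oplus> x \<otimes> g x"
    by auto
  then have "polynomial_on X 0 a f" by simp
  then show ?case by blast
next
  case (Suc m)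
  obtain a g where f: "a \<in> carrier R" "polynomial_on X (Suc m) \<zero> g" "\<forall>x\<in>X. f x = a \<oplus> x \<otimes> g x"
    using Suc.prems unfolding polynomial_on.simps(2)[of X "Suc m"] by blast
  then show ?case using Suc.IH[OF f(2)] f(1,3) by auto
qed

text \<open>Recentring the factor at \<open>y\<close> adds a multiple of \<open>g\<close>, which has
  degree at most \<open>m\<close> and leaves the coefficient in degree \<open>Suc m\<close>
  alone.\<close>

lemma polynomial_on_linear_factor:
  assumes g: "polynomial_on X m \<alpha> g" and a: "a \<in> carrier R" and y: "y \<in> carrier R"
  shows "polynomial_on X (Suc m) \<alpha> (\<lambda>x. a \<oplus> (x \<ominus> y) \<otimes> g x)"
proof -
  have "polynomial_on X (Suc m) \<alpha> (\<lambda>x. a \<oplus> x \<otimes> g x)" using g a by auto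
  moreover have "polynomial_on X (Suc m) \<zero> (\<lambda>x. (\<ominus> y) \<otimes> g x)"
    using g y by (intro polynomial_on_raise[OF polynomial_on_smult[OF g]]) auto
  ultimately have "polynomial_on X (Suc m) (\<alpha> \<oplus> \<zero>) (\<lambda>x. (a \<oplus> x \<otimes> g x) \<oplus> (\<ominus> y) \<otimes> g x)"
    by (rule polynomial_on_add)
  moreover have "(a \<oplus> x \<otimes> g x) \<oplus> (\<ominus> y) \<otimes> g x = a \<oplus> (x \<ominus> y) \<otimes> g x" if "x \<in> X" for x
    using that a y polynomial_on_closed(2)[OF g that] by (simp add: a_minus_def l_distr a_assoc)
  ultimately show ?thesis
    using polynomial_on_closed(1)[OF g] by (auto elim!: polynomial_on_cong simp del: polynomial_on.simps)
qed

lemma polynomial_on_divide_linear: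
  assumes "polynomial_on X (Suc m) \<alpha> f" "y \<in> carrier R"
  shows "\<exists>a\<in>carrier R. \<exists>g. polynomial_on X m \<alpha> g \<and> (\<forall>x\<in>X. f x = a \<oplus> (x \<ominus> y) \<otimes> g x)"
  using assms(1)
proof (induction m arbitrary: f)
  case 0
  then obtain a g where f: "a \<in> carrier R" "\<alpha> \<in> carrier R" "\<And>x. x \<in> X \<Longrightarrow> f x = a \<oplus> x \<otimes> \<alpha>"
    by auto
  have "f x = (a \<oplus> y \<otimes> \<alpha>) \<oplus> (x \<ominus> y) \<otimes> \<alpha>" if x: "x \<in> X" for x
  proof -
    have "x \<otimes> \<alpha> = y \<otimes> \<alpha> \<oplus> (x \<ominus> y) \<otimes> \<alpha>"
      using x f assms(2) by (simp add: a_minus_def l_distr l_minus r_neg1 a_lcomm[of "y \<otimes> \<alpha>"])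
        (simp add: r_neg)
    then show ?thesis using x f assms(2) by (simp add: a_assoc)
  qed
  then show ?case using f assms(2) by (intro bexI[of _ "a \<oplus> y \<otimes> \<alpha>"] exI[of _ "\<lambda>_. \<alpha>"]) auto
next
  case (Suc m)
  obtain a g where f: "a \<in> carrier R" "polynomial_on X (Suc m) \<alpha> g" "\<And>x. x \<in> X \<Longrightarrow> f x = a \<oplus> x \<otimes> g x"
    using Suc.prems unfolding polynomial_on.simps(2)[of X "Suc m"] by blast
  obtain b h where g: "b \<in> carrier R" "polynomial_on X m \<alpha> h"
      "\<And>x. x \<in> X \<Longrightarrow> g x = b \<oplus> (x \<ominus> y) \<otimes> h x"
    using Suc.IH[OF f(2)] by blast
  \<comment> \<open>The quotient arises by writing the factor \<open>x\<close> as
    \<open>y + (x - y)\<close>: then \<open>x g = y g + (x - y) g\<close>, and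
    \<open>g = b + (x - y) h\<close> turns \<open>y g\<close> into
    \<open>y b + (x - y) (y h)\<close>. The extra summand \<open>y h\<close> has lower
    degree.\<close>
  have "polynomial_on X (Suc m) (\<alpha> \<oplus> \<zero>) (\<lambda>x. g x \<oplus> y \<otimes> h x)"
    by (intro polynomial_on_add f polynomial_on_raise[OF polynomial_on_smult[OF g(2) assms(2)]])
  then have "polynomial_on X (Suc m) \<alpha> (\<lambda>x. g x \<oplus> y \<otimes> h x)"
    using polynomial_on_closed(1)[OF f(2)] by (simp del: polynomial_on.simps)
  moreover have "f x = (a \<oplus> y \<otimes> b) \<oplus> (x \<ominus> y) \<otimes> (g x \<oplus> y \<otimes> h x)" if x: "x \<in> X" for x
  proof -
    have c: "g x \<in> carrier R" "h x \<in> carrier R" "x \<ominus> y \<in> carrier R" "x \<in> carrier R"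
      using polynomial_on_closed(2)[OF f(2) x] polynomial_on_closed(2)[OF g(2) x] x assms(2) by auto
    have "x = y \<oplus> (x \<ominus> y)" using c assms(2) by (simp add: a_minus_def a_lcomm[of y x]) (simp add: r_neg)
    then have "x \<otimes> g x = y \<otimes> g x \<oplus> (x \<ominus> y) \<otimes> g x"
      using c assms(2) l_distr[of y "x \<ominus> y" "g x"] by simp
    moreover have "y \<otimes> g x = y \<otimes> b \<oplus> (x \<ominus> y) \<otimes> (y \<otimes> h x)"
      using g(1) g(3)[OF x] c assms(2) by (simp add: r_distr m_lcomm)
    ultimately show ?thesis
      using f(1) f(3)[OF x] c g(1) assms(2) by (simp add: r_distr a_ac)
  qed
  ultimately show ?case
    using f(1) g(1) assms(2) by (intro bexI[of _ "a \<oplus> y \<otimes> b"] exI[of _ "\<lambda>x. g x \<oplus> y \<otimes> h x"]) auto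
qed

text \<open>Each root splits off a linear factor, which lowers the degree by one, removes one root
  and keeps \<open>\<alpha>\<close>.\<close>

lemma polynomial_on_roots:
  assumes "polynomial_on X m \<alpha> f" "Y \<subseteq> X" "finite Y" "m < card Y" "\<And>x. x \<in> Y \<Longrightarrow> f x = \<zero>"
  shows "\<alpha> = \<zero>"
  using assms
proof (induction m arbitrary: f Y)
  case 0
  then obtain y where "y \<in> Y" by (auto simp: card_gt_0_iff)
  then show ?case using 0(1) 0(2) 0(5)[of y] by auto
next
  case (Suc m)
  then obtain y where y: "y \<in> Y" by (metis all_not_in_conv card.empty not_less0)
  then have yX: "y \<in> X" using Suc.prems by blast
  obtain a g where a: "a \<in> carrier R" and g: "polynomial_on X m \<alpha> g"
      and f: "\<And>x. x \<in> X \<Longrightarrow> f x = a \<oplus> (x \<ominus> y) \<otimes> g x"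
    using polynomial_on_divide_linear[OF Suc.prems(1) X_closed[OF yX]] by blast
  have "f y = a" using f[OF yX] a yX polynomial_on_closed(2)[OF g yX] by simp
  then have a0: "a = \<zero>" using Suc.prems(5)[OF y] by simp
  show ?case
  proof (rule Suc.IH[OF g, of "Y - {y}"])
    show "m < card (Y - {y})" using Suc.prems y by simp
    fix x assume x: "x \<in> Y - {y}"
    then have xX: "x \<in> X" using Suc.prems by blast
    have "(x \<ominus> y) \<otimes> g x = \<zero>"
      using f[OF xX] Suc.prems(5)[of x] x polynomial_on_closed(2)[OF g xX] xX yX by (simp add: a0)
    then show "g x = \<zero>"
      using x xX yX polynomial_on_closed(2)[OF g xX] by (simp add: integral_iff)
  qed (use Suc.prems in auto)
qed

lemma polynomial_on_unique:
  assumes "finite X" "m < card X" "polynomial_on X m \<alpha> f" "polynomial_on X m \<beta> f"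
  shows "\<alpha> = \<beta>"
proof -
  have "\<alpha> \<ominus> \<beta> = \<zero>"
    using polynomial_on_closed(2)[OF assms(3)]
    by (intro polynomial_on_roots[OF polynomial_on_minus[OF assms(3,4)] subset_refl assms(1,2)]) simp
  then show ?thesis using polynomial_on_closed(1)[OF assms(3)] polynomial_on_closed(1)[OF assms(4)] by simp
qed

text \<open>In the Horner form a translation recentres each factor, and recentring keeps the top
  coefficient. For \<open>c\<close> a value of the character this is the triviality of the action on
  the graded pieces.\<close>

lemma polynomial_on_translate:
  assumes "polynomial_on X m \<alpha> f" "c \<in> carrier R" "\<And>x. x \<in> X \<Longrightarrow> x \<oplus> c \<in> X"
  shows "polynomial_on X m \<alpha> (\<lambda>x. f (x \<oplus> c))"
  using assms(1)
proof (induction m arbitrary: f)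
  case (Suc m)
  obtain a g where f: "a \<in> carrier R" "polynomial_on X m \<alpha> g" "\<And>x. x \<in> X \<Longrightarrow> f x = a \<oplus> x \<otimes> g x"
    using Suc.prems by auto
  note g = Suc.IH[OF f(2)]
  have "f (x \<oplus> c) = a \<oplus> (x \<ominus> (\<ominus> c)) \<otimes> g (x \<oplus> c)" if "x \<in> X" for x
    using f(3)[OF assms(3)[OF that]] assms(2) that by (simp add: a_minus_def)
  moreover have "polynomial_on X (Suc m) \<alpha> (\<lambda>x. a \<oplus> (x \<ominus> (\<ominus> c)) \<otimes> g (x \<oplus> c))"
    using f g assms(2) by (intro polynomial_on_linear_factor) auto
  ultimately show ?case by (auto elim!: polynomial_on_cong simp del: polynomial_on.simps)
qed (simp add: assms(3))

text \<open>Newton interpolation: choose a point \<open>y\<close> and interpolate the divided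
  differences \<open>?h\<close> on the remaining points. Applied to all of \<open>X\<close>, it
  shows that the filtration by degree exhausts the functions.\<close>

lemma polynomial_on_interpolation:
  assumes "Y \<subseteq> X" "card Y = Suc m" "\<And>x. x \<in> Y \<Longrightarrow> f x \<in> carrier R"
  shows "\<exists>\<alpha> g. polynomial_on X m \<alpha> g \<and> (\<forall>x\<in>Y. g x = f x)"
  using assms
proof (induction m arbitrary: f Y)
  case 0
  then obtain y where "Y = {y}" by (auto simp: card_1_singleton_iff)
  then show ?case using 0 by (intro exI[of _ "f y"] exI[of _ "\<lambda>_. f y"]) auto
next
  case (Suc m)
  then obtain y where y: "y \<in> Y" by (metis all_not_in_conv card.empty nat.distinct(1))
  have Y [simp]: "x \<in> carrier R" if "x \<in> Y" for x using that Suc.prems by auto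
  have unit: "inv (x \<ominus> y) \<in> carrier R" "(x \<ominus> y) \<otimes> inv (x \<ominus> y) = \<one>" if "x \<in> Y - {y}" for x
  proof -
    have "x \<ominus> y \<in> Units R" using that y by (auto simp: field_Units)
    then show "inv (x \<ominus> y) \<in> carrier R" "(x \<ominus> y) \<otimes> inv (x \<ominus> y) = \<one>" by auto
  qed
  let ?h = "\<lambda>x. inv (x \<ominus> y) \<otimes> (f x \<ominus> f y)"
  have fin: "finite Y" using Suc.prems by (metis card.infinite nat.distinct(1))
  obtain \<alpha> g where g: "polynomial_on X m \<alpha> g" "\<And>x. x \<in> Y - {y} \<Longrightarrow> g x = ?h x"
  proof -
    have "Y - {y} \<subseteq> X" "card (Y - {y}) = Suc m" using Suc.prems y fin by auto
    moreover have "?h x \<in> carrier R" if "x \<in> Y - {y}" for x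
      using that unit Suc.prems(3) y by auto
    ultimately show ?thesis using Suc.IH[of "Y - {y}" ?h] that by blast
  qed
  have "f y \<oplus> (x \<ominus> y) \<otimes> g x = f x" if x: "x \<in> Y" for x
  proof (cases "x = y")
    case True
    then show ?thesis
      using x Suc.prems(3) polynomial_on_closed(2)[OF g(1) subsetD[OF Suc.prems(1) x]] by simp
  next
    case False
    then have "(x \<ominus> y) \<otimes> g x = f x \<ominus> f y"
      using g(2)[of x] unit[of x] x y Suc.prems(3) by (simp add: m_assoc[symmetric])
    moreover have "f y \<oplus> (f x \<ominus> f y) = f x"
      using x y Suc.prems(3) by (simp add: a_minus_def a_lcomm[of "f y"]) (simp add: r_neg)
    ultimately show ?thesis by simp
  qed
  moreover have "polynomial_on X (Suc m) \<alpha> (\<lambda>x. f y \<oplus> (x \<ominus> y) \<otimes> g x)"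
    using g y Suc.prems(3) by (intro polynomial_on_linear_factor) auto
  ultimately show ?case by (intro exI conjI ballI)
qed

text \<open>The model for lifting along leading coefficients. The centre \<open>y\<close> is free so
  that it can later move together with \<open>x\<close> under the action.\<close>

lemma polynomial_on_power:
  assumes "\<alpha> \<in> carrier R" "y \<in> carrier R"
  shows "polynomial_on X m \<alpha> (\<lambda>x. \<alpha> \<otimes> (x \<ominus> y) [^] m)"
proof (induction m)
  case (Suc m)
  have "polynomial_on X (Suc m) \<alpha> (\<lambda>x. \<zero> \<oplus> (x \<ominus> y) \<otimes> (\<alpha> \<otimes> (x \<ominus> y) [^] m))"
    by (intro polynomial_on_linear_factor Suc assms) simp
  moreover have "\<zero> \<oplus> (x \<ominus> y) \<otimes> (\<alpha> \<otimes> (x \<ominus> y) [^] m) = \<alpha> \<otimes> (x \<ominus> y) [^] Suc m" if "x \<in> X" for x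
    using that assms by (simp add: m_ac)
  ultimately show ?case by (rule polynomial_on_cong)
qed (use assms in simp)

text \<open>The coboundary combines values at different tuples for one fixed \<open>x\<close>, and
  leading coefficients are additive.\<close>

lemma polynomial_on_delta:
  assumes "\<sigma> \<in> tuples S (Suc l)" "\<And>\<tau>. \<tau> \<in> tuples S l \<Longrightarrow> polynomial_on X m (\<alpha> \<tau>) (\<lambda>x. c x \<tau>)"
  shows "polynomial_on X m (delta R \<alpha> \<sigma>) (\<lambda>x. delta R (c x) \<sigma>)"
  using assms
proof (induction \<sigma> arbitrary: l \<alpha> c)
  case Nil
  then show ?case by (simp add: polynomial_on_zero)
next
  case (Cons g \<sigma>)
  have hd: "polynomial_on X m (\<alpha> \<sigma>) (\<lambda>x. c x \<sigma>)" using Cons.prems by auto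
  have "polynomial_on X m (delta R (\<lambda>\<tau>. \<alpha> (g # \<tau>)) \<sigma>) (\<lambda>x. delta R (\<lambda>\<tau>. c x (g # \<tau>)) \<sigma>)"
  proof (cases l)
    case 0
    then show ?thesis using Cons.prems by (simp add: polynomial_on_zero)
  next
    case (Suc k)
    then show ?thesis using Cons.prems by (intro Cons.IH[of k]) auto
  qed
  from polynomial_on_minus[OF hd this] show ?case by simp
qed

end

declare X_closed [simp del]

end

section \<open>Vanishing cohomology forces the character to be trivial\<close>

locale field_character = additive_character G K \<phi> + K?: field K
  for G :: "('g, 'b) monoid_scheme" (structure) and K :: "('k, 'a) ring_scheme" (structure) and \<phi>

text \<open>The zero character has a one-point image, so the facts prefixed with
  \<open>trivial\<close> speak of cochains with coefficients in the field itself.\<close>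

sublocale field_character \<subseteq> trivial: additive_character G K "\<lambda>_. \<zero>\<^bsub>K\<^esub>"
  by unfold_locales simp_all

context field_character
begin

declare trivial.char_closed [simp del] trivial.char_one [simp del]

abbreviation X where "X \<equiv> \<phi> ` carrier G"

lemma X_facts: "X \<subseteq> carrier K" "finite X" "card X > 0"
proof -
  show "X \<subseteq> carrier K" by auto
  show "finite X" by simp
  then show "card X > 0" using G.one_closed by (metis card_gt_0_iff empty_iff imageI)
qed

lemma X_translate: "x \<in> X \<Longrightarrow> h \<in> carrier G \<Longrightarrow> x \<oplus>\<^bsub>K\<^esub> \<phi> h \<in> X"
  by (metis (no_types, opaque_lifting) G.m_closed char_mult image_iff)

lemma trivial_index [simp]: "(x, \<sigma>) \<in> trivial.index n \<longleftrightarrow> x = \<zero>\<^bsub>K\<^esub> \<and> \<sigma> \<in> tuples (carrier G) n"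
  unfolding trivial.index_def using G.one_closed by blast

lemma index_iff: "(x, \<sigma>) \<in> index n \<longleftrightarrow> x \<in> X \<and> \<sigma> \<in> tuples (carrier G) n"
  by (simp add: index_def)

section \<open>The degree filtration on cocycles and its leading coefficients\<close>

primrec stage :: "nat \<Rightarrow> ('k \<Rightarrow> 'k) \<Rightarrow> bool" where
  "stage 0 f \<longleftrightarrow> (\<forall>x\<in>X. f x = \<zero>\<^bsub>K\<^esub>)"
| "stage (Suc m) f \<longleftrightarrow> (\<exists>\<alpha>. K.polynomial_on X m \<alpha> f)"

definition stage_cocycles :: "nat \<Rightarrow> nat \<Rightarrow> ('k \<times> 'g list \<Rightarrow> 'k) set" where
  "stage_cocycles n m = {c \<in> cocycles K n. \<forall>\<sigma>\<in>tuples (carrier G) n. stage m (\<lambda>x. c (x, \<sigma>))}"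

text \<open>A cochain over the one-point image of the zero character, hence the first component
  zero. The description is meaningful for cochains in stage \<open>Suc m\<close> with
  \<open>m < card X\<close>.\<close>

definition lead :: "nat \<Rightarrow> nat \<Rightarrow> ('k \<times> 'g list \<Rightarrow> 'k) \<Rightarrow> 'k \<times> 'g list \<Rightarrow> 'k" where
  "lead m n c = (\<lambda>(x, \<sigma>). if (x, \<sigma>) \<in> trivial.index n
     then THE \<alpha>. K.polynomial_on X m \<alpha> (\<lambda>x. c (x, \<sigma>)) else \<zero>\<^bsub>K\<^esub>)"

lemma lead_eq:
  assumes "m < card X" "K.polynomial_on X m \<alpha> (\<lambda>x. c (x, \<sigma>))" "\<sigma> \<in> tuples (carrier G) n"
  shows "lead m n c (\<zero>\<^bsub>K\<^esub>, \<sigma>) = \<alpha>"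
proof -
  have "(THE \<alpha>. K.polynomial_on X m \<alpha> (\<lambda>x. c (x, \<sigma>))) = \<alpha>"
  proof (rule the_equality)
    show "K.polynomial_on X m \<alpha> (\<lambda>x. c (x, \<sigma>))" by fact
    show "\<beta> = \<alpha>" if "K.polynomial_on X m \<beta> (\<lambda>x. c (x, \<sigma>))" for \<beta>
      by (rule K.polynomial_on_unique[OF X_facts(1,2) assms(1) that assms(2)])
  qed
  then show ?thesis using assms(3) by (simp add: lead_def)
qed

lemma lead_outside: "i \<notin> trivial.index n \<Longrightarrow> lead m n c i = \<zero>\<^bsub>K\<^esub>"
  by (cases i) (simp add: lead_def del: trivial_index)

text \<open>Stage \<open>m\<close> means degree below \<open>m\<close>, with only the zero function
  at \<open>m = 0\<close>. In this uniform form closure under linear operations is the case of zero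
  coefficients of the polynomial facts.\<close>

lemma stage_iff: "stage m f \<longleftrightarrow> K.polynomial_on X m \<zero>\<^bsub>K\<^esub> f"
proof (cases m)
  case (Suc k)
  show ?thesis
    unfolding Suc stage.simps
  proof
    show "K.polynomial_on X (Suc k) \<zero>\<^bsub>K\<^esub> f" if "\<exists>\<alpha>. K.polynomial_on X k \<alpha> f"
      using that by (elim exE) (rule K.polynomial_on_raise[OF X_facts(1)])
    show "\<exists>\<alpha>. K.polynomial_on X k \<alpha> f" if "K.polynomial_on X (Suc k) \<zero>\<^bsub>K\<^esub> f"
      using that by (rule K.polynomial_on_lower[OF X_facts(1)])
  qed
next
  case 0
  then show ?thesis by simp
qed

lemma polynomial_on_cobd:
  assumes "\<And>\<tau>. \<tau> \<in> tuples (carrier G) n \<Longrightarrow> K.polynomial_on X m (\<alpha> \<tau>) (\<lambda>x. c (x, \<tau>))"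
    and "\<sigma> \<in> tuples (carrier G) (Suc n)"
  shows "K.polynomial_on X m (delta K \<alpha> \<sigma>) (\<lambda>x. cobd K n c (x, \<sigma>))"
proof -
  have "K.polynomial_on X m (delta K \<alpha> \<sigma>) (\<lambda>x. delta K (\<lambda>\<tau>. c (x, \<tau>)) \<sigma>)"
    using assms by (intro K.polynomial_on_delta[OF X_facts(1)])
  then show ?thesis
    by (rule K.polynomial_on_cong[OF X_facts(1)]) (use assms(2) in \<open>simp add: cobd_def index_iff\<close>)
qed

lemma fun_subspace_stage_cocycles: "fun_subspace K (stage_cocycles n m)"
proof -
  note * = K.fun_subspaceD[OF fun_subspace_cocycles[OF K.field_axioms, of n]]
  have "stage m (\<lambda>_. \<zero>\<^bsub>K\<^esub>)"
    using K.polynomial_on_zero[OF X_facts(1)] by (simp add: stage_iff)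
  moreover have "stage m (\<lambda>x. f x \<oplus>\<^bsub>K\<^esub> g x)" if "stage m f" "stage m g" for f g
    using K.polynomial_on_add[OF X_facts(1), of m "\<zero>\<^bsub>K\<^esub>" f "\<zero>\<^bsub>K\<^esub>" g] that by (simp add: stage_iff)
  moreover have "stage m (\<lambda>x. a \<otimes>\<^bsub>K\<^esub> f x)" if "stage m f" "a \<in> carrier K" for f a
    using K.polynomial_on_smult[OF X_facts(1), of m "\<zero>\<^bsub>K\<^esub>" f a] that by (simp add: stage_iff)
  ultimately show ?thesis
    unfolding fun_subspace_def stage_cocycles_def using * by (simp del: split_paired_All)
qed

lemma stage_cocycles_0:
  assumes c: "c \<in> stage_cocycles n 0"
  shows "c = (\<lambda>_. \<zero>\<^bsub>K\<^esub>)"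
proof
  fix i show "c i = \<zero>\<^bsub>K\<^esub>"
  proof (cases "i \<in> index n")
    case True
    then show ?thesis using c by (auto simp: stage_cocycles_def index_def)
  next
    case False
    then show ?thesis using c cochainsD(2)[of c K n i] by (simp add: stage_cocycles_def cocycles_def)
  qed
qed

lemma stage_cocycles_poly:
  assumes "c \<in> stage_cocycles n (Suc m)" "m < card X" "\<sigma> \<in> tuples (carrier G) n"
  shows "K.polynomial_on X m (lead m n c (\<zero>\<^bsub>K\<^esub>, \<sigma>)) (\<lambda>x. c (x, \<sigma>))"
  using assms lead_eq[OF assms(2) _ assms(3), of _ c] by (auto simp: stage_cocycles_def)

text \<open>Acting by \<open>h\<close> translates \<open>x\<close> by \<open>\<phi> h\<close>, which
  leaves leading coefficients unchanged; this gives invariance. Since leading coefficients commute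
  with the coboundary, their uniqueness, compared with the zero function, gives the cocycle
  condition.\<close>

lemma lead_cocycle:
  assumes c: "c \<in> stage_cocycles n (Suc m)" and m: "m < card X"
  shows "lead m n c \<in> trivial.cocycles K n"
proof -
  have cc: "c \<in> cochains K n" and cz: "cobd K n c = (\<lambda>_. \<zero>\<^bsub>K\<^esub>)"
    using c by (auto simp: stage_cocycles_def cocycles_def)
  note poly = stage_cocycles_poly[OF c m]
  have eqv: "lead m n c (trivial.act h (\<zero>\<^bsub>K\<^esub>, \<sigma>)) = lead m n c (\<zero>\<^bsub>K\<^esub>, \<sigma>)"
    if \<sigma>: "\<sigma> \<in> tuples (carrier G) n" and h: "h \<in> carrier G" for \<sigma> h
  proof -
    let ?\<sigma>' = "map (\<lambda>g. g \<otimes>\<^bsub>G\<^esub> h) \<sigma>"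
    have "K.polynomial_on X m (lead m n c (\<zero>\<^bsub>K\<^esub>, ?\<sigma>')) (\<lambda>x. c (x \<oplus>\<^bsub>K\<^esub> \<phi> h, ?\<sigma>'))"
      by (rule K.polynomial_on_translate[OF X_facts(1) poly[OF map_mult_closed[OF \<sigma> h]]
            char_closed[OF h] X_translate[OF _ h]])
    moreover have "c (x \<oplus>\<^bsub>K\<^esub> \<phi> h, ?\<sigma>') = c (x, \<sigma>)" if "x \<in> X" for x
      using cochainsD(3)[OF cc _ h, of "(x, \<sigma>)"] that \<sigma> by (simp add: index_iff act_def)
    ultimately have "K.polynomial_on X m (lead m n c (\<zero>\<^bsub>K\<^esub>, ?\<sigma>')) (\<lambda>x. c (x, \<sigma>))"
      by (rule K.polynomial_on_cong[OF X_facts(1)])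
    then have "lead m n c (\<zero>\<^bsub>K\<^esub>, ?\<sigma>') = lead m n c (\<zero>\<^bsub>K\<^esub>, \<sigma>)"
      using lead_eq[OF m _ \<sigma>, of _ c] by simp
    then show ?thesis by (simp add: trivial.act_def)
  qed
  have closed: "lead m n c i \<in> carrier K" for i
  proof (cases "i \<in> trivial.index n")
    case True
    then obtain \<sigma> where "i = (\<zero>\<^bsub>K\<^esub>, \<sigma>)" "\<sigma> \<in> tuples (carrier G) n" by (cases i) auto
    then show ?thesis using K.polynomial_on_closed(1)[OF X_facts(1) poly] by simp
  qed (simp add: lead_outside)
  have "lead m n c \<in> trivial.cochains K n"
    unfolding trivial.cochains_def mem_Collect_eq
  proof (intro conjI allI ballI impI closed lead_outside)
    fix i h assume i: "i \<in> trivial.index n" and h: "h \<in> carrier G"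
    then obtain \<sigma> where "i = (\<zero>\<^bsub>K\<^esub>, \<sigma>)" "\<sigma> \<in> tuples (carrier G) n" by (cases i) auto
    then show "lead m n c (trivial.act h i) = lead m n c i" using eqv h by simp
  qed
  moreover have "trivial.cobd K n (lead m n c) (x, \<sigma>) = \<zero>\<^bsub>K\<^esub>" for x \<sigma>
  proof (cases "(x, \<sigma>) \<in> trivial.index (Suc n)")
    case True
    then have x: "x = \<zero>\<^bsub>K\<^esub>" and \<sigma>: "\<sigma> \<in> tuples (carrier G) (Suc n)" by auto
    have "K.polynomial_on X m (delta K (\<lambda>\<tau>. lead m n c (\<zero>\<^bsub>K\<^esub>, \<tau>)) \<sigma>) (\<lambda>x. cobd K n c (x, \<sigma>))"
      using poly \<sigma> by (intro polynomial_on_cobd)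
    then have "delta K (\<lambda>\<tau>. lead m n c (\<zero>\<^bsub>K\<^esub>, \<tau>)) \<sigma> = \<zero>\<^bsub>K\<^esub>"
      using K.polynomial_on_unique[OF X_facts(1,2) m] K.polynomial_on_zero[OF X_facts(1)]
      unfolding cz by blast
    then show ?thesis using x \<sigma> by (simp add: trivial.cobd_def)
  qed (simp add: trivial.cobd_def del: trivial_index)
  ultimately show ?thesis by (auto simp: trivial.cocycles_def)
qed

lemma lead_kernel:
  assumes m: "m < card X"
  shows "{c \<in> stage_cocycles n (Suc m). lead m n c = (\<lambda>_. \<zero>\<^bsub>K\<^esub>)} = stage_cocycles n m"
proof (intro equalityI subsetI)
  fix c assume c: "c \<in> {c \<in> stage_cocycles n (Suc m). lead m n c = (\<lambda>_. \<zero>\<^bsub>K\<^esub>)}"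
  then show "c \<in> stage_cocycles n m"
    using stage_cocycles_poly[of c n m, OF _ m] by (auto simp: stage_cocycles_def stage_iff[of m])
next
  fix c assume c: "c \<in> stage_cocycles n m"
  then have poly: "K.polynomial_on X m \<zero>\<^bsub>K\<^esub> (\<lambda>x. c (x, \<sigma>))" if "\<sigma> \<in> tuples (carrier G) n" for \<sigma>
    using that by (simp add: stage_cocycles_def stage_iff)
  then have "c \<in> stage_cocycles n (Suc m)"
    using c by (auto simp: stage_cocycles_def)
  moreover have "lead m n c (x, \<sigma>) = \<zero>\<^bsub>K\<^esub>" for x \<sigma>
    using lead_eq[OF m poly] by (cases "(x, \<sigma>) \<in> trivial.index n") (auto simp: lead_def)
  ultimately show "c \<in> {c \<in> stage_cocycles n (Suc m). lead m n c = (\<lambda>_. \<zero>\<^bsub>K\<^esub>)}" by auto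
qed

lemma lead_linear:
  assumes m: "m < card X" and c: "c \<in> stage_cocycles n (Suc m)"
  shows "d \<in> stage_cocycles n (Suc m) \<Longrightarrow>
      lead m n (\<lambda>i. c i \<oplus>\<^bsub>K\<^esub> d i) = (\<lambda>i. lead m n c i \<oplus>\<^bsub>K\<^esub> lead m n d i)"
    "a \<in> carrier K \<Longrightarrow> lead m n (\<lambda>i. a \<otimes>\<^bsub>K\<^esub> c i) = (\<lambda>i. a \<otimes>\<^bsub>K\<^esub> lead m n c i)"
proof -
  show "lead m n (\<lambda>i. c i \<oplus>\<^bsub>K\<^esub> d i) = (\<lambda>i. lead m n c i \<oplus>\<^bsub>K\<^esub> lead m n d i)"
    if d: "d \<in> stage_cocycles n (Suc m)"
  proof (intro ext, clarify)
    fix x \<sigma>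
    show "lead m n (\<lambda>i. c i \<oplus>\<^bsub>K\<^esub> d i) (x, \<sigma>) = lead m n c (x, \<sigma>) \<oplus>\<^bsub>K\<^esub> lead m n d (x, \<sigma>)"
    proof (cases "(x, \<sigma>) \<in> trivial.index n")
      case True
      then have x: "x = \<zero>\<^bsub>K\<^esub>" and \<sigma>: "\<sigma> \<in> tuples (carrier G) n" by simp_all
      show ?thesis
        unfolding x
        by (rule lead_eq[OF m K.polynomial_on_add[OF X_facts(1)
                stage_cocycles_poly[OF c m \<sigma>] stage_cocycles_poly[OF d m \<sigma>]] \<sigma>])
    qed (simp add: lead_outside del: trivial_index)
  qed
  show "lead m n (\<lambda>i. a \<otimes>\<^bsub>K\<^esub> c i) = (\<lambda>i. a \<otimes>\<^bsub>K\<^esub> lead m n c i)" if a: "a \<in> carrier K"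
  proof (intro ext, clarify)
    fix x \<sigma>
    show "lead m n (\<lambda>i. a \<otimes>\<^bsub>K\<^esub> c i) (x, \<sigma>) = a \<otimes>\<^bsub>K\<^esub> lead m n c (x, \<sigma>)"
    proof (cases "(x, \<sigma>) \<in> trivial.index n")
      case True
      then have x: "x = \<zero>\<^bsub>K\<^esub>" and \<sigma>: "\<sigma> \<in> tuples (carrier G) n" by simp_all
      show ?thesis
        unfolding x
        by (rule lead_eq[OF m K.polynomial_on_smult[OF X_facts(1) stage_cocycles_poly[OF c m \<sigma>] a] \<sigma>])
    qed (use a in \<open>simp add: lead_outside del: trivial_index\<close>)
  qed
qed

text \<open>The equivariant lift of \<open>b(\<sigma>)\<close> is \<open>b(\<sigma>) (x - \<phi>(\<sigma>\<^sub>0))\<^sup>m\<close>.\<close>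

lemma lift_cochain:
  assumes b: "b \<in> trivial.cochains K (Suc k)"
  obtains c where "c \<in> cochains K (Suc k)"
    "\<And>\<sigma>. \<sigma> \<in> tuples (carrier G) (Suc k) \<Longrightarrow> K.polynomial_on X m (b (\<zero>\<^bsub>K\<^esub>, \<sigma>)) (\<lambda>x. c (x, \<sigma>))"
proof
  define c where "c = (\<lambda>(x, \<sigma>). if (x, \<sigma>) \<in> index (Suc k)
    then b (\<zero>\<^bsub>K\<^esub>, \<sigma>) \<otimes>\<^bsub>K\<^esub> (x \<ominus>\<^bsub>K\<^esub> \<phi> (hd \<sigma>)) [^]\<^bsub>K\<^esub> m else \<zero>\<^bsub>K\<^esub>)"
  note * = trivial.cochainsD[OF b]
  have hd: "hd \<sigma> \<in> carrier G" if "\<sigma> \<in> tuples (carrier G) (Suc k)" for \<sigma>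
    using that by (auto elim: tuples_SucE)
  have "c (act h (x, \<sigma>)) = c (x, \<sigma>)" if i: "(x, \<sigma>) \<in> index (Suc k)" and h: "h \<in> carrier G" for x \<sigma> h
  proof -
    have x: "x \<in> carrier K" and \<sigma>: "\<sigma> \<in> tuples (carrier G) (Suc k)" using i by (auto simp: index_iff)
    have "b (\<zero>\<^bsub>K\<^esub>, map (\<lambda>g. g \<otimes>\<^bsub>G\<^esub> h) \<sigma>) = b (\<zero>\<^bsub>K\<^esub>, \<sigma>)"
      using *(3)[of "(\<zero>\<^bsub>K\<^esub>, \<sigma>)" h] \<sigma> h by (simp add: trivial.act_def)
    moreover have "hd (map (\<lambda>g. g \<otimes>\<^bsub>G\<^esub> h) \<sigma>) = hd \<sigma> \<otimes>\<^bsub>G\<^esub> h"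
      using \<sigma> by (auto elim: tuples_SucE)
    moreover have "x \<oplus>\<^bsub>K\<^esub> \<phi> h \<ominus>\<^bsub>K\<^esub> (\<phi> (hd \<sigma>) \<oplus>\<^bsub>K\<^esub> \<phi> h) = x \<ominus>\<^bsub>K\<^esub> \<phi> (hd \<sigma>)"
    proof -
      have "x \<oplus>\<^bsub>K\<^esub> \<phi> h \<ominus>\<^bsub>K\<^esub> (\<phi> (hd \<sigma>) \<oplus>\<^bsub>K\<^esub> \<phi> h) =
          x \<oplus>\<^bsub>K\<^esub> (\<phi> h \<oplus>\<^bsub>K\<^esub> \<ominus>\<^bsub>K\<^esub> \<phi> h) \<oplus>\<^bsub>K\<^esub> \<ominus>\<^bsub>K\<^esub> \<phi> (hd \<sigma>)"
        using x h hd[OF \<sigma>] by (simp only: a_minus_def K.minus_add char_closed K.a_ac K.a_closed K.a_inv_closed)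
      then show ?thesis using x h by (simp add: K.r_neg a_minus_def)
    qed
    ultimately show ?thesis
      using i act_closed[OF i h] h hd[OF \<sigma>] by (simp add: c_def act_def char_mult)
  qed
  moreover have "c i \<in> carrier K" for i
    using *(1) hd by (auto simp: c_def index_iff intro!: K.m_closed K.nat_pow_closed split: prod.splits)
  ultimately show "c \<in> cochains K (Suc k)"
    by (auto simp: cochains_def c_def simp del: split_paired_All)
  fix \<sigma> assume \<sigma>: "\<sigma> \<in> tuples (carrier G) (Suc k)"
  have "K.polynomial_on X m (b (\<zero>\<^bsub>K\<^esub>, \<sigma>)) (\<lambda>x. b (\<zero>\<^bsub>K\<^esub>, \<sigma>) \<otimes>\<^bsub>K\<^esub> (x \<ominus>\<^bsub>K\<^esub> \<phi> (hd \<sigma>)) [^]\<^bsub>K\<^esub> m)"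
    using hd[OF \<sigma>] *(1) by (intro K.polynomial_on_power[OF X_facts(1)]) auto
  then show "K.polynomial_on X m (b (\<zero>\<^bsub>K\<^esub>, \<sigma>)) (\<lambda>x. c (x, \<sigma>))"
    by (rule K.polynomial_on_cong[OF X_facts(1)]) (use \<sigma> in \<open>simp add: c_def index_iff\<close>)
qed

section \<open>The filtration when cohomology vanishes in one degree\<close>

context
  fixes k
  assumes exact: "trivial.exact_at K (Suc k)"
begin

text \<open>Exactness makes \<open>lead\<close> surjective on cocycles: a cocycle \<open>t\<close>
  need not lift directly, but a cochain bounding it does, and the coboundary of that lift is again a
  cocycle. The lift is centred at the first list entry, so the bounding cochain must have positive
  length; hence exactness at \<open>Suc k\<close>.\<close>

lemma lead_lift:
  assumes t: "t \<in> trivial.cocycles K (Suc (Suc k))" and m: "m < card X"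
  obtains c where "c \<in> cochains K (Suc k)" "cobd K (Suc k) c \<in> stage_cocycles (Suc (Suc k)) (Suc m)"
    "lead m (Suc (Suc k)) (cobd K (Suc k) c) = t"
proof -
  obtain b where b: "b \<in> trivial.cochains K (Suc k)" "t = trivial.cobd K (Suc k) b"
    using exact t by (auto simp: trivial.exact_at_def)
  obtain c where c: "c \<in> cochains K (Suc k)"
    "\<And>\<sigma>. \<sigma> \<in> tuples (carrier G) (Suc k) \<Longrightarrow> K.polynomial_on X m (b (\<zero>\<^bsub>K\<^esub>, \<sigma>)) (\<lambda>x. c (x, \<sigma>))"
    using lift_cochain[OF b(1)] by blast
  have poly: "K.polynomial_on X m (delta K (\<lambda>\<tau>. b (\<zero>\<^bsub>K\<^esub>, \<tau>)) \<sigma>) (\<lambda>x. cobd K (Suc k) c (x, \<sigma>))"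
    if "\<sigma> \<in> tuples (carrier G) (Suc (Suc k))" for \<sigma>
    using polynomial_on_cobd[OF c(2) that] .
  have "cobd K (Suc k) c \<in> stage_cocycles (Suc (Suc k)) (Suc m)"
    using cobd_cocycle[OF K.abelian_group_axioms c(1)] poly by (auto simp: stage_cocycles_def)
  moreover have "lead m (Suc (Suc k)) (cobd K (Suc k) c) (x, \<sigma>) = t (x, \<sigma>)" for x \<sigma>
    using lead_eq[OF m poly]
    by (cases "(x, \<sigma>) \<in> trivial.index (Suc (Suc k))") (auto simp: b(2) trivial.cobd_def lead_def)
  ultimately show ?thesis using that c(1) by (auto simp: fun_eq_iff)
qed

text \<open>Passing from stage \<open>m\<close> to stage \<open>Suc m\<close> adds one copy of the
  cocycles over a point: \<open>lead\<close> is onto these, with kernel the previous stage.\<close>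

lemma fun_dim_stage_cocycles:
  "m \<le> card X \<Longrightarrow> fun_dim K (stage_cocycles (Suc (Suc k)) m) =
     m * fun_dim K (trivial.cocycles K (Suc (Suc k)))"
proof (induction m)
  case 0
  have "determines K {} (stage_cocycles (Suc (Suc k)) 0)"
    using stage_cocycles_0 by (auto simp: determines_def)
  then show ?case using K.fun_dim_le(1)[OF fun_subspace_stage_cocycles, of "{}"] by simp
next
  case (Suc m)
  then have m: "m < card X" by simp
  have "fun_dim K (stage_cocycles (Suc (Suc k)) (Suc m)) =
      fun_dim K (trivial.cocycles K (Suc (Suc k))) +
      fun_dim K {c \<in> stage_cocycles (Suc (Suc k)) (Suc m). lead m (Suc (Suc k)) c = (\<lambda>_. \<zero>\<^bsub>K\<^esub>)}"
  proof (rule K.fun_rank_nullity[OF fun_subspace_stage_cocycles finite_index])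
    show "determines K (index (Suc (Suc k))) (stage_cocycles (Suc (Suc k)) (Suc m))"
      by (rule determines_cochains[OF K.field_axioms]) (auto simp: stage_cocycles_def cocycles_def)
    show "fun_subspace K (trivial.cocycles K (Suc (Suc k)))"
      by (rule trivial.fun_subspace_cocycles[OF K.field_axioms])
    show "lead m (Suc (Suc k)) ` stage_cocycles (Suc (Suc k)) (Suc m) = trivial.cocycles K (Suc (Suc k))"
      using lead_cocycle[OF _ m] lead_lift[OF _ m] by (auto simp: image_iff) metis
  qed (use lead_linear[OF m] in auto)
  then show ?case using Suc m by (simp add: lead_kernel)
qed

text \<open>Subtract from a cocycle the coboundary of a lift with the same leading coefficients;
  what remains lies one stage lower.\<close>

lemma stage_cocycles_exact:
  "m \<le> card X \<Longrightarrow> stage_cocycles (Suc (Suc k)) m \<subseteq> cobd K (Suc k) ` cochains K (Suc k)"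
proof (induction m)
  case 0
  have "\<zero>\<^bsub>fun_module K (stage_cocycles (Suc (Suc k)) 0)\<^esub> \<in> cobd K (Suc k) ` cochains K (Suc k)"
    using K.fun_subspaceD(2)[OF fun_subspace_cobd_image[OF K.field_axioms]] by simp
  then show ?case using stage_cocycles_0 by auto
next
  case (Suc m)
  then have m: "m < card X" by simp
  note img = K.fun_subspaceD[OF fun_subspace_cobd_image[OF K.field_axioms, of "Suc k"]]
  note st = K.fun_subspaceD[OF fun_subspace_stage_cocycles[of "Suc (Suc k)" "Suc m"]]
  show ?case
  proof
    fix c assume c: "c \<in> stage_cocycles (Suc (Suc k)) (Suc m)"
    obtain b where b: "b \<in> cochains K (Suc k)" "cobd K (Suc k) b \<in> stage_cocycles (Suc (Suc k)) (Suc m)"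
      "lead m (Suc (Suc k)) (cobd K (Suc k) b) = lead m (Suc (Suc k)) c"
      using lead_lift[OF lead_cocycle[OF c m] m] by blast
    define d where "d = (\<lambda>i. c i \<ominus>\<^bsub>K\<^esub> cobd K (Suc k) b i)"
    have d: "d \<in> stage_cocycles (Suc (Suc k)) (Suc m)" unfolding d_def by (rule st(5)[OF c b(2)])
    have c_eq: "c = (\<lambda>i. cobd K (Suc k) b i \<oplus>\<^bsub>K\<^esub> d i)"
      using st(1)[OF c] st(1)[OF b(2)]
      by (auto simp: d_def fun_eq_iff a_minus_def K.a_lcomm[of "cobd K (Suc k) b _"] K.r_neg)
    have closed: "lead m (Suc (Suc k)) d i \<in> carrier K" "lead m (Suc (Suc k)) c i \<in> carrier K" for i
      using lead_cocycle[OF d m] lead_cocycle[OF c m]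
      by (auto simp: trivial.cocycles_def dest: trivial.cochainsD(1))
    have eq: "lead m (Suc (Suc k)) c i = lead m (Suc (Suc k)) c i \<oplus>\<^bsub>K\<^esub> lead m (Suc (Suc k)) d i" for i
      using fun_cong[OF lead_linear(1)[OF m b(2) d], of i] by (simp only: c_eq[symmetric] b(3))
    have "lead m (Suc (Suc k)) d = (\<lambda>_. \<zero>\<^bsub>K\<^esub>)"
      using K.add.l_cancel_one'[OF closed(2) closed(1)] eq by blast
    then have "d \<in> stage_cocycles (Suc (Suc k)) m" using d lead_kernel[OF m] by blast
    then have "d \<in> cobd K (Suc k) ` cochains K (Suc k)" using Suc by auto
    then show "c \<in> cobd K (Suc k) ` cochains K (Suc k)"
      unfolding c_eq using b(1) by (intro img(3)) auto
  qed
qed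

lemma stage_cocycles_all: "stage_cocycles n (card X) = cocycles K n"
proof -
  obtain q where q: "card X = Suc q" using X_facts(3) by (cases "card X") auto
  have *: "stage (card X) f" if f: "\<And>x. x \<in> X \<Longrightarrow> f x \<in> carrier K" for f
  proof -
    obtain \<alpha> g where "K.polynomial_on X q \<alpha> g" "\<And>x. x \<in> X \<Longrightarrow> g x = f x"
      using K.polynomial_on_interpolation[OF X_facts(1) subset_refl q, of f] f by blast
    then have "K.polynomial_on X q \<alpha> f" by (rule K.polynomial_on_cong[OF X_facts(1)])
    then show ?thesis unfolding q by auto
  qed
  have "stage (card X) (\<lambda>x. c (x, \<sigma>))" if "c \<in> cocycles K n" for c \<sigma>
    using that cochainsD(1)[of c K n] by (intro *) (simp add: cocycles_def)
  then show ?thesis by (auto simp: stage_cocycles_def)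
qed

theorem trivial_if_exact: "card X = 1"
proof -
  \<comment> \<open>Integers rather than naturals, because the differences to be compared alternate
    in sign.\<close>
  let ?z = "\<lambda>l. int (fun_dim (class_ring :: rat ring) (cocycles class_ring l))"
  let ?t = "\<lambda>l. int (fun_dim (class_ring :: rat ring) (trivial.cocycles class_ring l))"
  have "exact_at K (Suc k)"
    using stage_cocycles_exact[of "card X"] by (simp add: exact_at_def stage_cocycles_all)
  \<comment> \<open>Both complexes over \<open>K\<close>, the one on \<open>X\<close> and the one on
    a point, are exact at \<open>Suc k\<close>, so for both the dimensions over \<open>K\<close> may
    be replaced by rational ones.\<close>
  then have "?z (Suc (Suc k)) = int (fun_dim K (cocycles K (Suc (Suc k))))"
    using fun_dim_cocycles_exact[OF K.field_axioms] by simp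
  also have "\<dots> = card X * int (fun_dim K (trivial.cocycles K (Suc (Suc k))))"
    using fun_dim_stage_cocycles[of "card X"] by (simp add: stage_cocycles_all)
  also have "\<dots> = card X * ?t (Suc (Suc k))"
    using trivial.fun_dim_cocycles_exact[OF K.field_axioms exact] by simp
  finally have eq: "?z (Suc (Suc k)) = card X * ?t (Suc (Suc k))" .
  have "(\<lambda>_. \<zero>\<^bsub>K\<^esub>) ` carrier G = {\<zero>\<^bsub>K\<^esub>}" using G.one_closed by auto
  then have t: "?t (Suc (Suc l)) + ?t (Suc l) = int (card (carrier G) ^ l)" for l
  proof -
    have "fun_dim (class_ring :: rat ring) (trivial.cocycles class_ring (Suc (Suc l))) +
        fun_dim (class_ring :: rat ring) (trivial.cocycles class_ring (Suc l)) = card (carrier G) ^ l"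
      using trivial.rat_cocycles_recursion(3)[of l] \<open>_ = {\<zero>\<^bsub>K\<^esub>}\<close> by simp
    then show ?thesis by (metis of_nat_add)
  qed
  have z: "?z (Suc (Suc l)) + ?z (Suc l) = card X * int (card (carrier G) ^ l)" for l
    unfolding of_nat_add[symmetric] of_nat_mult[symmetric] rat_cocycles_recursion(3) ..
  \<comment> \<open>The factor \<open>card X\<close> makes the right-hand sides of the two
    recursions equal, so they cancel and only the sign survives. At \<open>l = Suc k\<close> the
    left side is zero by \<open>eq\<close>.\<close>
  have "?z (Suc l) - card X * ?t (Suc l) = (- 1) ^ l * (1 - int (card X))" for l
  proof (induction l)
    case 0
    show ?case unfolding rat_cocycles_recursion(2) trivial.rat_cocycles_recursion(2) by simp
  next
    case (Suc l)
    have "card X * ?t (Suc (Suc l)) + card X * ?t (Suc l) = card X * int (card (carrier G) ^ l)"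
      unfolding t[symmetric] by (rule distrib_left[symmetric])
    then have "?z (Suc (Suc l)) - card X * ?t (Suc (Suc l)) = - (?z (Suc l) - card X * ?t (Suc l))"
      using z[of l] by linarith
    then show ?case unfolding Suc by simp
  qed
  from this[of "Suc k"] show ?thesis using eq by simp
qed

end

end

section \<open>Modules over the group algebra as spaces with a group action\<close>

lemma (in right_module) finsum_smult:
  assumes "finite I" "f \<in> I \<rightarrow> carrier R" "x \<in> carrier M"
  shows "(\<Oplus>\<^bsub>R\<^esub>i\<in>I. f i) \<odot>\<^bsub>M\<^esub> x = (\<Oplus>\<^bsub>M\<^esub>i\<in>I. f i \<odot>\<^bsub>M\<^esub> x)"
  using assms
proof (induction I)
  case (insert i I)
  then have "(\<lambda>i. f i \<odot>\<^bsub>M\<^esub> x) \<in> I \<rightarrow> carrier M" "f \<in> I \<rightarrow> carrier R" "f i \<in> carrier R" by auto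
  then show ?case using insert by (simp add: smult_l_distr)
qed simp

locale finite_group_field_algebra = finite_group_algebra G K + K?: field K
  for G :: "('g, 'b) monoid_scheme" (structure) and K :: "('k, 'a) ring_scheme" (structure)
begin

definition gelt :: "'g \<Rightarrow> 'g \<Rightarrow> 'k" where
  "gelt g = (\<lambda>k\<in>carrier G. if k = g then \<one>\<^bsub>K\<^esub> else \<zero>\<^bsub>K\<^esub>)"

definition gact :: "('g \<Rightarrow> 'k, 'm, 'e) module_scheme \<Rightarrow> 'g \<Rightarrow> 'm \<Rightarrow> 'm" where
  "gact M g x = gelt g \<odot>\<^bsub>M\<^esub> x"

definition scal :: "('g \<Rightarrow> 'k, 'm, 'e) module_scheme \<Rightarrow> 'k \<Rightarrow> 'm \<Rightarrow> 'm" where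
  "scal M c x = group_algebra_scalar K G c \<odot>\<^bsub>M\<^esub> x"

lemma gelt_closed [simp]: "gelt g \<in> carrier KG"
  by (auto simp: gelt_def)

lemma mult_gelt:
  assumes b: "b \<in> carrier KG" and g: "g \<in> carrier G" and k: "k \<in> carrier G"
  shows "(b \<otimes>\<^bsub>KG\<^esub> gelt g) k = b (k \<otimes>\<^bsub>G\<^esub> inv\<^bsub>G\<^esub> g)"
proof -
  have "(b \<otimes>\<^bsub>KG\<^esub> gelt g) k =
      (\<Oplus>\<^bsub>K\<^esub>h\<in>carrier G. if k \<otimes>\<^bsub>G\<^esub> inv\<^bsub>G\<^esub> g = h then b h else \<zero>\<^bsub>K\<^esub>)"
    unfolding group_algebra_mult[OF k]
  proof (intro K.add.finprod_cong')
    fix h assume h: "h \<in> carrier G"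
    have "inv\<^bsub>G\<^esub> h \<otimes>\<^bsub>G\<^esub> k = g \<longleftrightarrow> k \<otimes>\<^bsub>G\<^esub> inv\<^bsub>G\<^esub> g = h"
      using G.inv_solve_left'[of g h k] G.inv_solve_right'[of h k g] g h k by blast
    then show "b h \<otimes>\<^bsub>K\<^esub> gelt g (inv\<^bsub>G\<^esub> h \<otimes>\<^bsub>G\<^esub> k) =
        (if k \<otimes>\<^bsub>G\<^esub> inv\<^bsub>G\<^esub> g = h then b h else \<zero>\<^bsub>K\<^esub>)"
      using b h k by (auto simp: gelt_def PiE_iff)
  qed (use b in \<open>auto simp: PiE_iff\<close>)
  also have "\<dots> = b (k \<otimes>\<^bsub>G\<^esub> inv\<^bsub>G\<^esub> g)"
    using b g k by (intro K.finsum_singleton) (auto simp: PiE_iff)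
  finally show ?thesis .
qed

lemma gelt_mult:
  assumes "g \<in> carrier G" "h \<in> carrier G"
  shows "gelt g \<otimes>\<^bsub>KG\<^esub> gelt h = gelt (g \<otimes>\<^bsub>G\<^esub> h)"
proof (rule group_algebra_ext[OF group_algebra_mult_closed[OF gelt_closed gelt_closed] gelt_closed])
  fix k assume k: "k \<in> carrier G"
  have "k \<otimes>\<^bsub>G\<^esub> inv\<^bsub>G\<^esub> h = g \<longleftrightarrow> k = g \<otimes>\<^bsub>G\<^esub> h"
    using G.inv_solve_right'[of g k h] assms k by blast
  then show "(gelt g \<otimes>\<^bsub>KG\<^esub> gelt h) k = gelt (g \<otimes>\<^bsub>G\<^esub> h) k"
    unfolding mult_gelt[OF gelt_closed assms(2) k] using k assms by (simp add: gelt_def)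
qed

lemma gelt_one: "gelt \<one>\<^bsub>G\<^esub> = \<one>\<^bsub>KG\<^esub>"
  by (simp add: gelt_def group_algebra_scalar_def)

lemma gelt_scalar:
  assumes c: "c \<in> carrier K" and g: "g \<in> carrier G"
  shows "group_algebra_scalar K G c \<otimes>\<^bsub>KG\<^esub> gelt g = gelt g \<otimes>\<^bsub>KG\<^esub> group_algebra_scalar K G c"
proof (rule group_algebra_ext[OF group_algebra_mult_closed group_algebra_mult_closed])
  fix k assume k: "k \<in> carrier G"
  have "(gelt g \<otimes>\<^bsub>KG\<^esub> group_algebra_scalar K G c) k =
      (\<Oplus>\<^bsub>K\<^esub>h\<in>carrier G. if g = h then group_algebra_scalar K G c (inv\<^bsub>G\<^esub> g \<otimes>\<^bsub>G\<^esub> k) else \<zero>\<^bsub>K\<^esub>)"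
    unfolding group_algebra_mult[OF k]
    using c g k by (intro K.add.finprod_cong') (auto simp: gelt_def group_algebra_scalar_def)
  also have "\<dots> = group_algebra_scalar K G c (inv\<^bsub>G\<^esub> g \<otimes>\<^bsub>G\<^esub> k)"
    using c g k by (intro K.finsum_singleton) (auto simp: group_algebra_scalar_def)
  also have "\<dots> = c \<otimes>\<^bsub>K\<^esub> gelt g k"
  proof -
    have "inv\<^bsub>G\<^esub> g \<otimes>\<^bsub>G\<^esub> k = \<one>\<^bsub>G\<^esub> \<longleftrightarrow> k = g"
      using G.inv_solve_left'[of "\<one>\<^bsub>G\<^esub>" g k] g k by (simp only: G.one_closed G.r_one)
    then show ?thesis using c g k by (simp add: group_algebra_scalar_def gelt_def)
  qed
  finally show "(group_algebra_scalar K G c \<otimes>\<^bsub>KG\<^esub> gelt g) k =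
      (gelt g \<otimes>\<^bsub>KG\<^esub> group_algebra_scalar K G c) k"
    using group_algebra_scalar_mult[OF c gelt_closed k, of g] by simp
qed (intro gelt_closed group_algebra_scalar_closed c)+

lemma scalar_add:
  "c \<in> carrier K \<Longrightarrow> e \<in> carrier K \<Longrightarrow> group_algebra_scalar K G (c \<oplus>\<^bsub>K\<^esub> e) =
    group_algebra_scalar K G c \<oplus>\<^bsub>KG\<^esub> group_algebra_scalar K G e"
  by (auto simp: group_algebra_scalar_def fun_eq_iff)

lemma scalar_mult:
  assumes "c \<in> carrier K" "e \<in> carrier K"
  shows "group_algebra_scalar K G (c \<otimes>\<^bsub>K\<^esub> e) = group_algebra_scalar K G e \<otimes>\<^bsub>KG\<^esub> group_algebra_scalar K G c"
proof (rule group_algebra_ext)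
  fix g assume "g \<in> carrier G"
  then show "group_algebra_scalar K G (c \<otimes>\<^bsub>K\<^esub> e) g = (group_algebra_scalar K G e \<otimes>\<^bsub>KG\<^esub> group_algebra_scalar K G c) g"
    using group_algebra_scalar_mult[OF assms(2) group_algebra_scalar_closed[OF assms(1)], of g] assms
    by (auto simp: group_algebra_scalar_def K.m_comm)
qed (use assms in \<open>simp_all only: group_algebra_mult_closed group_algebra_scalar_closed K.m_closed\<close>)

lemma finsum_group_algebra:
  assumes "finite I" "\<And>i. i \<in> I \<Longrightarrow> f i \<in> carrier KG" "k \<in> carrier G"
  shows "(\<Oplus>\<^bsub>KG\<^esub>i\<in>I. f i) k = (\<Oplus>\<^bsub>K\<^esub>i\<in>I. f i k)"
proof -
  interpret KG: ring KG by (rule ring_group_algebra)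
  show ?thesis
    using assms(1,2)
  proof (induction I)
    case empty
    then show ?case using assms(3) by (simp only: KG.finsum_empty K.finsum_empty) simp
  next
    case (insert i I)
    then have cl: "f \<in> I \<rightarrow> carrier KG" "f i \<in> carrier KG" by auto
    have "f i k \<in> carrier K" if "f i \<in> carrier KG" for i
      using that assms(3) by auto
    then have cl': "(\<lambda>i. f i k) \<in> I \<rightarrow> carrier K" "f i k \<in> carrier K" using cl by blast+
    have "(\<Oplus>\<^bsub>KG\<^esub>i\<in>insert i I. f i) k = (f i \<oplus>\<^bsub>KG\<^esub> (\<Oplus>\<^bsub>KG\<^esub>i\<in>I. f i)) k"
      using KG.finsum_insert[OF insert.hyps(1,2) cl] by (rule fun_cong)
    also have "\<dots> = f i k \<oplus>\<^bsub>K\<^esub> (\<Oplus>\<^bsub>KG\<^esub>i\<in>I. f i) k" using assms(3) by simp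
    also have "\<dots> = f i k \<oplus>\<^bsub>K\<^esub> (\<Oplus>\<^bsub>K\<^esub>i\<in>I. f i k)" using insert by simp
    also have "\<dots> = (\<Oplus>\<^bsub>K\<^esub>i\<in>insert i I. f i k)"
      by (rule K.finsum_insert[OF insert.hyps(1,2) cl', symmetric])
    finally show ?case .
  qed
qed

lemma group_algebra_decomposition:
  assumes a: "a \<in> carrier KG"
  shows "a = (\<Oplus>\<^bsub>KG\<^esub>g\<in>carrier G. group_algebra_scalar K G (a g) \<otimes>\<^bsub>KG\<^esub> gelt g)"
proof -
  interpret KG: ring KG by (rule ring_group_algebra)
  have ac: "a g \<in> carrier K" if "g \<in> carrier G" for g using a that by auto
  have cl: "group_algebra_scalar K G (a g) \<otimes>\<^bsub>KG\<^esub> gelt g \<in> carrier KG" if "g \<in> carrier G" for g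
    by (intro group_algebra_mult_closed group_algebra_scalar_closed gelt_closed ac that)
  show ?thesis
  proof (rule group_algebra_ext[OF a KG.finsum_closed])
    fix k assume k: "k \<in> carrier G"
    have "(\<Oplus>\<^bsub>KG\<^esub>g\<in>carrier G. group_algebra_scalar K G (a g) \<otimes>\<^bsub>KG\<^esub> gelt g) k =
        (\<Oplus>\<^bsub>K\<^esub>g\<in>carrier G. (group_algebra_scalar K G (a g) \<otimes>\<^bsub>KG\<^esub> gelt g) k)"
      by (rule finsum_group_algebra[OF finite_G cl k])
    also have "\<dots> = (\<Oplus>\<^bsub>K\<^esub>g\<in>carrier G. if k = g then a g else \<zero>\<^bsub>K\<^esub>)"
    proof (intro K.add.finprod_cong')
      fix g assume g: "g \<in> carrier G"
      have "(group_algebra_scalar K G (a g) \<otimes>\<^bsub>KG\<^esub> gelt g) k = a g \<otimes>\<^bsub>K\<^esub> gelt g k"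
        by (rule group_algebra_scalar_mult[OF ac[OF g] gelt_closed k])
      then show "(group_algebra_scalar K G (a g) \<otimes>\<^bsub>KG\<^esub> gelt g) k = (if k = g then a g else \<zero>\<^bsub>K\<^esub>)"
        using ac[OF g] k by (simp add: gelt_def)
    qed (use ac in auto)
    also have "\<dots> = a k" using ac k by (intro K.finsum_singleton) auto
    finally show "a k = (\<Oplus>\<^bsub>KG\<^esub>g\<in>carrier G. group_algebra_scalar K G (a g) \<otimes>\<^bsub>KG\<^esub> gelt g) k" ..
  qed (use cl in blast)
qed

context
  fixes M :: "('g \<Rightarrow> 'k, 'm, 'e) module_scheme"
  assumes M: "right_module KG M"
begin

interpretation M: right_module KG M by (rule M)

lemma gact_closed: "x \<in> carrier M \<Longrightarrow> gact M g x \<in> carrier M"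
  unfolding gact_def by (rule M.smult_closed[OF gelt_closed])

lemma gact_add: "x \<in> carrier M \<Longrightarrow> y \<in> carrier M \<Longrightarrow> gact M g (x \<oplus>\<^bsub>M\<^esub> y) = gact M g x \<oplus>\<^bsub>M\<^esub> gact M g y"
  unfolding gact_def by (rule M.smult_r_distr[OF gelt_closed])

lemma gact_gact:
  assumes "g \<in> carrier G" "h \<in> carrier G" "x \<in> carrier M"
  shows "gact M h (gact M g x) = gact M (g \<otimes>\<^bsub>G\<^esub> h) x"
  unfolding gact_def gelt_mult[OF assms(1,2), symmetric]
  by (rule M.smult_assoc[OF gelt_closed gelt_closed assms(3), symmetric])

lemma gact_one: "x \<in> carrier M \<Longrightarrow> gact M \<one>\<^bsub>G\<^esub> x = x"
  unfolding gact_def gelt_one by (rule M.smult_one)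

lemma gact_inv:
  assumes g: "g \<in> carrier G" and x: "x \<in> carrier M"
  shows "gact M g (gact M (inv\<^bsub>G\<^esub> g) x) = x" "gact M (inv\<^bsub>G\<^esub> g) (gact M g x) = x"
  unfolding gact_gact[OF G.inv_closed[OF g] g x] gact_gact[OF g G.inv_closed[OF g] x]
    G.l_inv[OF g] G.r_inv[OF g] by (rule gact_one[OF x])+

lemma scal_closed: "c \<in> carrier K \<Longrightarrow> x \<in> carrier M \<Longrightarrow> scal M c x \<in> carrier M"
  unfolding scal_def by (intro M.smult_closed group_algebra_scalar_closed)

lemma scal_add: "c \<in> carrier K \<Longrightarrow> x \<in> carrier M \<Longrightarrow> y \<in> carrier M \<Longrightarrow>
    scal M c (x \<oplus>\<^bsub>M\<^esub> y) = scal M c x \<oplus>\<^bsub>M\<^esub> scal M c y"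
  unfolding scal_def by (intro M.smult_r_distr group_algebra_scalar_closed)

lemma scal_add_left:
  assumes "c \<in> carrier K" "e \<in> carrier K" "x \<in> carrier M"
  shows "scal M (c \<oplus>\<^bsub>K\<^esub> e) x = scal M c x \<oplus>\<^bsub>M\<^esub> scal M e x"
  unfolding scal_def scalar_add[OF assms(1,2)]
  by (rule M.smult_l_distr[OF group_algebra_scalar_closed group_algebra_scalar_closed]) (rule assms)+

lemma scal_scal:
  assumes "c \<in> carrier K" "e \<in> carrier K" "x \<in> carrier M"
  shows "scal M c (scal M e x) = scal M (c \<otimes>\<^bsub>K\<^esub> e) x"
  unfolding scal_def scalar_mult[OF assms(1,2)]
  by (rule M.smult_assoc[OF group_algebra_scalar_closed group_algebra_scalar_closed, symmetric]) (rule assms)+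

lemma scal_one: "x \<in> carrier M \<Longrightarrow> scal M \<one>\<^bsub>K\<^esub> x = x"
  unfolding scal_def group_algebra_simps(4)[symmetric] by (rule M.smult_one)

lemma scal_zero: "c \<in> carrier K \<Longrightarrow> scal M c \<zero>\<^bsub>M\<^esub> = \<zero>\<^bsub>M\<^esub>"
  unfolding scal_def by (rule M.smult_r_null[OF group_algebra_scalar_closed])

lemma scal_zero_left: "x \<in> carrier M \<Longrightarrow> scal M \<zero>\<^bsub>K\<^esub> x = \<zero>\<^bsub>M\<^esub>"
  using scal_add_left[of "\<zero>\<^bsub>K\<^esub>" "\<zero>\<^bsub>K\<^esub>" x]
    M.M.add.l_cancel_one'[of "scal M \<zero>\<^bsub>K\<^esub> x" "scal M \<zero>\<^bsub>K\<^esub> x"] scal_closed[of "\<zero>\<^bsub>K\<^esub>" x]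
  by (simp only: K.zero_closed K.l_zero)

lemma gact_scal:
  assumes "c \<in> carrier K" "g \<in> carrier G" "x \<in> carrier M"
  shows "gact M g (scal M c x) = scal M c (gact M g x)"
  unfolding scal_def gact_def
    M.smult_assoc[OF group_algebra_scalar_closed[OF assms(1)] gelt_closed assms(3), symmetric]
    M.smult_assoc[OF gelt_closed group_algebra_scalar_closed[OF assms(1)] assms(3), symmetric]
    gelt_scalar[OF assms(1,2)] ..

lemma smult_eq_finsum:
  assumes a: "a \<in> carrier KG" and x: "x \<in> carrier M"
  shows "a \<odot>\<^bsub>M\<^esub> x = (\<Oplus>\<^bsub>M\<^esub>g\<in>carrier G. gact M g (scal M (a g) x))"
proof -
  have ac: "a g \<in> carrier K" if "g \<in> carrier G" for g using a that by auto
  have cl: "group_algebra_scalar K G (a g) \<otimes>\<^bsub>KG\<^esub> gelt g \<in> carrier KG" if "g \<in> carrier G" for g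
    by (intro group_algebra_mult_closed group_algebra_scalar_closed gelt_closed ac that)
  have "a \<odot>\<^bsub>M\<^esub> x = (\<Oplus>\<^bsub>KG\<^esub>g\<in>carrier G. group_algebra_scalar K G (a g) \<otimes>\<^bsub>KG\<^esub> gelt g) \<odot>\<^bsub>M\<^esub> x"
    using group_algebra_decomposition[OF a] by (rule arg_cong)
  also have "\<dots> = (\<Oplus>\<^bsub>M\<^esub>g\<in>carrier G. (group_algebra_scalar K G (a g) \<otimes>\<^bsub>KG\<^esub> gelt g) \<odot>\<^bsub>M\<^esub> x)"
    using cl by (intro M.finsum_smult x) blast+
  also have "\<dots> = (\<Oplus>\<^bsub>M\<^esub>g\<in>carrier G. gact M g (scal M (a g) x))"
    unfolding gact_def scal_def
    using ac x M.smult_closed[OF gelt_closed M.smult_closed[OF group_algebra_scalar_closed x]]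
    by (intro M.M.add.finprod_cong') (auto intro!: M.smult_assoc group_algebra_scalar_closed simp del: group_algebra_simps)
  finally show ?thesis .
qed

end

section \<open>Linear maps and homomorphisms over the group algebra\<close>

definition klin :: "('g \<Rightarrow> 'k, 'm, 'e) module_scheme \<Rightarrow> ('g \<Rightarrow> 'k, 'n, 'f) module_scheme \<Rightarrow> ('m \<Rightarrow> 'n) \<Rightarrow> bool" where
  "klin M N f \<longleftrightarrow> (\<forall>x\<in>carrier M. f x \<in> carrier N) \<and>
     (\<forall>x\<in>carrier M. \<forall>y\<in>carrier M. f (x \<oplus>\<^bsub>M\<^esub> y) = f x \<oplus>\<^bsub>N\<^esub> f y) \<and>
     (\<forall>c\<in>carrier K. \<forall>x\<in>carrier M. f (scal M c x) = scal N c (f x))"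

lemma klinI:
  assumes "\<And>x. x \<in> carrier M \<Longrightarrow> f x \<in> carrier N"
    "\<And>x y. x \<in> carrier M \<Longrightarrow> y \<in> carrier M \<Longrightarrow> f (x \<oplus>\<^bsub>M\<^esub> y) = f x \<oplus>\<^bsub>N\<^esub> f y"
    "\<And>c x. c \<in> carrier K \<Longrightarrow> x \<in> carrier M \<Longrightarrow> f (scal M c x) = scal N c (f x)"
  shows "klin M N f"
  using assms by (simp add: klin_def)

lemma klinD:
  assumes "klin M N f"
  shows "\<And>x. x \<in> carrier M \<Longrightarrow> f x \<in> carrier N"
    "\<And>x y. x \<in> carrier M \<Longrightarrow> y \<in> carrier M \<Longrightarrow> f (x \<oplus>\<^bsub>M\<^esub> y) = f x \<oplus>\<^bsub>N\<^esub> f y"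
    "\<And>c x. c \<in> carrier K \<Longrightarrow> x \<in> carrier M \<Longrightarrow> f (scal M c x) = scal N c (f x)"
  using assms by (simp_all add: klin_def)

lemma klin_comp: "klin L M f \<Longrightarrow> klin M N f' \<Longrightarrow> klin L N (\<lambda>x. f' (f x))"
  by (rule klinI) (simp_all add: klinD)

lemma klin_zero:
  assumes M: "right_module KG M" and N: "right_module KG N" and f: "klin M N f"
  shows "f \<zero>\<^bsub>M\<^esub> = \<zero>\<^bsub>N\<^esub>"
proof -
  interpret M: right_module KG M by fact
  interpret N: right_module KG N by fact
  show ?thesis
    using klinD(2)[OF f, of "\<zero>\<^bsub>M\<^esub>" "\<zero>\<^bsub>M\<^esub>"] klinD(1)[OF f, of "\<zero>\<^bsub>M\<^esub>"]
      N.M.add.l_cancel_one'[of "f \<zero>\<^bsub>M\<^esub>" "f \<zero>\<^bsub>M\<^esub>"] by simp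
qed

lemma klin_diff:
  assumes M: "right_module KG M" and N: "right_module KG N" and f: "klin M N f"
    and x: "x \<in> carrier M" and y: "y \<in> carrier M"
  shows "f (x \<ominus>\<^bsub>M\<^esub> y) = f x \<ominus>\<^bsub>N\<^esub> f y"
proof -
  interpret M: right_module KG M by fact
  interpret N: right_module KG N by fact
  have ny: "\<ominus>\<^bsub>M\<^esub> y \<in> carrier M" using y by simp
  have "f (\<ominus>\<^bsub>M\<^esub> y) \<oplus>\<^bsub>N\<^esub> f y = \<zero>\<^bsub>N\<^esub>"
    using klinD(2)[OF f ny y] klin_zero[OF M N f] y by (simp add: M.M.l_neg)
  then have "\<ominus>\<^bsub>N\<^esub> f y = f (\<ominus>\<^bsub>M\<^esub> y)"
    by (rule N.M.minus_equality[OF _ klinD(1)[OF f y] klinD(1)[OF f ny]])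
  then show ?thesis
    using klinD(2)[OF f x ny] by (simp add: a_minus_def)
qed

lemma klin_finsum:
  assumes M: "right_module KG M" and N: "right_module KG N" and f: "klin M N f"
    and I: "finite I" "\<And>i. i \<in> I \<Longrightarrow> h i \<in> carrier M"
  shows "f (\<Oplus>\<^bsub>M\<^esub>i\<in>I. h i) = (\<Oplus>\<^bsub>N\<^esub>i\<in>I. f (h i))"
proof -
  interpret M: right_module KG M by fact
  interpret N: right_module KG N by fact
  show ?thesis
    using I
  proof (induction I)
    case empty
    then show ?case using klin_zero[OF M N f] by simp
  next
    case (insert i I)
    then show ?case
      using klinD[OF f] by (simp add: Pi_iff)
  qed
qed

lemma klin_of_hom:
  assumes "f \<in> LinearCombinations.module_hom KG M N"
  shows "klin M N f" "\<And>g x. x \<in> carrier M \<Longrightarrow> f (gact M g x) = gact N g (f x)"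
proof -
  have *: "f \<in> carrier M \<rightarrow> carrier N"
    "\<And>x y. x \<in> carrier M \<Longrightarrow> y \<in> carrier M \<Longrightarrow> f (x \<oplus>\<^bsub>M\<^esub> y) = f x \<oplus>\<^bsub>N\<^esub> f y"
    "\<And>a x. a \<in> carrier KG \<Longrightarrow> x \<in> carrier M \<Longrightarrow> f (a \<odot>\<^bsub>M\<^esub> x) = a \<odot>\<^bsub>N\<^esub> f x"
    using assms unfolding LinearCombinations.module_hom_def by blast+
  show "klin M N f"
    using *(1,2) by (intro klinI) (auto simp: scal_def intro!: *(3) group_algebra_scalar_closed simp del: group_algebra_simps)
  show "f (gact M g x) = gact N g (f x)" if "x \<in> carrier M" for g x
    unfolding gact_def by (rule *(3)[OF gelt_closed that])
qed

text \<open>The group elements span the group algebra over \<open>K\<close>, so linearity together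
  with commutation with the group suffices.\<close>

lemma hom_of_klin:
  assumes M: "right_module KG M" and N: "right_module KG N" and f: "klin M N f"
    and eqv: "\<And>g x. g \<in> carrier G \<Longrightarrow> x \<in> carrier M \<Longrightarrow> f (gact M g x) = gact N g (f x)"
  shows "f \<in> LinearCombinations.module_hom KG M N"
proof -
  interpret N: right_module KG N by fact
  note * = klinD[OF f]
  have "f (a \<odot>\<^bsub>M\<^esub> x) = a \<odot>\<^bsub>N\<^esub> f x" if a: "a \<in> carrier KG" and x: "x \<in> carrier M" for a x
  proof -
    have ac: "a g \<in> carrier K" if "g \<in> carrier G" for g using a that by auto
    have "f (a \<odot>\<^bsub>M\<^esub> x) = (\<Oplus>\<^bsub>N\<^esub>g\<in>carrier G. f (gact M g (scal M (a g) x)))"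
      unfolding smult_eq_finsum[OF M a x]
      by (intro klin_finsum[OF M N f] finite_G gact_closed[OF M] scal_closed[OF M] ac x)
    also have "\<dots> = (\<Oplus>\<^bsub>N\<^esub>g\<in>carrier G. gact N g (scal N (a g) (f x)))"
      using ac x * by (intro N.M.add.finprod_cong')
        (auto simp: eqv scal_closed[OF M] intro!: gact_closed[OF N] scal_closed[OF N])
    also have "\<dots> = a \<odot>\<^bsub>N\<^esub> f x" by (rule smult_eq_finsum[OF N a *(1)[OF x], symmetric])
    finally show ?thesis .
  qed
  then show ?thesis unfolding LinearCombinations.module_hom_def using * by blast
qed

end

section \<open>Cochains with coefficients in the linear maps between two modules\<close>

context finite_group_field_algebra
begin

abbreviation tup :: "nat \<Rightarrow> 'g list set" where "tup \<equiv> tuples (carrier G)"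

text \<open>Equivariant cochains with values in the \<open>K\<close>-linear maps from
  \<open>M\<close> to \<open>N\<close>, on which the group acts by conjugation; the condition is
  arranged so that no inverse occurs. The module element comes first so that
  \<open>delta N (c x)\<close> is the coboundary at \<open>x\<close>.\<close>

definition mcochain :: "('g \<Rightarrow> 'k, 'm, 'e) module_scheme \<Rightarrow> ('g \<Rightarrow> 'k, 'n, 'f) module_scheme \<Rightarrow> nat \<Rightarrow>
    ('m \<Rightarrow> 'g list \<Rightarrow> 'n) \<Rightarrow> bool" where
  "mcochain M N l c \<longleftrightarrow> (\<forall>\<sigma>\<in>tup l. klin M N (\<lambda>x. c x \<sigma>)) \<and>
     (\<forall>x\<in>carrier M. \<forall>\<sigma>\<in>tup l. \<forall>h\<in>carrier G.
        c (gact M h x) (map (\<lambda>g. g \<otimes>\<^bsub>G\<^esub> h) \<sigma>) = gact N h (c x \<sigma>))"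

text \<open>Vanishing in degree \<open>l\<close> of the augmented complex of these cochains; for
  positive \<open>l\<close> it stands in for the vanishing of \<open>Ext\<close> in degree
  \<open>l\<close>.\<close>

definition mexact :: "('g \<Rightarrow> 'k, 'm, 'e) module_scheme \<Rightarrow> ('g \<Rightarrow> 'k, 'n, 'f) module_scheme \<Rightarrow> nat \<Rightarrow> bool" where
  "mexact M N l \<longleftrightarrow> (\<forall>c. mcochain M N (Suc l) c \<longrightarrow>
     (\<forall>x\<in>carrier M. \<forall>\<sigma>\<in>tup (Suc (Suc l)). delta N (c x) \<sigma> = \<zero>\<^bsub>N\<^esub>) \<longrightarrow>
     (\<exists>b. mcochain M N l b \<and> (\<forall>x\<in>carrier M. \<forall>\<sigma>\<in>tup (Suc l). c x \<sigma> = delta N (b x) \<sigma>)))"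

lemma mcochainI:
  assumes "\<And>x \<sigma>. x \<in> carrier M \<Longrightarrow> \<sigma> \<in> tup l \<Longrightarrow> c x \<sigma> \<in> carrier N"
    "\<And>x y \<sigma>. x \<in> carrier M \<Longrightarrow> y \<in> carrier M \<Longrightarrow> \<sigma> \<in> tup l \<Longrightarrow> c (x \<oplus>\<^bsub>M\<^esub> y) \<sigma> = c x \<sigma> \<oplus>\<^bsub>N\<^esub> c y \<sigma>"
    "\<And>a x \<sigma>. a \<in> carrier K \<Longrightarrow> x \<in> carrier M \<Longrightarrow> \<sigma> \<in> tup l \<Longrightarrow> c (scal M a x) \<sigma> = scal N a (c x \<sigma>)"
    "\<And>x \<sigma> h. x \<in> carrier M \<Longrightarrow> \<sigma> \<in> tup l \<Longrightarrow> h \<in> carrier G \<Longrightarrow>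
      c (gact M h x) (map (\<lambda>g. g \<otimes>\<^bsub>G\<^esub> h) \<sigma>) = gact N h (c x \<sigma>)"
  shows "mcochain M N l c"
  using assms unfolding mcochain_def by (auto intro!: klinI)

lemma mcochainD:
  assumes "mcochain M N l c"
  shows "\<And>x \<sigma>. x \<in> carrier M \<Longrightarrow> \<sigma> \<in> tup l \<Longrightarrow> c x \<sigma> \<in> carrier N"
    "\<And>x y \<sigma>. x \<in> carrier M \<Longrightarrow> y \<in> carrier M \<Longrightarrow> \<sigma> \<in> tup l \<Longrightarrow> c (x \<oplus>\<^bsub>M\<^esub> y) \<sigma> = c x \<sigma> \<oplus>\<^bsub>N\<^esub> c y \<sigma>"
    "\<And>a x \<sigma>. a \<in> carrier K \<Longrightarrow> x \<in> carrier M \<Longrightarrow> \<sigma> \<in> tup l \<Longrightarrow> c (scal M a x) \<sigma> = scal N a (c x \<sigma>)"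
    "\<And>x \<sigma> h. x \<in> carrier M \<Longrightarrow> \<sigma> \<in> tup l \<Longrightarrow> h \<in> carrier G \<Longrightarrow>
      c (gact M h x) (map (\<lambda>g. g \<otimes>\<^bsub>G\<^esub> h) \<sigma>) = gact N h (c x \<sigma>)"
    "\<And>\<sigma>. \<sigma> \<in> tup l \<Longrightarrow> klin M N (\<lambda>x. c x \<sigma>)"
  using assms unfolding mcochain_def klin_def by blast+

lemma tup_translate: "\<sigma> \<in> tup l \<Longrightarrow> h \<in> carrier G \<Longrightarrow> map (\<lambda>g. g \<otimes>\<^bsub>G\<^esub> h) \<sigma> \<in> tup l"
  by (auto simp: tuples_def)

lemma mcochain_delta:
  assumes M: "right_module KG M" and N: "right_module KG N" and b: "mcochain M N l b"
  shows "mcochain M N (Suc l) (\<lambda>x. delta N (b x))"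
proof (rule mcochainI)
  interpret M: right_module KG M by fact
  interpret N: right_module KG N by fact
  note * = mcochainD[OF b]
  fix x \<sigma> assume x: "x \<in> carrier M" and \<sigma>: "\<sigma> \<in> tup (Suc l)"
  show "delta N (b x) \<sigma> \<in> carrier N"
    using *(1)[OF x] by (intro N.M.delta_closed[OF \<sigma>])
  show "delta N (b (x \<oplus>\<^bsub>M\<^esub> y)) \<sigma> = delta N (b x) \<sigma> \<oplus>\<^bsub>N\<^esub> delta N (b y) \<sigma>" if y: "y \<in> carrier M" for y
  proof -
    have "delta N (b (x \<oplus>\<^bsub>M\<^esub> y)) \<sigma> = delta N (\<lambda>\<tau>. b x \<tau> \<oplus>\<^bsub>N\<^esub> b y \<tau>) \<sigma>"
      by (rule delta_cong[OF \<sigma>]) (rule *(2)[OF x y])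
    also have "\<dots> = delta N (b x) \<sigma> \<oplus>\<^bsub>N\<^esub> delta N (b y) \<sigma>"
      by (rule N.M.delta_add[OF \<sigma> *(1)[OF x] *(1)[OF y]])
    finally show ?thesis .
  qed
  show "delta N (b (scal M a x)) \<sigma> = scal N a (delta N (b x) \<sigma>)" if a: "a \<in> carrier K" for a
  proof -
    have "delta N (b (scal M a x)) \<sigma> = delta N (\<lambda>\<tau>. scal N a (b x \<tau>)) \<sigma>"
      by (rule delta_cong[OF \<sigma>]) (rule *(3)[OF a x])
    also have "\<dots> = scal N a (delta N (b x) \<sigma>)"
      using *(1)[OF x] by (intro N.M.delta_hom[OF N.M.abelian_group_axioms _ _ \<sigma>, symmetric])
        (auto intro: scal_closed[OF N a] scal_add[OF N a])
    finally show ?thesis .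
  qed
  show "delta N (b (gact M h x)) (map (\<lambda>g. g \<otimes>\<^bsub>G\<^esub> h) \<sigma>) = gact N h (delta N (b x) \<sigma>)"
    if h: "h \<in> carrier G" for h
  proof -
    have "delta N (b (gact M h x)) (map (\<lambda>g. g \<otimes>\<^bsub>G\<^esub> h) \<sigma>) = delta N (\<lambda>\<tau>. gact N h (b x \<tau>)) \<sigma>"
      unfolding delta_map by (rule delta_cong[OF \<sigma>]) (rule *(4)[OF x _ h])
    also have "\<dots> = gact N h (delta N (b x) \<sigma>)"
      using *(1)[OF x] by (intro N.M.delta_hom[OF N.M.abelian_group_axioms _ _ \<sigma>, symmetric])
        (auto intro: gact_closed[OF N] gact_add[OF N])
    finally show ?thesis .
  qed
qed

lemma mcochain_minus:
  assumes M: "right_module KG M" and N: "right_module KG N" and b: "mcochain M N l b" and c: "mcochain M N l c"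
  shows "mcochain M N l (\<lambda>x \<sigma>. b x \<sigma> \<ominus>\<^bsub>N\<^esub> c x \<sigma>)"
proof (rule mcochainI)
  interpret M: right_module KG M by fact
  interpret N: right_module KG N by fact
  note B = mcochainD[OF b] and C = mcochainD[OF c]
  fix x \<sigma> assume x: "x \<in> carrier M" and \<sigma>: "\<sigma> \<in> tup l"
  note cl = B(1)[OF x \<sigma>] C(1)[OF x \<sigma>]
  show "b x \<sigma> \<ominus>\<^bsub>N\<^esub> c x \<sigma> \<in> carrier N" using cl by simp
  show "b (x \<oplus>\<^bsub>M\<^esub> y) \<sigma> \<ominus>\<^bsub>N\<^esub> c (x \<oplus>\<^bsub>M\<^esub> y) \<sigma> = (b x \<sigma> \<ominus>\<^bsub>N\<^esub> c x \<sigma>) \<oplus>\<^bsub>N\<^esub> (b y \<sigma> \<ominus>\<^bsub>N\<^esub> c y \<sigma>)"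
    if y: "y \<in> carrier M" for y
    unfolding B(2)[OF x y \<sigma>] C(2)[OF x y \<sigma>]
    using cl B(1)[OF y \<sigma>] C(1)[OF y \<sigma>] by (simp add: a_minus_def N.M.minus_add N.M.a_ac)
  have kl: "klin N N (scal N a)" if "a \<in> carrier K" for a
    using that by (intro klinI) (simp_all add: scal_closed[OF N] scal_add[OF N] scal_scal[OF N] K.m_comm)
  show "b (scal M a x) \<sigma> \<ominus>\<^bsub>N\<^esub> c (scal M a x) \<sigma> = scal N a (b x \<sigma> \<ominus>\<^bsub>N\<^esub> c x \<sigma>)" if a: "a \<in> carrier K" for a
    unfolding B(3)[OF a x \<sigma>] C(3)[OF a x \<sigma>] by (rule klin_diff[OF N N kl[OF a] cl, symmetric])
  have kg: "klin N N (gact N h)" if "h \<in> carrier G" for h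
    using that by (intro klinI) (simp_all add: gact_closed[OF N] gact_add[OF N] gact_scal[OF N])
  show "b (gact M h x) (map (\<lambda>g. g \<otimes>\<^bsub>G\<^esub> h) \<sigma>) \<ominus>\<^bsub>N\<^esub> c (gact M h x) (map (\<lambda>g. g \<otimes>\<^bsub>G\<^esub> h) \<sigma>) =
      gact N h (b x \<sigma> \<ominus>\<^bsub>N\<^esub> c x \<sigma>)" if h: "h \<in> carrier G" for h
    unfolding B(4)[OF x \<sigma> h] C(4)[OF x \<sigma> h] by (rule klin_diff[OF N N kg[OF h] cl, symmetric])
qed

lemma mult_scalar:
  assumes "c \<in> carrier K" "b \<in> carrier KG" "k \<in> carrier G"
  shows "(b \<otimes>\<^bsub>KG\<^esub> group_algebra_scalar K G c) k = b k \<otimes>\<^bsub>K\<^esub> c"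
proof -
  have "(b \<otimes>\<^bsub>KG\<^esub> group_algebra_scalar K G c) k =
      (\<Oplus>\<^bsub>K\<^esub>h\<in>carrier G. if k = h then b h \<otimes>\<^bsub>K\<^esub> c else \<zero>\<^bsub>K\<^esub>)"
    unfolding group_algebra_mult[OF assms(3)]
  proof (intro K.add.finprod_cong')
    fix h assume h: "h \<in> carrier G"
    have "inv\<^bsub>G\<^esub> h \<otimes>\<^bsub>G\<^esub> k = \<one>\<^bsub>G\<^esub> \<longleftrightarrow> k = h"
      using G.inv_solve_left'[of "\<one>\<^bsub>G\<^esub>" h k] h assms(3) by (simp only: G.one_closed G.r_one)
    then show "b h \<otimes>\<^bsub>K\<^esub> group_algebra_scalar K G c (inv\<^bsub>G\<^esub> h \<otimes>\<^bsub>G\<^esub> k) =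
        (if k = h then b h \<otimes>\<^bsub>K\<^esub> c else \<zero>\<^bsub>K\<^esub>)"
      using assms h by (auto simp: group_algebra_scalar_def PiE_iff)
  qed (use assms in \<open>auto simp: PiE_iff\<close>)
  also have "\<dots> = b k \<otimes>\<^bsub>K\<^esub> c"
    using assms by (intro K.finsum_singleton) (auto simp: PiE_iff)
  finally show ?thesis .
qed

section \<open>Exactness on projective modules\<close>

definition component :: "'x set \<Rightarrow> 'g \<Rightarrow> ('x \<Rightarrow> 'g \<Rightarrow> 'k) \<Rightarrow> 'x \<Rightarrow> 'g \<Rightarrow> 'k" where
  "component X g f = (\<lambda>x\<in>X. \<lambda>k\<in>carrier G. if k = g then f x k else \<zero>\<^bsub>K\<^esub>)"

text \<open>A free module over the group algebra is induced from the trivial subgroup: coefficients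
  at one fixed group element form a linear subspace, and the group permutes these subspaces simply
  transitively.\<close>

lemma free_component:
  fixes X :: "'x set"
  defines "F \<equiv> free_right_module KG X"
  shows "g \<in> carrier G \<Longrightarrow> klin F F (component X g)"
    "f \<in> carrier F \<Longrightarrow> (\<Oplus>\<^bsub>F\<^esub>g\<in>carrier G. component X g f) = f"
    "g \<in> carrier G \<Longrightarrow> h \<in> carrier G \<Longrightarrow> f \<in> carrier F \<Longrightarrow>
      component X (g \<otimes>\<^bsub>G\<^esub> h) (gact F h f) = gact F h (component X g f)"
proof -
  have F: "right_module KG F"
    unfolding F_def by (rule right_module_free[OF ring_group_algebra])
  interpret F: right_module KG F by (rule F)
  have F_carrier: "f \<in> carrier F \<longleftrightarrow> f \<in> X \<rightarrow>\<^sub>E carrier KG \<and> finite {x \<in> X. f x \<noteq> \<zero>\<^bsub>KG\<^esub>}" for f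
    by (simp add: F_def)
  have F_val: "f x \<in> carrier KG" if "f \<in> carrier F" "x \<in> X" for f x
    using that F_carrier by blast
  have F_ext: "f = f'" if "f \<in> carrier F" "f' \<in> carrier F"
    "\<And>x k. x \<in> X \<Longrightarrow> k \<in> carrier G \<Longrightarrow> f x k = f' x k" for f f'
  proof (rule PiE_ext)
    show "f \<in> X \<rightarrow>\<^sub>E carrier KG" "f' \<in> X \<rightarrow>\<^sub>E carrier KG" using that F_carrier by blast+
    show "f x = f' x" if "x \<in> X" for x
      using F_val \<open>f \<in> carrier F\<close> \<open>f' \<in> carrier F\<close> \<open>x \<in> X\<close> that(1)
        \<open>\<And>x k. x \<in> X \<Longrightarrow> k \<in> carrier G \<Longrightarrow> f x k = f' x k\<close>
      by (intro group_algebra_ext) auto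
  qed
  have add: "(f \<oplus>\<^bsub>F\<^esub> f') x k = f x k \<oplus>\<^bsub>K\<^esub> f' x k" if "x \<in> X" "k \<in> carrier G" for f f' x k
    using that by (simp add: F_def)
  have scal: "scal F c f x k = f x k \<otimes>\<^bsub>K\<^esub> c"
    if "c \<in> carrier K" "f \<in> carrier F" "x \<in> X" "k \<in> carrier G" for c f x k
    using mult_scalar[OF that(1) F_val[OF that(2,3)] that(4)] that(3) by (simp add: scal_def F_def)
  have act: "gact F h f x k = f x (k \<otimes>\<^bsub>G\<^esub> inv\<^bsub>G\<^esub> h)"
    if "h \<in> carrier G" "f \<in> carrier F" "x \<in> X" "k \<in> carrier G" for h f x k
    using mult_gelt[OF F_val[OF that(2,3)] that(1,4)] that(3) by (simp add: gact_def F_def)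
  have comp: "component X g f x k = (if k = g then f x k else \<zero>\<^bsub>K\<^esub>)" if "x \<in> X" "k \<in> carrier G" for g f x k
    using that by (simp add: component_def)
  have closed: "component X g f \<in> carrier F" if f: "f \<in> carrier F" for g f
  proof -
    have "component X g f \<in> X \<rightarrow>\<^sub>E carrier KG"
      using F_val[OF f] by (auto simp: component_def PiE_iff)
    moreover have "{x \<in> X. component X g f x \<noteq> \<zero>\<^bsub>KG\<^esub>} \<subseteq> {x \<in> X. f x \<noteq> \<zero>\<^bsub>KG\<^esub>}"
      by (auto simp: component_def fun_eq_iff)
    then have "finite {x \<in> X. component X g f x \<noteq> \<zero>\<^bsub>KG\<^esub>}"
      by (rule finite_subset) (use f F_carrier in blast)
    ultimately show ?thesis unfolding F_carrier by blast
  qed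
  have val: "f x k \<in> carrier K" if "f \<in> carrier F" "x \<in> X" "k \<in> carrier G" for f x k
    using F_val[OF that(1,2)] that(3) by auto
  show "klin F F (component X g)" if g: "g \<in> carrier G"
  proof (rule klinI)
    fix f assume f: "f \<in> carrier F"
    show "component X g f \<in> carrier F" by (rule closed[OF f])
    show "component X g (f \<oplus>\<^bsub>F\<^esub> f') = component X g f \<oplus>\<^bsub>F\<^esub> component X g f'" if f': "f' \<in> carrier F" for f'
      by (rule F_ext[OF closed[OF F.M.a_closed[OF f f']] F.M.a_closed[OF closed[OF f] closed[OF f']]])
        (simp add: comp add g)
    show "component X g (scal F c f) = scal F c (component X g f)" if c: "c \<in> carrier K" for c
      by (rule F_ext[OF closed[OF scal_closed[OF F c f]] scal_closed[OF F c closed[OF f]]])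
        (simp add: comp scal c f closed g)
  qed
  show "component X (g \<otimes>\<^bsub>G\<^esub> h) (gact F h f) = gact F h (component X g f)"
    if g: "g \<in> carrier G" and h: "h \<in> carrier G" and f: "f \<in> carrier F" for g
  proof (rule F_ext[OF closed[OF gact_closed[OF F f]] gact_closed[OF F closed[OF f]]])
    fix x k assume x: "x \<in> X" and k: "k \<in> carrier G"
    have kh: "k \<otimes>\<^bsub>G\<^esub> inv\<^bsub>G\<^esub> h \<in> carrier G" using k h by simp
    have "k \<otimes>\<^bsub>G\<^esub> inv\<^bsub>G\<^esub> h = g \<longleftrightarrow> k = g \<otimes>\<^bsub>G\<^esub> h" by (rule G.inv_solve_right'[OF g k h])
    then show "component X (g \<otimes>\<^bsub>G\<^esub> h) (gact F h f) x k = gact F h (component X g f) x k"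
      unfolding comp[OF x k] act[OF h f x k] act[OF h closed[OF f] x k] comp[OF x kh] by simp
  qed
  show "(\<Oplus>\<^bsub>F\<^esub>g\<in>carrier G. component X g f) = f" if f: "f \<in> carrier F"
  proof (rule F_ext[OF F.M.finsum_closed f])
    fix x k assume x: "x \<in> X" and k: "k \<in> carrier G"
    have "(\<Oplus>\<^bsub>F\<^esub>g\<in>I. component X g f) x k = (\<Oplus>\<^bsub>K\<^esub>g\<in>I. component X g f x k)"
      if "finite I" for I
      using that
    proof (induction I)
      case empty
      show ?case unfolding F.M.finsum_empty K.finsum_empty using x k by (simp add: F_def)
    next
      case (insert g I)
      have 1: "(\<lambda>g. component X g f) \<in> I \<rightarrow> carrier F" "(\<lambda>g. component X g f x k) \<in> I \<rightarrow> carrier K"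
        using closed[OF f] val[OF closed[OF f] x k] by blast+
      show ?case
        unfolding F.M.finsum_insert[OF insert.hyps(1,2) 1(1) closed[OF f]]
          K.finsum_insert[OF insert.hyps(1,2) 1(2) val[OF closed[OF f] x k]] add[OF x k] insert.IH ..
    qed
    then have "(\<Oplus>\<^bsub>F\<^esub>g\<in>carrier G. component X g f) x k =
        (\<Oplus>\<^bsub>K\<^esub>g\<in>carrier G. if k = g then f x k else \<zero>\<^bsub>K\<^esub>)"
      using finite_G by (simp only: comp[OF x k])
    also have "\<dots> = f x k" using val[OF f x k] k by (intro K.finsum_singleton) auto
    finally show "(\<Oplus>\<^bsub>F\<^esub>g\<in>carrier G. component X g f) x k = f x k" .
  qed (use closed[OF f] in blast)
qed

text \<open>Higman's criterion: the identity of a projective module is a trace.\<close>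

lemma projective_decomposition:
  fixes P :: "('g \<Rightarrow> 'k, 'p) module"
  assumes P: "projective_module KG P"
  obtains v where "\<And>g. g \<in> carrier G \<Longrightarrow> klin P P (v g)"
    "\<And>x. x \<in> carrier P \<Longrightarrow> (\<Oplus>\<^bsub>P\<^esub>g\<in>carrier G. v g x) = x"
    "\<And>g h x. g \<in> carrier G \<Longrightarrow> h \<in> carrier G \<Longrightarrow> x \<in> carrier P \<Longrightarrow> v (g \<otimes>\<^bsub>G\<^esub> h) (gact P h x) = gact P h (v g x)"
proof -
  have Pm: "right_module KG P" using P by (simp add: projective_module_def)
  obtain X :: "'p set" and i r where i: "i \<in> LinearCombinations.module_hom KG P (free_right_module KG X)"
    and r: "r \<in> LinearCombinations.module_hom KG (free_right_module KG X) P"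
    and ri: "\<And>x. x \<in> carrier P \<Longrightarrow> r (i x) = x"
    using P unfolding projective_module_def by blast
  define F where "F = free_right_module KG X"
  have F: "right_module KG F" unfolding F_def by (rule right_module_free[OF ring_group_algebra])
  note I = klin_of_hom[OF i[folded F_def]] and R = klin_of_hom[OF r[folded F_def]]
  note fc = free_component[where X = X, folded F_def]
  show ?thesis
  \<comment> \<open>Embed into a free module, cut out one component and retract. Since
    \<open>i\<close> and \<open>r\<close> are homomorphisms, the sum and the transformation rule are
    inherited from the components.\<close>
  proof (rule that[of "\<lambda>g x. r (component X g (i x))"])
    show "klin P P (\<lambda>x. r (component X g (i x)))" if "g \<in> carrier G" for g
      by (rule klin_comp[OF I(1) klin_comp[OF fc(1)[OF that] R(1)]])
    show "(\<Oplus>\<^bsub>P\<^esub>g\<in>carrier G. r (component X g (i x))) = x" if x: "x \<in> carrier P" for x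
    proof -
      have ix: "i x \<in> carrier F" by (rule klinD(1)[OF I(1) x])
      have "(\<Oplus>\<^bsub>P\<^esub>g\<in>carrier G. r (component X g (i x))) = r (\<Oplus>\<^bsub>F\<^esub>g\<in>carrier G. component X g (i x))"
        by (rule klin_finsum[OF F Pm R(1) finite_G, symmetric]) (rule klinD(1)[OF fc(1) ix])
      also have "\<dots> = x" using fc(2)[OF ix] ri[OF x] by simp
      finally show ?thesis .
    qed
    show "r (component X (g \<otimes>\<^bsub>G\<^esub> h) (i (gact P h x))) = gact P h (r (component X g (i x)))"
      if g: "g \<in> carrier G" and h: "h \<in> carrier G" and x: "x \<in> carrier P" for g h x
    proof -
      have ix: "i x \<in> carrier F" by (rule klinD(1)[OF I(1) x])
      show ?thesis
        unfolding I(2)[OF x] fc(3)[OF g h ix] R(2)[OF klinD(1)[OF fc(1)[OF g] ix]] ..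
    qed
  qed
qed

text \<open>Prepending \<open>g\<close> contracts the complex without being equivariant. Weighting
  it with the piece \<open>v g\<close> of the identity and summing over \<open>g\<close> restores
  equivariance; the decomposition thus replaces division by the group order.\<close>

lemma projective_mexact:
  fixes P :: "('g \<Rightarrow> 'k, 'p) module"
  assumes P: "projective_module KG P" and N: "right_module KG N"
  shows "mexact P N l"
  unfolding mexact_def
proof (intro allI impI)
  interpret N: right_module KG N by fact
  have Pm: "right_module KG P" using P by (simp add: projective_module_def)
  interpret P: right_module KG P by fact
  obtain v where v: "\<And>g. g \<in> carrier G \<Longrightarrow> klin P P (v g)"
    "\<And>x. x \<in> carrier P \<Longrightarrow> (\<Oplus>\<^bsub>P\<^esub>g\<in>carrier G. v g x) = x"
    "\<And>g h x. g \<in> carrier G \<Longrightarrow> h \<in> carrier G \<Longrightarrow> x \<in> carrier P \<Longrightarrow> v (g \<otimes>\<^bsub>G\<^esub> h) (gact P h x) = gact P h (v g x)"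
    using projective_decomposition[OF P] by blast
  fix c assume c: "mcochain P N (Suc l) c"
    and cz: "\<forall>x\<in>carrier P. \<forall>\<sigma>\<in>tup (Suc (Suc l)). delta N (c x) \<sigma> = \<zero>\<^bsub>N\<^esub>"
  note C = mcochainD[OF c]
  define b where "b = (\<lambda>x \<sigma>. \<Oplus>\<^bsub>N\<^esub>g\<in>carrier G. c (v g x) (g # \<sigma>))"
  have V: "v g x \<in> carrier P" if "g \<in> carrier G" "x \<in> carrier P" for g x
    using klinD(1)[OF v(1)] that .
  have tc: "c (v g x) (g # \<sigma>) \<in> carrier N" if "g \<in> carrier G" "x \<in> carrier P" "\<sigma> \<in> tup l" for g x \<sigma>
    using that by (intro C(1) V) auto
  have "mcochain P N l b"
  proof (rule mcochainI)
    fix x \<sigma> assume x: "x \<in> carrier P" and \<sigma>: "\<sigma> \<in> tup l"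
    have g\<sigma>: "g # \<sigma> \<in> tup (Suc l)" if "g \<in> carrier G" for g using \<sigma> that by simp
    show "b x \<sigma> \<in> carrier N"
      unfolding b_def using tc[OF _ x \<sigma>] by (intro N.M.finsum_closed) blast
    show "b (x \<oplus>\<^bsub>P\<^esub> y) \<sigma> = b x \<sigma> \<oplus>\<^bsub>N\<^esub> b y \<sigma>" if y: "y \<in> carrier P" for y
    proof -
      have "b (x \<oplus>\<^bsub>P\<^esub> y) \<sigma> = (\<Oplus>\<^bsub>N\<^esub>g\<in>carrier G. c (v g x) (g # \<sigma>) \<oplus>\<^bsub>N\<^esub> c (v g y) (g # \<sigma>))"
        unfolding b_def
        using tc[OF _ x \<sigma>] tc[OF _ y \<sigma>]
        by (intro N.M.add.finprod_cong') (auto simp: klinD(2)[OF v(1) x y] C(2)[OF V[OF _ x] V[OF _ y] g\<sigma>])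
      also have "\<dots> = b x \<sigma> \<oplus>\<^bsub>N\<^esub> b y \<sigma>"
        unfolding b_def using tc[OF _ x \<sigma>] tc[OF _ y \<sigma>] by (intro N.M.finsum_addf) blast+
      finally show ?thesis .
    qed
    show "b (scal P a x) \<sigma> = scal N a (b x \<sigma>)" if a: "a \<in> carrier K" for a
    proof -
      have kl: "klin N N (scal N a)"
        using a by (intro klinI) (simp_all add: scal_closed[OF N] scal_add[OF N] scal_scal[OF N] K.m_comm)
      have "b (scal P a x) \<sigma> = (\<Oplus>\<^bsub>N\<^esub>g\<in>carrier G. scal N a (c (v g x) (g # \<sigma>)))"
        unfolding b_def
        using tc[OF _ x \<sigma>] a scal_closed[OF N a]
        by (intro N.M.add.finprod_cong') (auto simp: klinD(3)[OF v(1) a x] C(3)[OF a V[OF _ x] g\<sigma>])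
      also have "\<dots> = scal N a (b x \<sigma>)"
        unfolding b_def using tc[OF _ x \<sigma>] by (intro klin_finsum[OF N N kl finite_G, symmetric])
      finally show ?thesis .
    qed
    show "b (gact P h x) (map (\<lambda>g. g \<otimes>\<^bsub>G\<^esub> h) \<sigma>) = gact N h (b x \<sigma>)" if h: "h \<in> carrier G" for h
    proof -
      let ?\<sigma>' = "map (\<lambda>g. g \<otimes>\<^bsub>G\<^esub> h) \<sigma>"
      have kg: "klin N N (gact N h)"
        using h by (intro klinI) (simp_all add: gact_closed[OF N] gact_add[OF N] gact_scal[OF N])
      have bij: "bij_betw (\<lambda>g. g \<otimes>\<^bsub>G\<^esub> h) (carrier G) (carrier G)"
        by (rule bij_betw_byWitness[where f' = "\<lambda>g. g \<otimes>\<^bsub>G\<^esub> inv\<^bsub>G\<^esub> h"]) (use h in \<open>auto simp: G.m_assoc\<close>)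
      have tc': "c (v g (gact P h x)) (g # ?\<sigma>') \<in> carrier N" if "g \<in> carrier G" for g
        by (rule tc[OF that gact_closed[OF Pm x] tup_translate[OF \<sigma> h]])
      have "b (gact P h x) ?\<sigma>' = (\<Oplus>\<^bsub>N\<^esub>g\<in>(\<lambda>g. g \<otimes>\<^bsub>G\<^esub> h) ` carrier G. c (v g (gact P h x)) (g # ?\<sigma>'))"
        using bij by (simp add: b_def bij_betw_def)
      also have "\<dots> = (\<Oplus>\<^bsub>N\<^esub>g\<in>carrier G. c (v (g \<otimes>\<^bsub>G\<^esub> h) (gact P h x)) ((g \<otimes>\<^bsub>G\<^esub> h) # ?\<sigma>'))"
        using bij tc' by (intro N.M.finsum_reindex) (auto simp: bij_betw_def)
      also have "\<dots> = (\<Oplus>\<^bsub>N\<^esub>g\<in>carrier G. gact N h (c (v g x) (g # \<sigma>)))"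
      proof (rule N.M.add.finprod_cong'[OF refl])
        show "(\<lambda>g. gact N h (c (v g x) (g # \<sigma>))) \<in> carrier G \<rightarrow> carrier N"
          using tc[OF _ x \<sigma>] gact_closed[OF N] by blast
        fix g assume g: "g \<in> carrier G"
        show "c (v (g \<otimes>\<^bsub>G\<^esub> h) (gact P h x)) ((g \<otimes>\<^bsub>G\<^esub> h) # ?\<sigma>') = gact N h (c (v g x) (g # \<sigma>))"
          unfolding v(3)[OF g h x] using C(4)[OF V[OF g x] g\<sigma>[OF g] h] by simp
      qed
      also have "\<dots> = gact N h (b x \<sigma>)"
        unfolding b_def using tc[OF _ x \<sigma>] by (intro klin_finsum[OF N N kg finite_G, symmetric])
      finally show ?thesis .
    qed
  qed
  moreover have "c x \<sigma> = delta N (b x) \<sigma>" if x: "x \<in> carrier P" and \<sigma>: "\<sigma> \<in> tup (Suc l)" for x \<sigma>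
  proof -
    have "delta N (b x) \<sigma> = (\<Oplus>\<^bsub>N\<^esub>g\<in>carrier G. delta N (\<lambda>\<tau>. c (v g x) (g # \<tau>)) \<sigma>)"
      unfolding b_def by (rule N.M.delta_finsum[OF finite_G \<sigma>]) (rule tc[OF _ x])
    also have "\<dots> = (\<Oplus>\<^bsub>N\<^esub>g\<in>carrier G. c (v g x) \<sigma>)"
    proof (rule N.M.add.finprod_cong'[OF refl])
      show "(\<lambda>g. c (v g x) \<sigma>) \<in> carrier G \<rightarrow> carrier N" using C(1)[OF V[OF _ x] \<sigma>] by blast
      fix g assume g: "g \<in> carrier G"
      have "g # \<sigma> \<in> tup (Suc (Suc l))" using g \<sigma> by simp
      then have "delta N (c (v g x)) (g # \<sigma>) = \<zero>\<^bsub>N\<^esub>" using cz V[OF g x] by blast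
      then have "c (v g x) \<sigma> \<ominus>\<^bsub>N\<^esub> delta N (\<lambda>\<tau>. c (v g x) (g # \<tau>)) \<sigma> = \<zero>\<^bsub>N\<^esub>" by simp
      moreover have "delta N (\<lambda>\<tau>. c (v g x) (g # \<tau>)) \<sigma> \<in> carrier N"
        by (rule N.M.delta_closed[OF \<sigma>]) (rule tc[OF g x])
      ultimately show "delta N (\<lambda>\<tau>. c (v g x) (g # \<tau>)) \<sigma> = c (v g x) \<sigma>"
        using C(1)[OF V[OF g x] \<sigma>] N.M.minus_other_side by metis
    qed
    also have "\<dots> = c (\<Oplus>\<^bsub>P\<^esub>g\<in>carrier G. v g x) \<sigma>"
      by (rule klin_finsum[OF Pm N C(5)[OF \<sigma>] finite_G, symmetric]) (rule V[OF _ x])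
    also have "\<dots> = c x \<sigma>" unfolding v(2)[OF x] ..
    finally show ?thesis ..
  qed
  ultimately show "\<exists>b. mcochain P N l b \<and>
      (\<forall>x\<in>carrier P. \<forall>\<sigma>\<in>tup (Suc l). c x \<sigma> = delta N (b x) \<sigma>)"
    by blast
qed

end

section \<open>Dimension shifting\<close>

lemma submodule_right_module:
  assumes "right_module R M" and W: "W \<subseteq> carrier M" "\<zero>\<^bsub>M\<^esub> \<in> W"
    "\<And>x y. x \<in> W \<Longrightarrow> y \<in> W \<Longrightarrow> x \<oplus>\<^bsub>M\<^esub> y \<in> W" "\<And>a x. a \<in> carrier R \<Longrightarrow> x \<in> W \<Longrightarrow> a \<odot>\<^bsub>M\<^esub> x \<in> W"
  shows "right_module R (M\<lparr>carrier := W\<rparr>)"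
proof -
  interpret right_module R M by fact
  have cl: "x \<in> carrier M" if "x \<in> W" for x using W(1) that by blast
  have "abelian_group (M\<lparr>carrier := W\<rparr>)"
  proof (rule abelian_groupI)
    fix x assume x: "x \<in> carrier (M\<lparr>carrier := W\<rparr>)"
    have "(\<ominus>\<^bsub>R\<^esub> \<one>\<^bsub>R\<^esub>) \<odot>\<^bsub>M\<^esub> x \<oplus>\<^bsub>M\<^esub> x = (\<ominus>\<^bsub>R\<^esub> \<one>\<^bsub>R\<^esub> \<oplus>\<^bsub>R\<^esub> \<one>\<^bsub>R\<^esub>) \<odot>\<^bsub>M\<^esub> x"
      using cl x by (simp add: smult_l_distr)
    also have "\<dots> = \<zero>\<^bsub>M\<^esub>" using cl x by (simp add: R.l_neg)
    finally show "\<exists>y\<in>carrier (M\<lparr>carrier := W\<rparr>). y \<oplus>\<^bsub>M\<lparr>carrier := W\<rparr>\<^esub> x = \<zero>\<^bsub>M\<lparr>carrier := W\<rparr>\<^esub>"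
      using x W(4) by auto
  qed (use W cl in \<open>auto simp: M.a_ac\<close>)
  then show ?thesis
    using W(4) cl
    by (intro right_module.intro right_module_axioms.intro R.ring_axioms)
      (auto simp: smult_l_distr smult_r_distr smult_assoc)
qed

text \<open>Kernels are represented by shrinking the carrier of the record, so that addition,
  \<open>gact\<close> and \<open>scal\<close> are literally those of the ambient module.\<close>

lemma right_module_kernel:
  assumes M: "right_module R M" and N: "right_module R N" and f: "f \<in> LinearCombinations.module_hom R M N"
  shows "right_module R (M\<lparr>carrier := {x \<in> carrier M. f x = \<zero>\<^bsub>N\<^esub>}\<rparr>)"
proof -
  interpret M: right_module R M by fact
  interpret N: right_module R N by fact
  note f' = funcset_mem[OF LinearCombinations.module_hom_closed[OF f]]
    LinearCombinations.module_hom_add[OF f] LinearCombinations.module_hom_smult[OF f]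
  have "f \<zero>\<^bsub>M\<^esub> = \<zero>\<^bsub>R\<^esub> \<odot>\<^bsub>N\<^esub> f \<zero>\<^bsub>M\<^esub>"
    using f'(3)[of "\<zero>\<^bsub>R\<^esub>" "\<zero>\<^bsub>M\<^esub>"] by simp
  also have "\<dots> = \<zero>\<^bsub>N\<^esub>" using f'(1) by (intro N.smult_l_null) auto
  finally show ?thesis
    by (intro submodule_right_module M) (auto simp: f')
qed

context finite_group_field_algebra
begin

lemma gact_carrier_update [simp]: "gact (M\<lparr>carrier := W\<rparr>) = gact M"
  by (simp add: gact_def fun_eq_iff)

lemma scal_carrier_update [simp]: "scal (M\<lparr>carrier := W\<rparr>) = scal M"
  by (simp add: scal_def fun_eq_iff)

section \<open>Linear complements and retractions\<close>

definition linear_subspace :: "('g \<Rightarrow> 'k, 'm, 'e) module_scheme \<Rightarrow> 'm set \<Rightarrow> bool" where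
  "linear_subspace M U \<longleftrightarrow> U \<subseteq> carrier M \<and> \<zero>\<^bsub>M\<^esub> \<in> U \<and> (\<forall>x\<in>U. \<forall>y\<in>U. x \<oplus>\<^bsub>M\<^esub> y \<in> U) \<and>
     (\<forall>c\<in>carrier K. \<forall>x\<in>U. scal M c x \<in> U)"

context
  fixes M :: "('g \<Rightarrow> 'k, 'm, 'e) module_scheme"
  assumes M: "right_module KG M"
begin

interpretation M: right_module KG M by (rule M)

lemma linear_subspace_minus:
  assumes U: "linear_subspace M U" and x: "x \<in> U" and y: "y \<in> U"
  shows "x \<ominus>\<^bsub>M\<^esub> y \<in> U"
proof -
  have yM: "y \<in> carrier M" using U y by (auto simp: linear_subspace_def)
  have "scal M (\<ominus>\<^bsub>K\<^esub> \<one>\<^bsub>K\<^esub>) y \<oplus>\<^bsub>M\<^esub> y = scal M (\<ominus>\<^bsub>K\<^esub> \<one>\<^bsub>K\<^esub> \<oplus>\<^bsub>K\<^esub> \<one>\<^bsub>K\<^esub>) y"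
    using scal_add_left[OF M, of "\<ominus>\<^bsub>K\<^esub> \<one>\<^bsub>K\<^esub>" "\<one>\<^bsub>K\<^esub>" y] yM by (simp add: scal_one[OF M])
  then have "scal M (\<ominus>\<^bsub>K\<^esub> \<one>\<^bsub>K\<^esub>) y \<oplus>\<^bsub>M\<^esub> y = \<zero>\<^bsub>M\<^esub>"
    using scal_zero_left[OF M yM] by (simp add: K.l_neg)
  then have "\<ominus>\<^bsub>M\<^esub> y = scal M (\<ominus>\<^bsub>K\<^esub> \<one>\<^bsub>K\<^esub>) y"
    using yM by (intro M.M.minus_equality scal_closed[OF M]) auto
  then have "\<ominus>\<^bsub>M\<^esub> y \<in> U" using U y by (auto simp: linear_subspace_def)
  then show ?thesis using U x by (auto simp: linear_subspace_def a_minus_def)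
qed

text \<open>Zorn's lemma, as terms of a resolution may have infinite dimension. If a maximal
  subspace \<open>U\<close> meeting \<open>W\<close> only in zero failed to be a complement, the
  line of a vector outside \<open>U + W\<close> could be added to it.\<close>

lemma linear_complement:
  assumes W: "linear_subspace M W"
  obtains U where "linear_subspace M U" "U \<inter> W = {\<zero>\<^bsub>M\<^esub>}"
    "\<And>x. x \<in> carrier M \<Longrightarrow> \<exists>u\<in>U. \<exists>w\<in>W. x = u \<oplus>\<^bsub>M\<^esub> w"
proof -
  define \<A> where "\<A> = {U. linear_subspace M U \<and> U \<inter> W = {\<zero>\<^bsub>M\<^esub>}}"
  have "{\<zero>\<^bsub>M\<^esub>} \<in> \<A>"
    using W scal_zero[OF M] by (auto simp: \<A>_def linear_subspace_def)
  then have "\<A> \<noteq> {}" by blast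
  moreover have "\<Union>C \<in> \<A>" if C: "C \<noteq> {}" "subset.chain \<A> C" for C
  proof -
    have CA: "\<And>U. U \<in> C \<Longrightarrow> linear_subspace M U \<and> U \<inter> W = {\<zero>\<^bsub>M\<^esub>}"
      and ch: "\<And>U V. U \<in> C \<Longrightarrow> V \<in> C \<Longrightarrow> U \<subseteq> V \<or> V \<subseteq> U"
      using C(2) by (auto simp: subset_chain_def \<A>_def)
    have "x \<oplus>\<^bsub>M\<^esub> y \<in> \<Union>C" if "x \<in> \<Union>C" "y \<in> \<Union>C" for x y
    proof -
      obtain U V where UV: "U \<in> C" "x \<in> U" "V \<in> C" "y \<in> V" using \<open>x \<in> \<Union>C\<close> \<open>y \<in> \<Union>C\<close> by blast
      then obtain T where "T \<in> C" "x \<in> T" "y \<in> T" using ch by blast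
      then show ?thesis using CA unfolding linear_subspace_def by blast
    qed
    moreover have "\<Union>C \<subseteq> carrier M" "\<zero>\<^bsub>M\<^esub> \<in> \<Union>C" "\<And>c x. c \<in> carrier K \<Longrightarrow> x \<in> \<Union>C \<Longrightarrow> scal M c x \<in> \<Union>C"
      using CA C(1) unfolding linear_subspace_def by blast+
    moreover have "\<Union>C \<inter> W = {\<zero>\<^bsub>M\<^esub>}" using CA C(1) by blast
    ultimately show ?thesis unfolding \<A>_def linear_subspace_def by blast
  qed
  ultimately obtain U where UA: "U \<in> \<A>" and max: "\<And>V. V \<in> \<A> \<Longrightarrow> U \<subseteq> V \<Longrightarrow> V = U"
    using subset_Zorn_nonempty[of \<A>] by blast
  have U: "linear_subspace M U" "U \<inter> W = {\<zero>\<^bsub>M\<^esub>}" using UA by (auto simp: \<A>_def)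
  have UM: "u \<in> carrier M" if "u \<in> U" for u using U(1) that by (auto simp: linear_subspace_def)
  have WM: "w \<in> carrier M" if "w \<in> W" for w using W that by (auto simp: linear_subspace_def)
  have "\<exists>u\<in>U. \<exists>w\<in>W. x = u \<oplus>\<^bsub>M\<^esub> w" if x: "x \<in> carrier M" for x
  proof (rule ccontr)
    assume nx: "\<not> (\<exists>u\<in>U. \<exists>w\<in>W. x = u \<oplus>\<^bsub>M\<^esub> w)"
    define V where "V = {u \<oplus>\<^bsub>M\<^esub> scal M c x |u c. u \<in> U \<and> c \<in> carrier K}"
    have Vsub: "linear_subspace M V"
      unfolding linear_subspace_def
    proof (intro conjI ballI)
      show "V \<subseteq> carrier M" using x UM scal_closed[OF M] by (auto simp: V_def)
      have "\<zero>\<^bsub>M\<^esub> = \<zero>\<^bsub>M\<^esub> \<oplus>\<^bsub>M\<^esub> scal M \<zero>\<^bsub>K\<^esub> x" using scal_zero_left[OF M x] by simp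
      then show "\<zero>\<^bsub>M\<^esub> \<in> V" using U(1) by (auto simp: V_def linear_subspace_def)
      fix y assume "y \<in> V"
      then obtain u c where y: "y = u \<oplus>\<^bsub>M\<^esub> scal M c x" "u \<in> U" "c \<in> carrier K" by (auto simp: V_def)
      show "y \<oplus>\<^bsub>M\<^esub> z \<in> V" if "z \<in> V" for z
      proof -
        obtain u' c' where z: "z = u' \<oplus>\<^bsub>M\<^esub> scal M c' x" "u' \<in> U" "c' \<in> carrier K"
          using \<open>z \<in> V\<close> by (auto simp: V_def)
        have "y \<oplus>\<^bsub>M\<^esub> z = (u \<oplus>\<^bsub>M\<^esub> u') \<oplus>\<^bsub>M\<^esub> scal M (c \<oplus>\<^bsub>K\<^esub> c') x"
          using y z x UM scal_closed[OF M] by (simp add: scal_add_left[OF M] M.M.a_ac)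
        moreover have "u \<oplus>\<^bsub>M\<^esub> u' \<in> U" using U(1) y z by (auto simp: linear_subspace_def)
        ultimately show ?thesis using y z by (auto simp: V_def)
      qed
      show "scal M a y \<in> V" if a: "a \<in> carrier K" for a
      proof -
        have "scal M a y = scal M a u \<oplus>\<^bsub>M\<^esub> scal M (a \<otimes>\<^bsub>K\<^esub> c) x"
          using y x a UM scal_closed[OF M] by (simp add: scal_add[OF M] scal_scal[OF M])
        moreover have "scal M a u \<in> U" using U(1) y a by (auto simp: linear_subspace_def)
        ultimately show ?thesis using y a by (auto simp: V_def)
      qed
    qed
    have "V \<inter> W \<subseteq> {\<zero>\<^bsub>M\<^esub>}"
    proof
      fix w assume w: "w \<in> V \<inter> W"
      then obtain u c where y: "w = u \<oplus>\<^bsub>M\<^esub> scal M c x" "u \<in> U" "c \<in> carrier K" by (auto simp: V_def)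
      show "w \<in> {\<zero>\<^bsub>M\<^esub>}"
      proof (cases "c = \<zero>\<^bsub>K\<^esub>")
        case True
        then have "w = u" using y UM scal_zero_left[OF M x] by simp
        then show ?thesis using w y U(2) by blast
      next
        case False
        then have c: "inv\<^bsub>K\<^esub> c \<in> carrier K" "inv\<^bsub>K\<^esub> c \<otimes>\<^bsub>K\<^esub> c = \<one>\<^bsub>K\<^esub>"
          using y(3) by (auto simp: K.field_Units)
        \<comment> \<open>With \<open>c\<close> invertible, solving \<open>w = u + c x\<close> for
          \<open>x\<close> would place \<open>x\<close> in \<open>U + W\<close>.\<close>
        have "scal M c x = w \<ominus>\<^bsub>M\<^esub> u"
          using y x UM[OF y(2)] scal_closed[OF M y(3) x]
          by (simp add: a_minus_def M.M.a_ac M.M.r_neg1 M.M.r_neg2)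
        also have "\<dots> = scal M (\<ominus>\<^bsub>K\<^esub> \<one>\<^bsub>K\<^esub>) u \<oplus>\<^bsub>M\<^esub> w"
        proof -
          have "scal M (\<ominus>\<^bsub>K\<^esub> \<one>\<^bsub>K\<^esub>) u \<oplus>\<^bsub>M\<^esub> u = \<zero>\<^bsub>M\<^esub>"
            using scal_add_left[OF M, of "\<ominus>\<^bsub>K\<^esub> \<one>\<^bsub>K\<^esub>" "\<one>\<^bsub>K\<^esub>" u] UM[OF y(2)] scal_zero_left[OF M UM[OF y(2)]]
            by (simp add: scal_one[OF M] K.l_neg)
          then have "\<ominus>\<^bsub>M\<^esub> u = scal M (\<ominus>\<^bsub>K\<^esub> \<one>\<^bsub>K\<^esub>) u"
            using UM[OF y(2)] by (intro M.M.minus_equality scal_closed[OF M]) auto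
          then show ?thesis using UM[OF y(2)] w WM scal_closed[OF M] by (simp add: a_minus_def M.M.a_comm)
        qed
        finally have "scal M (inv\<^bsub>K\<^esub> c) (scal M c x) =
            scal M (inv\<^bsub>K\<^esub> c) (scal M (\<ominus>\<^bsub>K\<^esub> \<one>\<^bsub>K\<^esub>) u) \<oplus>\<^bsub>M\<^esub> scal M (inv\<^bsub>K\<^esub> c) w"
          using c(1) UM[OF y(2)] w WM by (simp add: scal_add[OF M] scal_closed[OF M])
        moreover have "scal M (inv\<^bsub>K\<^esub> c) (scal M c x) = x"
          using c x y(3) by (simp add: scal_scal[OF M] scal_one[OF M])
        moreover have "scal M (inv\<^bsub>K\<^esub> c) (scal M (\<ominus>\<^bsub>K\<^esub> \<one>\<^bsub>K\<^esub>) u) \<in> U" "scal M (inv\<^bsub>K\<^esub> c) w \<in> W"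
          using U(1) W c(1) y(2) w by (auto simp: linear_subspace_def)
        ultimately show ?thesis using nx by metis
      qed
    qed
    moreover have "\<zero>\<^bsub>M\<^esub> \<in> V \<inter> W" using Vsub W by (auto simp: linear_subspace_def)
    ultimately have "V \<in> \<A>" using Vsub by (auto simp: \<A>_def)
    moreover have "U \<subseteq> V"
    proof
      fix u assume u: "u \<in> U"
      then have "u = u \<oplus>\<^bsub>M\<^esub> scal M \<zero>\<^bsub>K\<^esub> x" using scal_zero_left[OF M x] UM by simp
      then show "u \<in> V" using u by (auto simp: V_def)
    qed
    ultimately have "V = U" by (rule max)
    moreover have "x \<in> V"
    proof -
      have "x = \<zero>\<^bsub>M\<^esub> \<oplus>\<^bsub>M\<^esub> scal M \<one>\<^bsub>K\<^esub> x" using x scal_one[OF M x] by simp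
      then show ?thesis using U(1) by (auto simp: V_def linear_subspace_def)
    qed
    ultimately have "x \<in> U" by simp
    moreover have "x = x \<oplus>\<^bsub>M\<^esub> \<zero>\<^bsub>M\<^esub>" "\<zero>\<^bsub>M\<^esub> \<in> W" using x W by (auto simp: linear_subspace_def)
    ultimately show False using nx by blast
  qed
  then show ?thesis using that U by blast
qed

end

end

lemma (in abelian_group) diff_add_right:
  assumes "x \<in> carrier G" "y \<in> carrier G" "z \<in> carrier G"
  shows "(x \<oplus> z) \<ominus> (y \<oplus> z) = x \<ominus> y"
proof -
  have "(x \<oplus> z) \<ominus> (y \<oplus> z) = x \<oplus> (z \<oplus> \<ominus> z) \<oplus> \<ominus> y"
    using assms by (simp only: a_minus_def minus_add a_ac a_closed a_inv_closed)
  then show ?thesis using assms by (simp add: r_neg a_minus_def)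
qed

lemma (in abelian_group) add_eq_add_imp:
  assumes "a \<in> carrier G" "b \<in> carrier G" "c \<in> carrier G" "d \<in> carrier G" "a \<oplus> b = c \<oplus> d"
  shows "a \<ominus> c = d \<ominus> b"
proof -
  have "a \<ominus> c = (c \<oplus> d) \<ominus> (c \<oplus> b)" using assms diff_add_right[of a c b] by simp
  also have "\<dots> = d \<ominus> b" using assms diff_add_right[of d b c] by (simp add: a_comm)
  finally show ?thesis .
qed

context finite_group_field_algebra
begin

context
  fixes M :: "('g \<Rightarrow> 'k, 'm, 'e) module_scheme"
  assumes M: "right_module KG M"
begin

interpretation M: right_module KG M by (rule M)

text \<open>Projection along a complement; the two components are unique since the subspaces meet
  only in zero. The map need not commute with the group.\<close>

lemma linear_retraction:
  assumes W: "linear_subspace M W"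
  obtains \<pi> where "klin M M \<pi>" "\<And>x. x \<in> carrier M \<Longrightarrow> \<pi> x \<in> W" "\<And>w. w \<in> W \<Longrightarrow> \<pi> w = w"
proof -
  obtain U where U: "linear_subspace M U" "U \<inter> W = {\<zero>\<^bsub>M\<^esub>}"
    and dec: "\<And>x. x \<in> carrier M \<Longrightarrow> \<exists>u\<in>U. \<exists>w\<in>W. x = u \<oplus>\<^bsub>M\<^esub> w"
    using linear_complement[OF M W] by blast
  have UM: "u \<in> carrier M" if "u \<in> U" for u using U(1) that by (auto simp: linear_subspace_def)
  have WM: "w \<in> carrier M" if "w \<in> W" for w using W that by (auto simp: linear_subspace_def)
  have "\<exists>u w. u \<in> U \<and> w \<in> W \<and> x = u \<oplus>\<^bsub>M\<^esub> w" if "x \<in> carrier M" for x using dec[OF that] by blast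
  then obtain \<mu> \<pi> where \<mu>: "\<And>x. x \<in> carrier M \<Longrightarrow> \<mu> x \<in> U"
    and \<pi>: "\<And>x. x \<in> carrier M \<Longrightarrow> \<pi> x \<in> W" and eq: "\<And>x. x \<in> carrier M \<Longrightarrow> x = \<mu> x \<oplus>\<^bsub>M\<^esub> \<pi> x"
    by metis
  have uniq: "\<pi> x = w" if "u \<in> U" "w \<in> W" "x = u \<oplus>\<^bsub>M\<^esub> w" for x u w
  proof -
    have x: "x \<in> carrier M" using that UM WM by simp
    note cl = UM[OF \<mu>[OF x]] WM[OF \<pi>[OF x]] UM[OF that(1)] WM[OF that(2)]
    have "u \<oplus>\<^bsub>M\<^esub> w = \<mu> x \<oplus>\<^bsub>M\<^esub> \<pi> x" using eq[OF x] that(3) by simp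
    then have e: "u \<ominus>\<^bsub>M\<^esub> \<mu> x = \<pi> x \<ominus>\<^bsub>M\<^esub> w"
      by (rule M.M.add_eq_add_imp[OF cl(3,4,1,2)])
    have "u \<ominus>\<^bsub>M\<^esub> \<mu> x \<in> U" by (rule linear_subspace_minus[OF M U(1) that(1) \<mu>[OF x]])
    moreover have "\<pi> x \<ominus>\<^bsub>M\<^esub> w \<in> W" by (rule linear_subspace_minus[OF M W \<pi>[OF x] that(2)])
    ultimately have "\<pi> x \<ominus>\<^bsub>M\<^esub> w = \<zero>\<^bsub>M\<^esub>" using U(2) e by auto
    then show ?thesis using cl by simp
  qed
  show ?thesis
  proof (rule that[of \<pi>])
    show "klin M M \<pi>"
    proof (rule klinI)
      fix x assume x: "x \<in> carrier M"
      show "\<pi> x \<in> carrier M" by (rule WM[OF \<pi>[OF x]])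
      show "\<pi> (x \<oplus>\<^bsub>M\<^esub> y) = \<pi> x \<oplus>\<^bsub>M\<^esub> \<pi> y" if y: "y \<in> carrier M" for y
      proof (rule uniq)
        show "\<mu> x \<oplus>\<^bsub>M\<^esub> \<mu> y \<in> U" "\<pi> x \<oplus>\<^bsub>M\<^esub> \<pi> y \<in> W"
          using U(1) W \<mu> \<pi> x y by (auto simp: linear_subspace_def)
        have "x \<oplus>\<^bsub>M\<^esub> y = (\<mu> x \<oplus>\<^bsub>M\<^esub> \<pi> x) \<oplus>\<^bsub>M\<^esub> (\<mu> y \<oplus>\<^bsub>M\<^esub> \<pi> y)"
          using eq[OF x] eq[OF y] by simp
        also have "\<dots> = (\<mu> x \<oplus>\<^bsub>M\<^esub> \<mu> y) \<oplus>\<^bsub>M\<^esub> (\<pi> x \<oplus>\<^bsub>M\<^esub> \<pi> y)"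
          using UM[OF \<mu>[OF x]] UM[OF \<mu>[OF y]] WM[OF \<pi>[OF x]] WM[OF \<pi>[OF y]] by (simp add: M.M.a_ac)
        finally show "x \<oplus>\<^bsub>M\<^esub> y = (\<mu> x \<oplus>\<^bsub>M\<^esub> \<mu> y) \<oplus>\<^bsub>M\<^esub> (\<pi> x \<oplus>\<^bsub>M\<^esub> \<pi> y)" .
      qed
      show "\<pi> (scal M c x) = scal M c (\<pi> x)" if c: "c \<in> carrier K" for c
      proof (rule uniq)
        show "scal M c (\<mu> x) \<in> U" "scal M c (\<pi> x) \<in> W"
          using U(1) W \<mu> \<pi> x c by (auto simp: linear_subspace_def)
        show "scal M c x = scal M c (\<mu> x) \<oplus>\<^bsub>M\<^esub> scal M c (\<pi> x)"
          using scal_add[OF M c UM[OF \<mu>[OF x]] WM[OF \<pi>[OF x]]] eq[OF x] by simp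
      qed
    qed
    show "\<pi> w = w" if "w \<in> W" for w
      using U(1) that WM by (intro uniq[of "\<zero>\<^bsub>M\<^esub>"]) (auto simp: linear_subspace_def)
  qed (rule \<pi>)
qed

end

text \<open>A cochain of positive length is determined by arbitrary linear maps at the tuples with
  first entry the identity. There the extension is composition with \<open>\<pi>\<close>; other
  tuples are first translated to that form and the value is translated back, so no equivariance of
  \<open>\<pi>\<close> is required.\<close>

lemma mcochain_extend:
  fixes P :: "('g \<Rightarrow> 'k, 'p) module"
  assumes P: "right_module KG P" and N: "right_module KG N" and \<Omega>: "right_module KG (P\<lparr>carrier := W\<rparr>)"
    and W: "W \<subseteq> carrier P" and a': "mcochain (P\<lparr>carrier := W\<rparr>) N (Suc k) a'"
  obtains a where "mcochain P N (Suc k) a" "\<And>x \<sigma>. x \<in> W \<Longrightarrow> \<sigma> \<in> tup (Suc k) \<Longrightarrow> a x \<sigma> = a' x \<sigma>"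
proof -
  interpret P: right_module KG P by fact
  interpret \<Omega>: right_module KG "P\<lparr>carrier := W\<rparr>" by fact
  have Wact: "gact P g w \<in> W" if "w \<in> W" for g w
    using gact_closed[OF \<Omega>, of w g] that unfolding gact_carrier_update by simp
  have "linear_subspace P W"
    unfolding linear_subspace_def
  proof (intro conjI ballI W)
    show "\<zero>\<^bsub>P\<^esub> \<in> W" using \<Omega>.M.zero_closed by simp
    show "x \<oplus>\<^bsub>P\<^esub> y \<in> W" if "x \<in> W" "y \<in> W" for x y using \<Omega>.M.a_closed[of x y] that by simp
    show "scal P c x \<in> W" if "c \<in> carrier K" "x \<in> W" for c x
      using scal_closed[OF \<Omega> that(1), of x] that(2) unfolding scal_carrier_update by simp
  qed
  then obtain \<pi> where \<pi>: "klin P P \<pi>" "\<And>x. x \<in> carrier P \<Longrightarrow> \<pi> x \<in> W" "\<And>w. w \<in> W \<Longrightarrow> \<pi> w = w"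
    using linear_retraction[OF P] by blast
  note A = mcochainD[OF a', simplified]
  let ?i = "\<lambda>\<sigma>. inv\<^bsub>G\<^esub> (hd \<sigma>)"
  define a where "a = (\<lambda>x \<sigma>. gact N (hd \<sigma>) (a' (\<pi> (gact P (?i \<sigma>) x)) (map (\<lambda>g. g \<otimes>\<^bsub>G\<^esub> ?i \<sigma>) \<sigma>)))"
  have hd: "hd \<sigma> \<in> carrier G" if "\<sigma> \<in> tup (Suc k)" for \<sigma>
    using that by (auto elim: tuples_SucE)
  have t: "map (\<lambda>g. g \<otimes>\<^bsub>G\<^esub> ?i \<sigma>) \<sigma> \<in> tup (Suc k)" if "\<sigma> \<in> tup (Suc k)" for \<sigma>
    by (rule tup_translate[OF that G.inv_closed[OF hd[OF that]]])
  have pc: "\<pi> (gact P g x) \<in> W" if "x \<in> carrier P" for g x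
    by (rule \<pi>(2)[OF gact_closed[OF P that]])
  show ?thesis
  proof (rule that[of a])
    show "mcochain P N (Suc k) a"
    proof (rule mcochainI)
      fix x \<sigma> assume x: "x \<in> carrier P" and \<sigma>: "\<sigma> \<in> tup (Suc k)"
      have iG: "?i \<sigma> \<in> carrier G" using hd[OF \<sigma>] by simp
      show "a x \<sigma> \<in> carrier N"
        unfolding a_def by (rule gact_closed[OF N A(1)[OF pc[OF x] t[OF \<sigma>]]])
      show "a (x \<oplus>\<^bsub>P\<^esub> y) \<sigma> = a x \<sigma> \<oplus>\<^bsub>N\<^esub> a y \<sigma>" if y: "y \<in> carrier P" for y
        unfolding a_def gact_add[OF P x y] klinD(2)[OF \<pi>(1) gact_closed[OF P x] gact_closed[OF P y]]
          A(2)[OF pc[OF x] pc[OF y] t[OF \<sigma>]]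
        by (rule gact_add[OF N A(1)[OF pc[OF x] t[OF \<sigma>]] A(1)[OF pc[OF y] t[OF \<sigma>]]])
      show "a (scal P c x) \<sigma> = scal N c (a x \<sigma>)" if c: "c \<in> carrier K" for c
        unfolding a_def gact_scal[OF P c iG x] klinD(3)[OF \<pi>(1) c gact_closed[OF P x]]
          A(3)[OF c pc[OF x] t[OF \<sigma>]]
        by (rule gact_scal[OF N c hd[OF \<sigma>] A(1)[OF pc[OF x] t[OF \<sigma>]]])
      show "a (gact P h x) (map (\<lambda>g. g \<otimes>\<^bsub>G\<^esub> h) \<sigma>) = gact N h (a x \<sigma>)" if h: "h \<in> carrier G" for h
      proof -
        let ?\<sigma>' = "map (\<lambda>g. g \<otimes>\<^bsub>G\<^esub> h) \<sigma>"
        have hd': "hd ?\<sigma>' = hd \<sigma> \<otimes>\<^bsub>G\<^esub> h" using \<sigma> by (auto elim: tuples_SucE)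
        have i': "?i ?\<sigma>' = inv\<^bsub>G\<^esub> h \<otimes>\<^bsub>G\<^esub> ?i \<sigma>" unfolding hd' using hd[OF \<sigma>] h by (rule G.inv_mult_group)
        have cancel: "h \<otimes>\<^bsub>G\<^esub> (inv\<^bsub>G\<^esub> h \<otimes>\<^bsub>G\<^esub> ?i \<sigma>) = ?i \<sigma>"
          using G.m_assoc[of h "inv\<^bsub>G\<^esub> h" "?i \<sigma>", symmetric] h iG by simp
        \<comment> \<open>After acting by \<open>h\<close>, the normalised vector and tuple are the
          same as before; only the final translation back involves \<open>h\<close>.\<close>
        have act_eq: "gact P (?i ?\<sigma>') (gact P h x) = gact P (?i \<sigma>) x"
          unfolding i' gact_gact[OF P h G.m_closed[OF G.inv_closed[OF h] iG] x] cancel ..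
        have map_eq: "map (\<lambda>g. g \<otimes>\<^bsub>G\<^esub> ?i ?\<sigma>') ?\<sigma>' = map (\<lambda>g. g \<otimes>\<^bsub>G\<^esub> ?i \<sigma>) \<sigma>"
          unfolding i' map_map
        proof (rule map_cong[OF refl])
          fix g assume "g \<in> set \<sigma>"
          then have "g \<in> carrier G" using \<sigma> by (auto simp: tuples_def)
          then have "g \<otimes>\<^bsub>G\<^esub> h \<otimes>\<^bsub>G\<^esub> (inv\<^bsub>G\<^esub> h \<otimes>\<^bsub>G\<^esub> ?i \<sigma>) = g \<otimes>\<^bsub>G\<^esub> ?i \<sigma>"
            using h iG by (simp add: G.m_assoc cancel)
          then show "((\<lambda>g. g \<otimes>\<^bsub>G\<^esub> (inv\<^bsub>G\<^esub> h \<otimes>\<^bsub>G\<^esub> ?i \<sigma>)) \<circ> (\<lambda>g. g \<otimes>\<^bsub>G\<^esub> h)) g = g \<otimes>\<^bsub>G\<^esub> ?i \<sigma>"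
            by simp
        qed
        show ?thesis
          unfolding a_def act_eq map_eq unfolding hd'
          by (rule gact_gact[OF N hd[OF \<sigma>] h A(1)[OF pc[OF x] t[OF \<sigma>]], symmetric])
      qed
    qed
    show "a x \<sigma> = a' x \<sigma>" if x: "x \<in> W" and \<sigma>: "\<sigma> \<in> tup (Suc k)" for x \<sigma>
    proof -
      have iG: "?i \<sigma> \<in> carrier G" using hd[OF \<sigma>] by simp
      show ?thesis
        unfolding a_def \<pi>(3)[OF Wact[OF x]] A(4)[OF x \<sigma> iG]
        by (rule gact_inv(1)[OF N hd[OF \<sigma>] A(1)[OF x \<sigma>]])
    qed
  qed
qed

text \<open>A cocycle on lists of length one does not depend on the entry, so it is a single
  equivariant map and comes from the augmentation. Dimension shifting starts here.\<close>

lemma mexact_0: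
  assumes M: "right_module KG M" and N: "right_module KG N"
  shows "mexact M N 0"
  unfolding mexact_def
proof (intro allI impI)
  interpret N: right_module KG N by fact
  fix c assume c: "mcochain M N (Suc 0) c"
    and cz: "\<forall>x\<in>carrier M. \<forall>\<sigma>\<in>tup (Suc (Suc 0)). delta N (c x) \<sigma> = \<zero>\<^bsub>N\<^esub>"
  note C = mcochainD[OF c]
  have one: "c x [g] = c x [\<one>\<^bsub>G\<^esub>]" if x: "x \<in> carrier M" and g: "g \<in> carrier G" for x g
  proof -
    have "[\<one>\<^bsub>G\<^esub>, g] \<in> tup (Suc (Suc 0))" using g by simp
    then have "delta N (c x) [\<one>\<^bsub>G\<^esub>, g] = \<zero>\<^bsub>N\<^esub>" using cz x by blast
    moreover have "c x [g] \<in> carrier N" "c x [\<one>\<^bsub>G\<^esub>] \<in> carrier N"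
      using g by (auto intro!: C(1)[OF x])
    ultimately show ?thesis by simp
  qed
  have "mcochain M N 0 (\<lambda>x _. c x [\<one>\<^bsub>G\<^esub>])"
  proof (rule mcochainI)
    fix x \<sigma> h assume x: "x \<in> carrier M" and h: "h \<in> carrier G"
    have "c (gact M h x) [\<one>\<^bsub>G\<^esub>] = c (gact M h x) (map (\<lambda>g. g \<otimes>\<^bsub>G\<^esub> h) [\<one>\<^bsub>G\<^esub>])"
      using one[OF gact_closed[OF M x] h, of h] h by (simp only: list.map G.l_one)
    also have "\<dots> = gact N h (c x [\<one>\<^bsub>G\<^esub>])" by (rule C(4)[OF x _ h]) simp
    finally show "c (gact M h x) [\<one>\<^bsub>G\<^esub>] = gact N h (c x [\<one>\<^bsub>G\<^esub>])" .
  next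
    fix x y \<sigma> a assume x: "x \<in> carrier M"
    have t: "[\<one>\<^bsub>G\<^esub>] \<in> tup (Suc 0)" by simp
    show "c x [\<one>\<^bsub>G\<^esub>] \<in> carrier N" by (rule C(1)[OF x t])
    show "c (x \<oplus>\<^bsub>M\<^esub> y) [\<one>\<^bsub>G\<^esub>] = c x [\<one>\<^bsub>G\<^esub>] \<oplus>\<^bsub>N\<^esub> c y [\<one>\<^bsub>G\<^esub>]" if "y \<in> carrier M"
      by (rule C(2)[OF x that t])
    show "c (scal M a x) [\<one>\<^bsub>G\<^esub>] = scal N a (c x [\<one>\<^bsub>G\<^esub>])" if "a \<in> carrier K"
      by (rule C(3)[OF that x t])
  qed
  moreover have "c x \<sigma> = delta N (\<lambda>_. c x [\<one>\<^bsub>G\<^esub>]) \<sigma>" if x: "x \<in> carrier M" and \<sigma>: "\<sigma> \<in> tup (Suc 0)" for x \<sigma>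
  proof -
    obtain g where "\<sigma> = [g]" "g \<in> carrier G" using \<sigma> by (auto elim: tuples_SucE)
    then show ?thesis using one[OF x, of g] C(1)[OF x, of "[\<one>\<^bsub>G\<^esub>]"] by simp
  qed
  ultimately show "\<exists>b. mcochain M N 0 b \<and> (\<forall>x\<in>carrier M. \<forall>\<sigma>\<in>tup (Suc 0). c x \<sigma> = delta N (b x) \<sigma>)"
    by blast
qed

text \<open>A diagram chase with cochains. Pulled back to \<open>P\<close>, the cocycle
  \<open>c\<close> bounds some \<open>b\<close>; on the kernel \<open>W\<close> this
  \<open>b\<close> is a cocycle and bounds \<open>a'\<close>. After extending \<open>a'\<close> to
  \<open>a\<close>, the corrected cochain \<open>d\<close> vanishes on \<open>W\<close>, descends to
  \<open>A\<close> and still bounds \<open>c\<close>. The extension is assumed because for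
  \<open>l = 0\<close> it is a genuine condition.\<close>

lemma mexact_shift:
  fixes P :: "('g \<Rightarrow> 'k, 'p) module" and e :: "'p \<Rightarrow> 'm"
  assumes P: "projective_module KG P" and A: "right_module KG A" and N: "right_module KG N"
    and e: "e \<in> LinearCombinations.module_hom KG P A" and surj: "e ` carrier P = carrier A"
  defines "W \<equiv> {x \<in> carrier P. e x = \<zero>\<^bsub>A\<^esub>}"
  assumes exact: "mexact (P\<lparr>carrier := W\<rparr>) N l"
    and ext: "\<And>a'. mcochain (P\<lparr>carrier := W\<rparr>) N l a' \<Longrightarrow>
      \<exists>a. mcochain P N l a \<and> (\<forall>x\<in>W. \<forall>\<sigma>\<in>tup l. a x \<sigma> = a' x \<sigma>)"
  shows "mexact A N (Suc l)"
  unfolding mexact_def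
proof (intro allI impI)
  interpret N: right_module KG N by fact
  interpret A: right_module KG A by fact
  have Pm: "right_module KG P" using P by (simp add: projective_module_def)
  interpret P: right_module KG P by fact
  note E = klin_of_hom[OF e]
  have eP: "e x \<in> carrier A" if "x \<in> carrier P" for x using klinD(1)[OF E(1) that] .
  fix c assume c: "mcochain A N (Suc (Suc l)) c"
    and cz: "\<forall>y\<in>carrier A. \<forall>\<sigma>\<in>tup (Suc (Suc (Suc l))). delta N (c y) \<sigma> = \<zero>\<^bsub>N\<^esub>"
  note C = mcochainD[OF c]
  have "mcochain P N (Suc (Suc l)) (\<lambda>x. c (e x))"
  proof (rule mcochainI)
    fix x \<sigma> assume x: "x \<in> carrier P" and \<sigma>: "\<sigma> \<in> tup (Suc (Suc l))"
    show "c (e x) \<sigma> \<in> carrier N" by (intro C(1) eP x \<sigma>)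
    show "c (e (x \<oplus>\<^bsub>P\<^esub> y)) \<sigma> = c (e x) \<sigma> \<oplus>\<^bsub>N\<^esub> c (e y) \<sigma>" if y: "y \<in> carrier P" for y
      unfolding klinD(2)[OF E(1) x y] by (intro C(2) eP x y \<sigma>)
    show "c (e (scal P a x)) \<sigma> = scal N a (c (e x) \<sigma>)" if a: "a \<in> carrier K" for a
      unfolding klinD(3)[OF E(1) a x] by (intro C(3) eP x a \<sigma>)
    show "c (e (gact P h x)) (map (\<lambda>g. g \<otimes>\<^bsub>G\<^esub> h) \<sigma>) = gact N h (c (e x) \<sigma>)" if h: "h \<in> carrier G" for h
      unfolding E(2)[OF x] by (intro C(4) eP x h \<sigma>)
  qed
  moreover have "\<forall>x\<in>carrier P. \<forall>\<sigma>\<in>tup (Suc (Suc (Suc l))). delta N (c (e x)) \<sigma> = \<zero>\<^bsub>N\<^esub>"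
    using cz eP by blast
  ultimately obtain b where b: "mcochain P N (Suc l) b"
    and bc: "\<And>x \<sigma>. x \<in> carrier P \<Longrightarrow> \<sigma> \<in> tup (Suc (Suc l)) \<Longrightarrow> c (e x) \<sigma> = delta N (b x) \<sigma>"
    using projective_mexact[OF P N, of "Suc l"] unfolding mexact_def by blast
  have "mcochain (P\<lparr>carrier := W\<rparr>) N (Suc l) b"
    using mcochainD[OF b] by (intro mcochainI) (simp_all add: W_def)
  moreover have bz: "delta N (b x) \<sigma> = \<zero>\<^bsub>N\<^esub>" if x: "x \<in> W" and \<sigma>: "\<sigma> \<in> tup (Suc (Suc l))" for x \<sigma>
  proof -
    have "delta N (b x) \<sigma> = c \<zero>\<^bsub>A\<^esub> \<sigma>" using bc[of x \<sigma>] x \<sigma> by (simp add: W_def)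
    also have "\<dots> = \<zero>\<^bsub>N\<^esub>" by (rule klin_zero[OF A N C(5)[OF \<sigma>]])
    finally show ?thesis .
  qed
  moreover have "\<forall>x\<in>carrier (P\<lparr>carrier := W\<rparr>). \<forall>\<sigma>\<in>tup (Suc (Suc l)). delta N (b x) \<sigma> = \<zero>\<^bsub>N\<^esub>"
    using bz by simp
  ultimately have "\<exists>a'. mcochain (P\<lparr>carrier := W\<rparr>) N l a' \<and>
      (\<forall>x\<in>carrier (P\<lparr>carrier := W\<rparr>). \<forall>\<sigma>\<in>tup (Suc l). b x \<sigma> = delta N (a' x) \<sigma>)"
    using exact unfolding mexact_def by blast
  then obtain a' where a': "mcochain (P\<lparr>carrier := W\<rparr>) N l a'"
    and ba': "\<And>x \<sigma>. x \<in> W \<Longrightarrow> \<sigma> \<in> tup (Suc l) \<Longrightarrow> b x \<sigma> = delta N (a' x) \<sigma>"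
    by auto
  obtain a where a: "mcochain P N l a" and aa': "\<And>x \<sigma>. x \<in> W \<Longrightarrow> \<sigma> \<in> tup l \<Longrightarrow> a x \<sigma> = a' x \<sigma>"
    using ext[OF a'] by blast
  define d where "d = (\<lambda>x \<sigma>. b x \<sigma> \<ominus>\<^bsub>N\<^esub> delta N (a x) \<sigma>)"
  have d: "mcochain P N (Suc l) d"
    unfolding d_def by (rule mcochain_minus[OF Pm N b mcochain_delta[OF Pm N a]])
  note D = mcochainD[OF d]
  have dW: "d x \<sigma> = \<zero>\<^bsub>N\<^esub>" if x: "x \<in> W" and \<sigma>: "\<sigma> \<in> tup (Suc l)" for x \<sigma>
  proof -
    have "delta N (a x) \<sigma> = delta N (a' x) \<sigma>"
      by (rule delta_cong[OF \<sigma>]) (rule aa'[OF x])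
    then show ?thesis
      using ba'[OF x \<sigma>] mcochainD(1)[OF b, of x \<sigma>] x \<sigma> by (simp add: d_def W_def)
  qed
  have d_eq: "d x \<sigma> = d x' \<sigma>"
    if x: "x \<in> carrier P" and x': "x' \<in> carrier P" and "e x = e x'" and \<sigma>: "\<sigma> \<in> tup (Suc l)" for x x' \<sigma>
  proof -
    have "x \<ominus>\<^bsub>P\<^esub> x' \<in> W"
      using klin_diff[OF Pm A E(1) x x'] that eP by (simp add: W_def)
    then have "d x \<sigma> \<ominus>\<^bsub>N\<^esub> d x' \<sigma> = \<zero>\<^bsub>N\<^esub>"
      using dW[OF _ \<sigma>] klin_diff[OF Pm N D(5)[OF \<sigma>] x x'] by simp
    then show ?thesis using D(1)[OF x \<sigma>] D(1)[OF x' \<sigma>] by simp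
  qed
  \<comment> \<open>A section of sets suffices, since \<open>d\<close> is constant on the fibres of
    \<open>e\<close>.\<close>
  define s where "s = inv_into (carrier P) e"
  have s: "s y \<in> carrier P" "e (s y) = y" if "y \<in> carrier A" for y
    unfolding s_def
    by (rule inv_into_into[of y e "carrier P", unfolded surj, OF that]
        f_inv_into_f[of y e "carrier P", unfolded surj, OF that])+
  have ds: "d (s (e x)) \<sigma> = d x \<sigma>" if "x \<in> carrier P" "\<sigma> \<in> tup (Suc l)" for x \<sigma>
    by (rule d_eq[OF s(1)[OF eP[OF that(1)]] that(1) s(2)[OF eP[OF that(1)]] that(2)])
  have "mcochain A N (Suc l) (\<lambda>y. d (s y))"
  proof (rule mcochainI)
    fix y \<sigma> assume y: "y \<in> carrier A" and \<sigma>: "\<sigma> \<in> tup (Suc l)"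
    show "d (s y) \<sigma> \<in> carrier N" by (rule D(1)[OF s(1)[OF y] \<sigma>])
    show "d (s (y \<oplus>\<^bsub>A\<^esub> z)) \<sigma> = d (s y) \<sigma> \<oplus>\<^bsub>N\<^esub> d (s z) \<sigma>" if z: "z \<in> carrier A" for z
      using ds[OF P.M.a_closed[OF s(1)[OF y] s(1)[OF z]] \<sigma>]
      unfolding klinD(2)[OF E(1) s(1)[OF y] s(1)[OF z]] s(2)[OF y] s(2)[OF z] D(2)[OF s(1)[OF y] s(1)[OF z] \<sigma>] .
    show "d (s (scal A a y)) \<sigma> = scal N a (d (s y) \<sigma>)" if a: "a \<in> carrier K" for a
      using ds[OF scal_closed[OF Pm a s(1)[OF y]] \<sigma>]
      unfolding klinD(3)[OF E(1) a s(1)[OF y]] s(2)[OF y] D(3)[OF a s(1)[OF y] \<sigma>] .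
    show "d (s (gact A h y)) (map (\<lambda>g. g \<otimes>\<^bsub>G\<^esub> h) \<sigma>) = gact N h (d (s y) \<sigma>)" if h: "h \<in> carrier G" for h
      using ds[OF gact_closed[OF Pm s(1)[OF y], of h] tup_translate[OF \<sigma> h]]
      unfolding E(2)[OF s(1)[OF y]] s(2)[OF y] D(4)[OF s(1)[OF y] \<sigma> h] .
  qed
  moreover have "c y \<sigma> = delta N (d (s y)) \<sigma>" if y: "y \<in> carrier A" and \<sigma>: "\<sigma> \<in> tup (Suc (Suc l))" for y \<sigma>
  proof -
    let ?x = "s y"
    have x: "?x \<in> carrier P" by (rule s(1)[OF y])
    have "delta N (d ?x) \<sigma> = delta N (b ?x) \<sigma> \<ominus>\<^bsub>N\<^esub> delta N (delta N (a ?x)) \<sigma>"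
      unfolding d_def
      by (rule N.M.delta_minus[OF \<sigma> mcochainD(1)[OF b x] mcochainD(1)[OF mcochain_delta[OF Pm N a] x]])
    also have "delta N (delta N (a ?x)) \<sigma> = \<zero>\<^bsub>N\<^esub>"
      by (rule N.M.delta_delta[OF \<sigma> mcochainD(1)[OF a x]])
    also have "delta N (b ?x) \<sigma> = c y \<sigma>" using bc[OF x \<sigma>] s(2)[OF y] by simp
    finally show ?thesis using C(1)[OF y \<sigma>] by simp
  qed
  ultimately show "\<exists>b. mcochain A N (Suc l) b \<and> (\<forall>x\<in>carrier A. \<forall>\<sigma>\<in>tup (Suc (Suc l)). c x \<sigma> = delta N (b x) \<sigma>)"
    by blast
qed

end

section \<open>Vanishing of Ext\<close>

text \<open>All that is known of the chosen resolution is that it is one. Accordingly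
  \<open>not_Ext_nonzeroE\<close> yields some resolution, while \<open>not_Ext_nonzeroI\<close> asks
  for an argument valid for all.\<close>

lemma Ext_resolution:
  fixes M :: "('r, 'm) module"
  assumes "right_module R M"
  obtains P d \<epsilon> where "projective_resolution R M P d \<epsilon>"
    "\<And>n. Ext R M N n = Ext_of_resolution R P d N n"
proof -
  let ?Q = "\<lambda>(P :: nat \<Rightarrow> ('r, ('m, 'r) syz \<Rightarrow> 'r) module, d). \<exists>\<epsilon>. projective_resolution R M P d \<epsilon>"
  obtain P d where Pd: "(SOME x. ?Q x) = (P, d)" by (rule prod.exhaust)
  have "\<exists>x. ?Q x" using projective_resolution_exists[OF assms] by auto
  then have "?Q (SOME x. ?Q x)" by (rule someI_ex)
  then obtain \<epsilon> where "projective_resolution R M P d \<epsilon>" unfolding Pd by auto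
  then show ?thesis using that[of P d \<epsilon>] Pd by (simp add: Ext_def)
qed

section \<open>Homomorphism groups and cosets of coboundaries\<close>

lemma Hom_group_simps:
  "carrier (Hom_group R P N) = LinearCombinations.module_hom R P N \<inter> extensional (carrier P)"
  "mult (Hom_group R P N) = (\<lambda>f g. \<lambda>x\<in>carrier P. f x \<oplus>\<^bsub>N\<^esub> g x)"
  "one (Hom_group R P N) = (\<lambda>x\<in>carrier P. \<zero>\<^bsub>N\<^esub>)"
  by (simp_all add: Hom_group_def)

context
  fixes R :: "('r, 'c) ring_scheme" and N :: "('r, 'n) module"
  assumes N: "right_module R N"
begin

interpretation N: right_module R N by (rule N)

lemma Hom_group_restrict:
  assumes "right_module R P" "f \<in> LinearCombinations.module_hom R P N"
  shows "restrict f (carrier P) \<in> carrier (Hom_group R P N)"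
proof -
  interpret P: right_module R P by fact
  show ?thesis
    using assms(2) by (auto simp: Hom_group_simps LinearCombinations.module_hom_def)
qed

lemma Hom_group_zero:
  assumes "right_module R P"
  shows "(\<lambda>x\<in>carrier P. \<zero>\<^bsub>N\<^esub>) \<in> carrier (Hom_group R P N)"
proof -
  have "(\<lambda>_. \<zero>\<^bsub>N\<^esub>) \<in> LinearCombinations.module_hom R P N"
    by (simp add: LinearCombinations.module_hom_def)
  then show ?thesis by (rule Hom_group_restrict[OF assms])
qed

lemma Hom_group_add:
  assumes "right_module R P" "f \<in> carrier (Hom_group R P N)" "g \<in> carrier (Hom_group R P N)"
  shows "(\<lambda>x\<in>carrier P. f x \<oplus>\<^bsub>N\<^esub> g x) \<in> carrier (Hom_group R P N)"
proof (rule Hom_group_restrict[OF assms(1)])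
  have f: "f \<in> LinearCombinations.module_hom R P N" and g: "g \<in> LinearCombinations.module_hom R P N"
    using assms by (auto simp: Hom_group_simps)
  note f = funcset_mem[OF LinearCombinations.module_hom_closed[OF f]]
    LinearCombinations.module_hom_add[OF f] LinearCombinations.module_hom_smult[OF f]
  note g = funcset_mem[OF LinearCombinations.module_hom_closed[OF g]]
    LinearCombinations.module_hom_add[OF g] LinearCombinations.module_hom_smult[OF g]
  show "(\<lambda>x. f x \<oplus>\<^bsub>N\<^esub> g x) \<in> LinearCombinations.module_hom R P N"
    using f g by (auto simp: LinearCombinations.module_hom_def N.smult_r_distr N.M.a_ac)
qed

lemma Hom_group_uminus:
  assumes "right_module R P" "f \<in> carrier (Hom_group R P N)"
  shows "(\<lambda>x\<in>carrier P. \<ominus>\<^bsub>N\<^esub> f x) \<in> carrier (Hom_group R P N)"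
proof (rule Hom_group_restrict[OF assms(1)])
  have f: "f \<in> LinearCombinations.module_hom R P N"
    using assms by (auto simp: Hom_group_simps)
  note f = funcset_mem[OF LinearCombinations.module_hom_closed[OF f]]
    LinearCombinations.module_hom_add[OF f] LinearCombinations.module_hom_smult[OF f]
  have neg: "\<ominus>\<^bsub>N\<^esub> (a \<odot>\<^bsub>N\<^esub> x) = a \<odot>\<^bsub>N\<^esub> (\<ominus>\<^bsub>N\<^esub> x)" if "a \<in> carrier R" "x \<in> carrier N" for a x
  proof (rule N.M.minus_equality)
    have "a \<odot>\<^bsub>N\<^esub> (\<ominus>\<^bsub>N\<^esub> x) \<oplus>\<^bsub>N\<^esub> a \<odot>\<^bsub>N\<^esub> x = a \<odot>\<^bsub>N\<^esub> (\<ominus>\<^bsub>N\<^esub> x \<oplus>\<^bsub>N\<^esub> x)"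
      using that by (intro N.smult_r_distr[symmetric]) auto
    then show "a \<odot>\<^bsub>N\<^esub> (\<ominus>\<^bsub>N\<^esub> x) \<oplus>\<^bsub>N\<^esub> a \<odot>\<^bsub>N\<^esub> x = \<zero>\<^bsub>N\<^esub>" using that by (simp add: N.M.l_neg)
  qed (use that in auto)
  show "(\<lambda>x. \<ominus>\<^bsub>N\<^esub> f x) \<in> LinearCombinations.module_hom R P N"
    using f by (auto simp: LinearCombinations.module_hom_def N.M.minus_add neg)
qed

text \<open>In a trivial quotient the coset of a cocycle is the set of coboundaries. The cocycle
  lies in its own coset because zero is a coboundary, so it is a coboundary itself.\<close>

lemma not_Ext_nonzeroE:
  fixes M :: "('r, 'm) module"
  assumes M: "right_module R M" and Ext: "\<not> Ext_nonzero R M N (Suc m)"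
  obtains P :: "nat \<Rightarrow> ('r, ('m, 'r) syz \<Rightarrow> 'r) module" and d \<epsilon> where "projective_resolution R M P d \<epsilon>"
    "\<And>f. f \<in> LinearCombinations.module_hom R (P (Suc m)) N \<Longrightarrow>
       (\<And>x. x \<in> carrier (P (Suc (Suc m))) \<Longrightarrow> f (d (Suc m) x) = \<zero>\<^bsub>N\<^esub>) \<Longrightarrow>
       \<exists>g\<in>LinearCombinations.module_hom R (P m) N. \<forall>x\<in>carrier (P (Suc m)). f x = g (d m x)"
proof -
  obtain P d \<epsilon> where res: "projective_resolution R M P d \<epsilon>"
    and Ext_eq: "\<And>n. Ext R M N n = Ext_of_resolution R P d N n"
    using Ext_resolution[OF M, of N] by blast
  have P: "right_module R (P n)" and d: "d n \<in> LinearCombinations.module_hom R (P (Suc n)) (P n)" for n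
    using res by (auto simp: projective_resolution_def projective_module_def)
  have dc: "d n x \<in> carrier (P n)" if "x \<in> carrier (P (Suc n))" for n x
    using LinearCombinations.module_hom_closed[OF d[of n]] that by auto
  have "\<exists>g\<in>LinearCombinations.module_hom R (P m) N. \<forall>x\<in>carrier (P (Suc m)). f x = g (d m x)"
    if f: "f \<in> LinearCombinations.module_hom R (P (Suc m)) N"
      and fd: "\<And>x. x \<in> carrier (P (Suc (Suc m))) \<Longrightarrow> f (d (Suc m) x) = \<zero>\<^bsub>N\<^esub>" for f
  proof -
    let ?f = "restrict f (carrier (P (Suc m)))"
    let ?B = "Ext_coboundaries R P d N (Suc m)"
    have fc: "?f \<in> Ext_cocycles R P d N (Suc m)"
      using Hom_group_restrict[OF P f] fd dc
      by (auto simp: Ext_cocycles_def Hom_diff_def Hom_group_simps fun_eq_iff)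
    define \<Gamma> where "\<Gamma> = (Hom_group R (P (Suc m)) N)\<lparr>carrier := Ext_cocycles R P d N (Suc m)\<rparr>"
    have "carrier (Ext R M N (Suc m)) = {\<one>\<^bsub>Ext R M N (Suc m)\<^esub>}"
      using Ext by (simp add: Ext_nonzero_def)
    then have "rcosets\<^bsub>\<Gamma>\<^esub> ?B = {?B}"
      by (simp add: Ext_eq Ext_of_resolution_def FactGroup_def \<Gamma>_def)
    moreover have "?B #>\<^bsub>\<Gamma>\<^esub> ?f \<in> rcosets\<^bsub>\<Gamma>\<^esub> ?B"
      using fc by (auto simp: RCOSETS_def \<Gamma>_def)
    ultimately have coset: "?B #>\<^bsub>\<Gamma>\<^esub> ?f = ?B" by simp
    have zero: "(\<lambda>x\<in>carrier (P (Suc m)). \<zero>\<^bsub>N\<^esub>) \<in> ?B"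
    proof -
      have "(\<lambda>x\<in>carrier (P (Suc m)). \<zero>\<^bsub>N\<^esub>) = Hom_diff P d m (\<lambda>x\<in>carrier (P m). \<zero>\<^bsub>N\<^esub>)"
        using dc by (auto simp: Hom_diff_def fun_eq_iff)
      then show ?thesis
        using Hom_group_zero[OF P[of m]] by (simp add: Ext_coboundaries_def)
    qed
    have "(\<lambda>x\<in>carrier (P (Suc m)). \<zero>\<^bsub>N\<^esub>) \<otimes>\<^bsub>\<Gamma>\<^esub> ?f = ?f"
      using LinearCombinations.module_hom_closed[OF f]
      by (auto simp: \<Gamma>_def Hom_group_simps fun_eq_iff Pi_iff)
    then have "?f \<in> ?B #>\<^bsub>\<Gamma>\<^esub> ?f"
      using zero by (force simp: r_coset_def)
    then obtain g where g: "g \<in> carrier (Hom_group R (P m) N)" "?f = Hom_diff P d m g"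
      using coset by (auto simp: Ext_coboundaries_def)
    then have "f x = g (d m x)" if "x \<in> carrier (P (Suc m))" for x
      using that by (auto simp: Hom_diff_def fun_eq_iff restrict_def split: if_splits)
    then show ?thesis using g(1) by (auto simp: Hom_group_simps)
  qed
  then show ?thesis using that[OF res] by blast
qed

text \<open>Each coset is the set of coboundaries translated by a coboundary, and coboundaries are
  closed under sums and differences. The zero cocycle shows that there is a coset at all.\<close>

lemma not_Ext_nonzeroI:
  fixes M :: "('r, 'm) module"
  assumes M: "right_module R M"
    and cob: "\<And>(P :: nat \<Rightarrow> ('r, ('m, 'r) syz \<Rightarrow> 'r) module) d \<epsilon> f.
      projective_resolution R M P d \<epsilon> \<Longrightarrow> f \<in> LinearCombinations.module_hom R (P (Suc m)) N \<Longrightarrow>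
      (\<And>x. x \<in> carrier (P (Suc (Suc m))) \<Longrightarrow> f (d (Suc m) x) = \<zero>\<^bsub>N\<^esub>) \<Longrightarrow>
      \<exists>g\<in>LinearCombinations.module_hom R (P m) N. \<forall>x\<in>carrier (P (Suc m)). f x = g (d m x)"
  shows "\<not> Ext_nonzero R M N (Suc m)"
proof -
  obtain P d \<epsilon> where res: "projective_resolution R M P d \<epsilon>"
    and Ext_eq: "\<And>n. Ext R M N n = Ext_of_resolution R P d N n"
    using Ext_resolution[OF M, of N] by blast
  have P: "right_module R (P n)" and d: "d n \<in> LinearCombinations.module_hom R (P (Suc n)) (P n)" for n
    using res by (auto simp: projective_resolution_def projective_module_def)
  have dc: "d n x \<in> carrier (P n)" if "x \<in> carrier (P (Suc n))" for n x
    using LinearCombinations.module_hom_closed[OF d[of n]] that by auto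
  let ?B = "Ext_coboundaries R P d N (Suc m)" and ?Z = "Ext_cocycles R P d N (Suc m)"
  let ?H = "carrier (Hom_group R (P m) N)"
  define \<Gamma> where "\<Gamma> = (Hom_group R (P (Suc m)) N)\<lparr>carrier := ?Z\<rparr>"
  have B_eq: "?B = Hom_diff P d m ` ?H" by (simp add: Ext_coboundaries_def)
  have val: "g x \<in> carrier N" if "g \<in> ?H" "x \<in> carrier (P m)" for g x
    using that LinearCombinations.module_hom_closed by (fastforce simp: Hom_group_simps)
  have ZB: "f \<in> ?B" if f: "f \<in> ?Z" for f
  proof -
    have fd: "f (d (Suc m) x) = \<zero>\<^bsub>N\<^esub>" if "x \<in> carrier (P (Suc (Suc m)))" for x
      using f that by (auto simp: Ext_cocycles_def Hom_diff_def Hom_group_simps fun_eq_iff restrict_def split: if_splits)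
    have "f \<in> LinearCombinations.module_hom R (P (Suc m)) N" "f \<in> extensional (carrier (P (Suc m)))"
      using f by (auto simp: Ext_cocycles_def Hom_group_simps)
    then obtain g where g: "g \<in> LinearCombinations.module_hom R (P m) N"
      "\<And>x. x \<in> carrier (P (Suc m)) \<Longrightarrow> f x = g (d m x)"
      using cob[OF res, of f] fd by blast
    have "f = Hom_diff P d m (restrict g (carrier (P m)))"
      using g(2) dc \<open>f \<in> extensional _\<close> by (auto simp: Hom_diff_def fun_eq_iff extensional_def)
    then show ?thesis unfolding B_eq using Hom_group_restrict[OF P g(1)] by blast
  qed
  have coset: "?B #>\<^bsub>\<Gamma>\<^esub> f = ?B" if fZ: "f \<in> ?Z" for f
  proof -
    obtain g where g: "g \<in> ?H" "f = Hom_diff P d m g" using ZB[OF fZ] unfolding B_eq by blast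
    have mult: "Hom_diff P d m h \<otimes>\<^bsub>\<Gamma>\<^esub> f = Hom_diff P d m (\<lambda>x\<in>carrier (P m). h x \<oplus>\<^bsub>N\<^esub> g x)" for h
      using dc by (auto simp: \<Gamma>_def Hom_group_simps g(2) Hom_diff_def fun_eq_iff)
    show ?thesis
    proof (intro equalityI subsetI)
      fix u assume "u \<in> ?B #>\<^bsub>\<Gamma>\<^esub> f"
      then obtain h where "h \<in> ?H" "u = Hom_diff P d m h \<otimes>\<^bsub>\<Gamma>\<^esub> f" by (auto simp: r_coset_def B_eq)
      then show "u \<in> ?B" unfolding B_eq mult using Hom_group_add[OF P _ g(1)] by blast
    next
      fix u assume "u \<in> ?B"
      then obtain h where h: "h \<in> ?H" "u = Hom_diff P d m h" by (auto simp: B_eq)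
      let ?h = "\<lambda>x\<in>carrier (P m). h x \<oplus>\<^bsub>N\<^esub> (\<lambda>x\<in>carrier (P m). \<ominus>\<^bsub>N\<^esub> g x) x"
      have hH: "?h \<in> ?H" by (intro Hom_group_add Hom_group_uminus P h g)
      have "u = Hom_diff P d m ?h \<otimes>\<^bsub>\<Gamma>\<^esub> f"
        unfolding mult h(2)
        using dc val[OF h(1)] val[OF g(1)] by (auto simp: Hom_diff_def fun_eq_iff N.M.a_assoc N.M.l_neg)
      then show "u \<in> ?B #>\<^bsub>\<Gamma>\<^esub> f" using hH by (auto simp: r_coset_def B_eq)
    qed
  qed
  have "(\<lambda>x\<in>carrier (P (Suc m)). \<zero>\<^bsub>N\<^esub>) \<in> ?Z"
    using Hom_group_zero[OF P] dc by (auto simp: Ext_cocycles_def Hom_diff_def Hom_group_simps fun_eq_iff)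
  then have "?Z \<noteq> {}" by blast
  then have "rcosets\<^bsub>\<Gamma>\<^esub> ?B = {?B}"
    using coset by (auto simp: RCOSETS_def \<Gamma>_def)
  then show ?thesis
    by (simp add: Ext_nonzero_def Ext_eq Ext_of_resolution_def FactGroup_def \<Gamma>_def)
qed

end

section \<open>From \<open>Ext\<close> to the homogeneous complex\<close>

context finite_group_field_algebra
begin

text \<open>Climb along the kernels \<open>Z i\<close> of the resolution: length zero on
  \<open>Z m\<close> is automatic, and each shift passes from one kernel to the previous one while
  raising the degree by one, the last shift reaching \<open>M\<close> in degree
  \<open>Suc m\<close>. Only the first shift has to extend cochains of length zero, and there the
  hypothesis on \<open>Ext\<close> enters.\<close>

lemma mexact_if_Ext_zero:
  fixes M :: "('g \<Rightarrow> 'k, 'm) module" and N :: "('g \<Rightarrow> 'k, 'n) module"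
  assumes M: "right_module KG M" and N: "right_module KG N" and Ext: "\<not> Ext_nonzero KG M N (Suc m)"
  shows "mexact M N (Suc m)"
proof -
  interpret N: right_module KG N by (rule N)
  obtain P :: "nat \<Rightarrow> ('g \<Rightarrow> 'k, ('m, 'g \<Rightarrow> 'k) syz \<Rightarrow> 'g \<Rightarrow> 'k) module" and d \<epsilon>
    where res: "projective_resolution KG M P d \<epsilon>"
      and cob: "\<And>f. f \<in> LinearCombinations.module_hom KG (P (Suc m)) N \<Longrightarrow>
       (\<And>x. x \<in> carrier (P (Suc (Suc m))) \<Longrightarrow> f (d (Suc m) x) = \<zero>\<^bsub>N\<^esub>) \<Longrightarrow>
       \<exists>g\<in>LinearCombinations.module_hom KG (P m) N. \<forall>x\<in>carrier (P (Suc m)). f x = g (d m x)"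
    using not_Ext_nonzeroE[OF N M Ext] by blast
  have proj: "projective_module KG (P n)" and Pm: "right_module KG (P n)"
    and d: "d n \<in> LinearCombinations.module_hom KG (P (Suc n)) (P n)" for n
    using res by (auto simp: projective_resolution_def projective_module_def)
  have eps: "\<epsilon> \<in> LinearCombinations.module_hom KG (P 0) M" "\<epsilon> ` carrier (P 0) = carrier M"
    and im0: "d 0 ` carrier (P (Suc 0)) = {x \<in> carrier (P 0). \<epsilon> x = \<zero>\<^bsub>M\<^esub>}"
    and imS: "\<And>n. d (Suc n) ` carrier (P (Suc (Suc n))) = {x \<in> carrier (P (Suc n)). d n x = \<zero>\<^bsub>P n\<^esub>}"
    using res by (auto simp: projective_resolution_def)
  define Z where "Z = (\<lambda>n. (P n)\<lparr>carrier := d n ` carrier (P (Suc n))\<rparr>)"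
  have Zm: "right_module KG (Z n)" for n
  proof (cases n)
    case 0
    show ?thesis unfolding Z_def 0 im0 by (rule right_module_kernel[OF Pm M eps(1)])
  next
    case (Suc k)
    show ?thesis unfolding Z_def Suc imS by (rule right_module_kernel[OF Pm Pm d])
  qed
  have dZ: "d n \<in> LinearCombinations.module_hom KG (P (Suc n)) (Z n)" for n
    using d[of n] by (auto simp: Z_def LinearCombinations.module_hom_def)
  have sub: "d n ` carrier (P (Suc n)) \<subseteq> carrier (P n)" for n
    using LinearCombinations.module_hom_closed[OF d[of n]] by auto
  have ext: "\<exists>a. mcochain (P i) N j a \<and>
      (\<forall>x\<in>d i ` carrier (P (Suc i)). \<forall>\<sigma>\<in>tup j. a x \<sigma> = a' x \<sigma>)"
    if ij: "i + j = m" and a': "mcochain (Z i) N j a'" for i j a'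
  proof (cases j)
    case (Suc k)
    show ?thesis
      using mcochain_extend[OF Pm N Zm[unfolded Z_def] sub a'[unfolded Z_def Suc]] unfolding Suc by metis
  next
    case 0
    \<comment> \<open>A cochain of length zero on \<open>Z m\<close> is a homomorphism. Composed
      with \<open>d m\<close> it is a cocycle of the resolution, and a homomorphism on
      \<open>P m\<close> that bounds it is the wanted extension.\<close>
    then have i: "i = m" using ij by simp
    note A = mcochainD[OF a'[unfolded i 0]]
    have nil: "[] \<in> tup 0" by simp
    have "(\<lambda>x. a' x []) \<in> LinearCombinations.module_hom KG (Z m) N"
      using A(4)[OF _ nil] by (intro hom_of_klin[OF Zm N A(5)[OF nil]]) simp
    note H = funcset_mem[OF LinearCombinations.module_hom_closed[OF this]]
      LinearCombinations.module_hom_add[OF this] LinearCombinations.module_hom_smult[OF this]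
    note D = funcset_mem[OF LinearCombinations.module_hom_closed[OF dZ[of m]]]
      LinearCombinations.module_hom_add[OF dZ[of m]] LinearCombinations.module_hom_smult[OF dZ[of m]]
    have "(\<lambda>x. a' (d m x) []) \<in> LinearCombinations.module_hom KG (P (Suc m)) N"
      unfolding LinearCombinations.module_hom_def mem_Collect_eq
    proof (intro CollectI conjI allI impI)
      show "(\<lambda>x. a' (d m x) []) \<in> carrier (P (Suc m)) \<rightarrow> carrier N"
        using H(1) D(1) by blast
      show "a' (d m (x \<oplus>\<^bsub>P (Suc m)\<^esub> y)) [] = a' (d m x) [] \<oplus>\<^bsub>N\<^esub> a' (d m y) []"
        if "x \<in> carrier (P (Suc m)) \<and> y \<in> carrier (P (Suc m))" for x y
        using that by (simp only: D H)
      show "a' (d m (r \<odot>\<^bsub>P (Suc m)\<^esub> x)) [] = r \<odot>\<^bsub>N\<^esub> a' (d m x) []"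
        if "r \<in> carrier KG \<and> x \<in> carrier (P (Suc m))" for r x
        using that by (simp only: D H)
    qed
    moreover have "a' (d m (d (Suc m) x)) [] = \<zero>\<^bsub>N\<^esub>" if x: "x \<in> carrier (P (Suc (Suc m)))" for x
    proof -
      have "d m (d (Suc m) x) = \<zero>\<^bsub>Z m\<^esub>" using imS[of m] x by (auto simp: Z_def)
      then show ?thesis using klin_zero[OF Zm N A(5)[OF nil]] by simp
    qed
    ultimately obtain g where g: "g \<in> LinearCombinations.module_hom KG (P m) N"
      "\<And>x. x \<in> carrier (P (Suc m)) \<Longrightarrow> a' (d m x) [] = g (d m x)"
      using cob[of "\<lambda>x. a' (d m x) []"] by blast
    note G' = klin_of_hom[OF g(1)]
    have "mcochain (P m) N 0 (\<lambda>x _. g x)"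
      by (rule mcochainI) (simp_all add: klinD[OF G'(1)] G'(2))
    then show ?thesis unfolding i 0 using g(2) by auto
  qed
  have step: "mexact (Z (m - j)) N j" if "j \<le> m" for j
    using that
  proof (induction j)
    case 0
    show ?case by (rule mexact_0[OF Zm N])
  next
    case (Suc j)
    define i where "i = m - Suc j"
    have i: "m - j = Suc i" "Suc i + j = m" using Suc.prems by (auto simp: i_def)
    have Z_eq: "(P (Suc i))\<lparr>carrier := {x \<in> carrier (P (Suc i)). d i x = \<zero>\<^bsub>Z i\<^esub>}\<rparr> = Z (Suc i)"
      unfolding Z_def imS by simp
    have ker: "{x \<in> carrier (P (Suc i)). d i x = \<zero>\<^bsub>Z i\<^esub>} = d (Suc i) ` carrier (P (Suc (Suc i)))"
      unfolding Z_def imS by simp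
    have "mexact (Z i) N (Suc j)"
    proof (rule mexact_shift[OF proj Zm N dZ])
      show "d i ` carrier (P (Suc i)) = carrier (Z i)" by (simp add: Z_def)
      show "mexact ((P (Suc i))\<lparr>carrier := {x \<in> carrier (P (Suc i)). d i x = \<zero>\<^bsub>Z i\<^esub>}\<rparr>) N j"
        unfolding Z_eq using Suc i by simp
      show "\<exists>a. mcochain (P (Suc i)) N j a \<and>
          (\<forall>x\<in>{x \<in> carrier (P (Suc i)). d i x = \<zero>\<^bsub>Z i\<^esub>}. \<forall>\<sigma>\<in>tup j. a x \<sigma> = a' x \<sigma>)"
        if "mcochain ((P (Suc i))\<lparr>carrier := {x \<in> carrier (P (Suc i)). d i x = \<zero>\<^bsub>Z i\<^esub>}\<rparr>) N j a'" for a'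
        using ext[OF i(2) that[unfolded Z_eq]] unfolding ker .
    qed
    then show ?case by (simp add: i_def)
  qed
  have Z_eq: "(P 0)\<lparr>carrier := {x \<in> carrier (P 0). \<epsilon> x = \<zero>\<^bsub>M\<^esub>}\<rparr> = Z 0"
    unfolding Z_def im0 ..
  show ?thesis
  proof (rule mexact_shift[OF proj M N eps])
    show "mexact ((P 0)\<lparr>carrier := {x \<in> carrier (P 0). \<epsilon> x = \<zero>\<^bsub>M\<^esub>}\<rparr>) N m"
      unfolding Z_eq using step[of m] by simp
    show "\<exists>a. mcochain (P 0) N m a \<and> (\<forall>x\<in>{x \<in> carrier (P 0). \<epsilon> x = \<zero>\<^bsub>M\<^esub>}. \<forall>\<sigma>\<in>tup m. a x \<sigma> = a' x \<sigma>)"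
      if "mcochain ((P 0)\<lparr>carrier := {x \<in> carrier (P 0). \<epsilon> x = \<zero>\<^bsub>M\<^esub>}\<rparr>) N m a'" for a'
      using ext[of 0 m, OF _ that[unfolded Z_eq]] unfolding im0 by simp
  qed
qed

end

section \<open>The trace argument and the character of an extension\<close>

context finite_group_field_algebra
begin

lemma trivial_module_simps [simp]:
  "carrier (trivial_module K G) = carrier K" "zero (trivial_module K G) = \<zero>\<^bsub>K\<^esub>"
  "add (trivial_module K G) = add K"
  by (simp_all add: trivial_module_def)

lemma finsum_delta:
  assumes "g \<in> carrier G" "c \<in> carrier K"
  shows "finsum K (\<lambda>k\<in>carrier G. if k = g then c else \<zero>\<^bsub>K\<^esub>) (carrier G) = c"
proof -
  have "finsum K (\<lambda>k\<in>carrier G. if k = g then c else \<zero>\<^bsub>K\<^esub>) (carrier G) =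
      (\<Oplus>\<^bsub>K\<^esub>k\<in>carrier G. if g = k then c else \<zero>\<^bsub>K\<^esub>)"
    using assms by (intro K.add.finprod_cong') auto
  also have "\<dots> = c" using assms by (intro K.finsum_singleton) auto
  finally show ?thesis .
qed

lemma scal_trivial: "c \<in> carrier K \<Longrightarrow> scal (trivial_module K G) c x = x \<otimes>\<^bsub>K\<^esub> c"
  using finsum_delta[of "\<one>\<^bsub>G\<^esub>" c]
  by (simp add: scal_def trivial_module_def group_algebra_scalar_def)

lemma gact_trivial: "g \<in> carrier G \<Longrightarrow> x \<in> carrier K \<Longrightarrow> gact (trivial_module K G) g x = x"
  using finsum_delta[of g "\<one>\<^bsub>K\<^esub>"]
  by (simp add: gact_def trivial_module_def gelt_def)

section \<open>Traces with respect to coordinates\<close>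

context
  fixes M :: "('g \<Rightarrow> 'k, 'm, 'e) module_scheme" and B :: "'m set" and \<kappa> :: "'m \<Rightarrow> 'm \<Rightarrow> 'k"
  assumes M: "right_module KG M"
    and B: "finite B" "B \<subseteq> carrier M"
    and coord_closed: "\<And>x e. x \<in> carrier M \<Longrightarrow> e \<in> B \<Longrightarrow> \<kappa> x e \<in> carrier K"
    and coord_add: "\<And>x y e. x \<in> carrier M \<Longrightarrow> y \<in> carrier M \<Longrightarrow> e \<in> B \<Longrightarrow> \<kappa> (x \<oplus>\<^bsub>M\<^esub> y) e = \<kappa> x e \<oplus>\<^bsub>K\<^esub> \<kappa> y e"
    and coord_scal: "\<And>c x e. c \<in> carrier K \<Longrightarrow> x \<in> carrier M \<Longrightarrow> e \<in> B \<Longrightarrow> \<kappa> (scal M c x) e = c \<otimes>\<^bsub>K\<^esub> \<kappa> x e"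
    and coord_basis: "\<And>e. e \<in> B \<Longrightarrow> \<kappa> e e = \<one>\<^bsub>K\<^esub>"
    and coord_expand: "\<And>x. x \<in> carrier M \<Longrightarrow> x = (\<Oplus>\<^bsub>M\<^esub>e\<in>B. scal M (\<kappa> x e) e)"
begin

interpretation M: right_module KG M by (rule M)

lemma BM: "e \<in> B \<Longrightarrow> e \<in> carrier M"
  using B by blast

lemma coord_zero: "e \<in> B \<Longrightarrow> \<kappa> \<zero>\<^bsub>M\<^esub> e = \<zero>\<^bsub>K\<^esub>"
  using coord_scal[of "\<zero>\<^bsub>K\<^esub>" e e] coord_closed[OF BM, of e e] scal_zero_left[OF M BM, of e] BM by simp

lemma coord_finsum:
  assumes "finite I" "\<And>i. i \<in> I \<Longrightarrow> h i \<in> carrier M" "e \<in> B"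
  shows "\<kappa> (\<Oplus>\<^bsub>M\<^esub>i\<in>I. h i) e = (\<Oplus>\<^bsub>K\<^esub>i\<in>I. \<kappa> (h i) e)"
  using assms
proof (induction I)
  case empty
  then show ?case using coord_zero by simp
next
  case (insert i I)
  then have cl: "h \<in> I \<rightarrow> carrier M" "h i \<in> carrier M" by auto
  have cl': "(\<lambda>i. \<kappa> (h i) e) \<in> I \<rightarrow> carrier K" "\<kappa> (h i) e \<in> carrier K"
    using cl coord_closed insert.prems(2) by auto
  show ?case
    unfolding M.M.finsum_insert[OF insert.hyps(1,2) cl] K.finsum_insert[OF insert.hyps(1,2) cl']
      coord_add[OF cl(2) M.M.finsum_closed[OF cl(1)] insert.prems(2)]
    using insert by simp
qed

definition tr :: "('m \<Rightarrow> 'm) \<Rightarrow> 'k" where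
  "tr f = (\<Oplus>\<^bsub>K\<^esub>e\<in>B. \<kappa> (f e) e)"

lemma tr_closed:
  assumes "klin M M f"
  shows "tr f \<in> carrier K"
  unfolding tr_def using coord_closed[OF klinD(1)[OF assms BM]] by (intro K.finsum_closed) blast

lemma tr_cong:
  assumes "\<And>x. x \<in> carrier M \<Longrightarrow> f x = f' x" "klin M M f'"
  shows "tr f = tr f'"
  unfolding tr_def
  using coord_closed[OF klinD(1)[OF assms(2) BM]] by (intro K.add.finprod_cong' refl) (auto simp: assms(1) BM)

lemma tr_comp_eq:
  assumes f: "klin M M f" and h: "klin M M h"
  shows "tr (\<lambda>x. f (h x)) = (\<Oplus>\<^bsub>K\<^esub>e\<in>B. \<Oplus>\<^bsub>K\<^esub>e'\<in>B. \<kappa> (h e) e' \<otimes>\<^bsub>K\<^esub> \<kappa> (f e') e)"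
  unfolding tr_def
proof (rule K.add.finprod_cong'[OF refl])
  note fM = klinD(1)[OF f] and hM = klinD(1)[OF h]
  have cl: "\<kappa> (h e) e' \<otimes>\<^bsub>K\<^esub> \<kappa> (f e') e \<in> carrier K" if "e \<in> B" "e' \<in> B" for e e'
    using that by (intro K.m_closed coord_closed fM hM BM)
  show "(\<lambda>e. \<Oplus>\<^bsub>K\<^esub>e'\<in>B. \<kappa> (h e) e' \<otimes>\<^bsub>K\<^esub> \<kappa> (f e') e) \<in> B \<rightarrow> carrier K"
    using cl by (auto intro!: K.finsum_closed)
  fix e assume e: "e \<in> B"
  have hc: "\<kappa> (h e) e' \<in> carrier K" if "e' \<in> B" for e'
    by (intro coord_closed hM BM e that)
  have sc: "scal M (\<kappa> (h e) e') e' \<in> carrier M" if "e' \<in> B" for e'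
    by (intro scal_closed[OF M] hc BM that)
  have "f (h e) = f (\<Oplus>\<^bsub>M\<^esub>e'\<in>B. scal M (\<kappa> (h e) e') e')"
    using coord_expand[OF hM[OF BM[OF e]]] by (rule arg_cong)
  also have "\<dots> = (\<Oplus>\<^bsub>M\<^esub>e'\<in>B. f (scal M (\<kappa> (h e) e') e'))"
    by (rule klin_finsum[OF M M f B(1) sc])
  finally have "\<kappa> (f (h e)) e = (\<Oplus>\<^bsub>K\<^esub>e'\<in>B. \<kappa> (f (scal M (\<kappa> (h e) e') e')) e)"
    using coord_finsum[OF B(1) fM[OF sc] e] by simp
  also have "\<dots> = (\<Oplus>\<^bsub>K\<^esub>e'\<in>B. \<kappa> (h e) e' \<otimes>\<^bsub>K\<^esub> \<kappa> (f e') e)"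
  proof (rule K.add.finprod_cong'[OF refl])
    show "(\<lambda>e'. \<kappa> (h e) e' \<otimes>\<^bsub>K\<^esub> \<kappa> (f e') e) \<in> B \<rightarrow> carrier K" using cl[OF e] by blast
    fix e' assume e': "e' \<in> B"
    show "\<kappa> (f (scal M (\<kappa> (h e) e') e')) e = \<kappa> (h e) e' \<otimes>\<^bsub>K\<^esub> \<kappa> (f e') e"
      unfolding klinD(3)[OF f hc[OF e'] BM[OF e']]
      by (rule coord_scal[OF hc[OF e'] fM[OF BM[OF e']] e])
  qed
  finally show "\<kappa> (f (h e)) e = (\<Oplus>\<^bsub>K\<^esub>e'\<in>B. \<kappa> (h e) e' \<otimes>\<^bsub>K\<^esub> \<kappa> (f e') e)" .
qed

text \<open>Needed for invariance of the trace under conjugation by a group element, which turns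
  equivariant cochains with values in endomorphisms into invariant ones with values in
  \<open>K\<close>.\<close>

lemma tr_comm:
  assumes f: "klin M M f" and h: "klin M M h"
  shows "tr (\<lambda>x. f (h x)) = tr (\<lambda>x. h (f x))"
proof -
  note fM = klinD(1)[OF f] and hM = klinD(1)[OF h]
  have cl: "\<kappa> (h e) e' \<in> carrier K" "\<kappa> (f e) e' \<in> carrier K" if "e \<in> B" "e' \<in> B" for e e'
    by (rule coord_closed[OF hM[OF BM[OF that(1)]] that(2)] coord_closed[OF fM[OF BM[OF that(1)]] that(2)])+
  have "tr (\<lambda>x. f (h x)) = (\<Oplus>\<^bsub>K\<^esub>e\<in>B. \<Oplus>\<^bsub>K\<^esub>e'\<in>B. \<kappa> (h e) e' \<otimes>\<^bsub>K\<^esub> \<kappa> (f e') e)"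
    by (rule tr_comp_eq[OF f h])
  also have "\<dots> = (\<Oplus>\<^bsub>K\<^esub>e'\<in>B. \<Oplus>\<^bsub>K\<^esub>e\<in>B. \<kappa> (h e) e' \<otimes>\<^bsub>K\<^esub> \<kappa> (f e') e)"
    using cl B(1) by (intro K.finsum_finsum_swap) auto
  also have "\<dots> = (\<Oplus>\<^bsub>K\<^esub>e'\<in>B. \<Oplus>\<^bsub>K\<^esub>e\<in>B. \<kappa> (f e') e \<otimes>\<^bsub>K\<^esub> \<kappa> (h e) e')"
    using cl by (intro K.add.finprod_cong' refl) (auto intro!: K.finsum_closed K.add.finprod_cong' K.m_comm)
  also have "\<dots> = tr (\<lambda>x. h (f x))" by (rule tr_comp_eq[OF h f, symmetric])
  finally show ?thesis .
qed

theorem trivial_exact_if_mexact: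
  assumes n: "[card B] \<cdot>\<^bsub>K\<^esub> \<one>\<^bsub>K\<^esub> \<noteq> \<zero>\<^bsub>K\<^esub>" and exact: "mexact M M l"
  shows "additive_character.exact_at G K (\<lambda>_. \<zero>\<^bsub>K\<^esub>) K l"
proof -
  interpret T: additive_character G K "\<lambda>_. \<zero>\<^bsub>K\<^esub>" by unfold_locales simp_all
  note T.char_closed [simp del] T.char_one [simp del]
  have T_index: "(x, \<sigma>) \<in> T.index n \<longleftrightarrow> x = \<zero>\<^bsub>K\<^esub> \<and> \<sigma> \<in> tup n" for x \<sigma> n
    using G.one_closed unfolding T.index_def by blast
  have T_act: "T.act h (\<zero>\<^bsub>K\<^esub>, \<sigma>) = (\<zero>\<^bsub>K\<^esub>, map (\<lambda>g. g \<otimes>\<^bsub>G\<^esub> h) \<sigma>)" for h \<sigma>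
    by (simp add: T.act_def)
  let ?n = "[card B] \<cdot>\<^bsub>K\<^esub> \<one>\<^bsub>K\<^esub>"
  have nK: "?n \<in> carrier K" by simp
  have ninv: "inv\<^bsub>K\<^esub> ?n \<in> carrier K" "inv\<^bsub>K\<^esub> ?n \<otimes>\<^bsub>K\<^esub> ?n = \<one>\<^bsub>K\<^esub>"
    using n nK by (auto simp: K.field_Units)
  show ?thesis
    unfolding T.exact_at_def
  proof
    fix c0 assume c0: "c0 \<in> T.cocycles K (Suc l)"
    then have c0c: "c0 \<in> T.cochains K (Suc l)" and c0z: "T.cobd K (Suc l) c0 = (\<lambda>_. \<zero>\<^bsub>K\<^esub>)"
      by (auto simp: T.cocycles_def)
    define \<gamma> where "\<gamma> = (\<lambda>\<sigma>. c0 (\<zero>\<^bsub>K\<^esub>, \<sigma>))"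
    have \<gamma>K: "\<gamma> \<sigma> \<in> carrier K" for \<sigma> using T.cochainsD(1)[OF c0c] by (simp add: \<gamma>_def)
    have \<gamma>_eqv: "\<gamma> (map (\<lambda>g. g \<otimes>\<^bsub>G\<^esub> h) \<sigma>) = \<gamma> \<sigma>" if "\<sigma> \<in> tup (Suc l)" "h \<in> carrier G" for \<sigma> h
      using T.cochainsD(3)[OF c0c, of "(\<zero>\<^bsub>K\<^esub>, \<sigma>)" h] that by (simp add: \<gamma>_def T_index T_act)
    have \<gamma>_cocycle: "delta K \<gamma> \<sigma> = \<zero>\<^bsub>K\<^esub>" if "\<sigma> \<in> tup (Suc (Suc l))" for \<sigma>
      using fun_cong[OF c0z, of "(\<zero>\<^bsub>K\<^esub>, \<sigma>)"] that by (simp add: T.cobd_def T_index \<gamma>_def)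
    \<comment> \<open>Scalars commute with the group and with each other, so multiplying the
      identity by an invariant cochain gives an equivariant one.\<close>
    have "mcochain M M (Suc l) (\<lambda>x \<sigma>. scal M (\<gamma> \<sigma>) x)"
    proof (rule mcochainI)
      fix x \<sigma> assume x: "x \<in> carrier M" and \<sigma>: "\<sigma> \<in> tup (Suc l)"
      show "scal M (\<gamma> \<sigma>) x \<in> carrier M" by (rule scal_closed[OF M \<gamma>K x])
      show "scal M (\<gamma> \<sigma>) (x \<oplus>\<^bsub>M\<^esub> y) = scal M (\<gamma> \<sigma>) x \<oplus>\<^bsub>M\<^esub> scal M (\<gamma> \<sigma>) y" if "y \<in> carrier M" for y
        by (rule scal_add[OF M \<gamma>K x that])
      show "scal M (\<gamma> \<sigma>) (scal M a x) = scal M a (scal M (\<gamma> \<sigma>) x)" if a: "a \<in> carrier K" for a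
        unfolding scal_scal[OF M \<gamma>K a x] scal_scal[OF M a \<gamma>K x] K.m_comm[OF a \<gamma>K] ..
      show "scal M (\<gamma> (map (\<lambda>g. g \<otimes>\<^bsub>G\<^esub> h) \<sigma>)) (gact M h x) = gact M h (scal M (\<gamma> \<sigma>) x)" if h: "h \<in> carrier G" for h
        unfolding \<gamma>_eqv[OF \<sigma> h] by (rule gact_scal[OF M \<gamma>K h x, symmetric])
    qed
    moreover have "delta M (\<lambda>\<sigma>. scal M (\<gamma> \<sigma>) x) \<sigma> = \<zero>\<^bsub>M\<^esub>" if x: "x \<in> carrier M" and \<sigma>: "\<sigma> \<in> tup (Suc (Suc l))" for x \<sigma>
    proof -
      have "delta M (\<lambda>\<sigma>. scal M (\<gamma> \<sigma>) x) \<sigma> = scal M (delta K \<gamma> \<sigma>) x"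
        using scal_closed[OF M _ x] scal_add_left[OF M _ _ x]
        by (intro K.delta_hom[OF M.M.abelian_group_axioms _ _ \<sigma> \<gamma>K, symmetric]) auto
      then show ?thesis using \<gamma>_cocycle[OF \<sigma>] scal_zero_left[OF M x] by simp
    qed
    ultimately obtain b where b: "mcochain M M l b"
      and bc: "\<And>x \<sigma>. x \<in> carrier M \<Longrightarrow> \<sigma> \<in> tup (Suc l) \<Longrightarrow> scal M (\<gamma> \<sigma>) x = delta M (b x) \<sigma>"
      using exact[unfolded mexact_def, rule_format, of "\<lambda>x \<sigma>. scal M (\<gamma> \<sigma>) x"] by blast
    note Bd = mcochainD[OF b]
    define t where "t = (\<lambda>\<sigma>. tr (\<lambda>x. b x \<sigma>))"
    have tK: "t \<sigma> \<in> carrier K" if "\<sigma> \<in> tup l" for \<sigma>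
      unfolding t_def by (rule tr_closed[OF Bd(5)[OF that]])
    have t_eqv: "t (map (\<lambda>g. g \<otimes>\<^bsub>G\<^esub> h) \<sigma>) = t \<sigma>" if \<sigma>: "\<sigma> \<in> tup l" and h: "h \<in> carrier G" for \<sigma> h
    proof -
      have ih: "inv\<^bsub>G\<^esub> h \<in> carrier G" using h by simp
      have kg: "klin M M (gact M g)" if "g \<in> carrier G" for g
        using that by (intro klinI) (simp_all add: gact_closed[OF M] gact_add[OF M] gact_scal[OF M])
      have kb: "klin M M (\<lambda>x. b (gact M (inv\<^bsub>G\<^esub> h) x) \<sigma>)"
        by (rule klin_comp[OF kg[OF ih] Bd(5)[OF \<sigma>]])
      have "t (map (\<lambda>g. g \<otimes>\<^bsub>G\<^esub> h) \<sigma>) = tr (\<lambda>x. gact M h (b (gact M (inv\<^bsub>G\<^esub> h) x) \<sigma>))"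
        unfolding t_def
      proof (rule tr_cong[OF _ klin_comp[OF kb kg[OF h]]])
        fix x assume x: "x \<in> carrier M"
        show "b x (map (\<lambda>g. g \<otimes>\<^bsub>G\<^esub> h) \<sigma>) = gact M h (b (gact M (inv\<^bsub>G\<^esub> h) x) \<sigma>)"
          using Bd(4)[OF gact_closed[OF M x] \<sigma> h, of "inv\<^bsub>G\<^esub> h"] gact_inv(1)[OF M h x] by simp
      qed
      also have "\<dots> = tr (\<lambda>x. b (gact M (inv\<^bsub>G\<^esub> h) (gact M h x)) \<sigma>)"
        by (rule tr_comm[OF kg[OF h] kb])
      also have "\<dots> = t \<sigma>"
        unfolding t_def by (rule tr_cong[OF _ Bd(5)[OF \<sigma>]]) (simp add: gact_inv(2)[OF M h])
      finally show ?thesis .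
    qed
    \<comment> \<open>Diagonal coordinates are additive, so the trace commutes with the coboundary;
      the trace of the scalar \<open>\<gamma> \<sigma>\<close> is the dimension times it.\<close>
    have t_delta: "delta K t \<sigma> = ?n \<otimes>\<^bsub>K\<^esub> \<gamma> \<sigma>" if \<sigma>: "\<sigma> \<in> tup (Suc l)" for \<sigma>
    proof -
      have cl: "\<kappa> (b e \<tau>) e \<in> carrier K" if "e \<in> B" "\<tau> \<in> tup l" for e \<tau>
        using that by (intro coord_closed Bd(1) BM)
      have "delta K t \<sigma> = (\<Oplus>\<^bsub>K\<^esub>e\<in>B. delta K (\<lambda>\<tau>. \<kappa> (b e \<tau>) e) \<sigma>)"
        unfolding t_def tr_def by (rule K.delta_finsum[OF B(1) \<sigma> cl])
      also have "\<dots> = (\<Oplus>\<^bsub>K\<^esub>e\<in>B. \<gamma> \<sigma>)"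
      proof (rule K.add.finprod_cong'[OF refl])
        show "(\<lambda>e. \<gamma> \<sigma>) \<in> B \<rightarrow> carrier K" using \<gamma>K by blast
        fix e assume e: "e \<in> B"
        have "delta K (\<lambda>\<tau>. \<kappa> (b e \<tau>) e) \<sigma> = \<kappa> (delta M (b e) \<sigma>) e"
          using coord_closed[OF _ e] coord_add[OF _ _ e] Bd(1)[OF BM[OF e]]
          by (intro M.M.delta_hom[OF K.abelian_group_axioms _ _ \<sigma>, symmetric, of "\<lambda>x. \<kappa> x e"]) auto
        also have "delta M (b e) \<sigma> = scal M (\<gamma> \<sigma>) e" by (rule bc[OF BM[OF e] \<sigma>, symmetric])
        also have "\<kappa> (scal M (\<gamma> \<sigma>) e) e = \<gamma> \<sigma>"
          using coord_scal[OF \<gamma>K BM[OF e] e] coord_basis[OF e] \<gamma>K by simp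
        finally show "delta K (\<lambda>\<tau>. \<kappa> (b e \<tau>) e) \<sigma> = \<gamma> \<sigma>" .
      qed
      also have "\<dots> = [card B] \<cdot>\<^bsub>K\<^esub> \<gamma> \<sigma>" by (rule K.add.finprod_const[OF \<gamma>K])
      also have "\<dots> = ?n \<otimes>\<^bsub>K\<^esub> \<gamma> \<sigma>"
        using K.add_pow_ldistr[of "\<one>\<^bsub>K\<^esub>" "\<gamma> \<sigma>" "card B"] \<gamma>K by simp
      finally show ?thesis .
    qed
    define s where "s = (\<lambda>(x, \<sigma>). if (x, \<sigma>) \<in> T.index l then inv\<^bsub>K\<^esub> ?n \<otimes>\<^bsub>K\<^esub> t \<sigma> else \<zero>\<^bsub>K\<^esub>)"
    have "s (T.act h i) = s i" if i: "i \<in> T.index l" and h: "h \<in> carrier G" for i h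
    proof -
      obtain \<sigma> where \<sigma>: "i = (\<zero>\<^bsub>K\<^esub>, \<sigma>)" "\<sigma> \<in> tup l" using i T_index by (cases i) auto
      then show ?thesis
        using t_eqv[OF \<sigma>(2) h] tup_translate[OF \<sigma>(2) h] by (simp add: s_def T_act T_index)
    qed
    moreover have "s i \<in> carrier K" for i
      using ninv tK by (cases i) (simp add: s_def T_index)
    ultimately have sc: "s \<in> T.cochains K l"
      unfolding T.cochains_def mem_Collect_eq by (auto simp: s_def)
    have "c0 (x, \<sigma>) = T.cobd K l s (x, \<sigma>)" for x \<sigma>
    proof (cases "(x, \<sigma>) \<in> T.index (Suc l)")
      case True
      then have x: "x = \<zero>\<^bsub>K\<^esub>" and \<sigma>: "\<sigma> \<in> tup (Suc l)" by (auto simp: T_index)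
      have "T.cobd K l s (x, \<sigma>) = delta K (\<lambda>\<tau>. s (\<zero>\<^bsub>K\<^esub>, \<tau>)) \<sigma>"
        using True x by (simp add: T.cobd_def)
      also have "\<dots> = delta K (\<lambda>\<tau>. inv\<^bsub>K\<^esub> ?n \<otimes>\<^bsub>K\<^esub> t \<tau>) \<sigma>"
        by (rule delta_cong[OF \<sigma>]) (simp add: s_def T_index)
      also have "\<dots> = inv\<^bsub>K\<^esub> ?n \<otimes>\<^bsub>K\<^esub> delta K t \<sigma>"
        using ninv by (intro K.delta_hom[OF K.abelian_group_axioms _ _ \<sigma> tK, symmetric]) (auto simp: K.r_distr)
      also have "\<dots> = \<gamma> \<sigma>"
        unfolding t_delta[OF \<sigma>] using ninv \<gamma>K nK by (simp add: K.m_assoc[symmetric])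
      finally show ?thesis by (simp add: \<gamma>_def x)
    next
      case False
      then show ?thesis using T.cochainsD(2)[OF c0c False] by (simp add: T.cobd_def)
    qed
    then show "c0 \<in> T.cobd K l ` T.cochains K l"
      using sc by (intro image_eqI[of _ _ s]) auto
  qed
qed

end

lemma finite_basis_coordinates:
  fixes M :: "('g \<Rightarrow> 'k, 'm) module"
  assumes M: "right_module KG M" and fd: "vectorspace.fin_dim K (underlying_space K G M)"
  obtains B \<kappa> where "finite B" "B \<subseteq> carrier M" "card B = vectorspace.dim K (underlying_space K G M)"
    "\<And>x e. x \<in> carrier M \<Longrightarrow> e \<in> B \<Longrightarrow> \<kappa> x e \<in> carrier K"
    "\<And>x y e. x \<in> carrier M \<Longrightarrow> y \<in> carrier M \<Longrightarrow> e \<in> B \<Longrightarrow> \<kappa> (x \<oplus>\<^bsub>M\<^esub> y) e = \<kappa> x e \<oplus>\<^bsub>K\<^esub> \<kappa> y e"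
    "\<And>c x e. c \<in> carrier K \<Longrightarrow> x \<in> carrier M \<Longrightarrow> e \<in> B \<Longrightarrow> \<kappa> (scal M c x) e = c \<otimes>\<^bsub>K\<^esub> \<kappa> x e"
    "\<And>e. e \<in> B \<Longrightarrow> \<kappa> e e = \<one>\<^bsub>K\<^esub>"
    "\<And>x. x \<in> carrier M \<Longrightarrow> x = (\<Oplus>\<^bsub>M\<^esub>e\<in>B. scal M (\<kappa> x e) e)"
proof -
  let ?V = "underlying_space K G M"
  interpret M: right_module KG M by (rule M)
  interpret V: vectorspace K ?V
    by (rule vectorspace_underlying_space[OF G.group_axioms finite_G K.field_axioms M])
  have V [simp]: "carrier ?V = carrier M" "zero ?V = zero M" "add ?V = add M" "smult ?V c x = scal M c x" for c x
    by (simp_all add: underlying_space_def scal_def)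
  obtain B where B: "finite B" "V.basis B" using V.finite_basis_exists fd by blast
  then have BM: "B \<subseteq> carrier M" by (auto simp: V.basis_def)
  \<comment> \<open>Finite sums in the underlying space and in \<open>M\<close> belong to different
    records; induction over the index set identifies them.\<close>
  have lc: "V.lincomb a B = (\<Oplus>\<^bsub>M\<^esub>e\<in>B. scal M (a e) e)" if a: "\<And>e. e \<in> B \<Longrightarrow> a e \<in> carrier K" for a
  proof -
    have "(\<Oplus>\<^bsub>?V\<^esub>e\<in>I. scal M (a e) e) = (\<Oplus>\<^bsub>M\<^esub>e\<in>I. scal M (a e) e)" if "finite I" "I \<subseteq> B" for I
      using that
    proof (induction I)
      case (insert i I)
      then have cl: "(\<lambda>e. scal M (a e) e) \<in> I \<rightarrow> carrier M" "scal M (a i) i \<in> carrier M"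
        using a BM by (auto intro!: scal_closed[OF M])
      have "(\<Oplus>\<^bsub>?V\<^esub>e\<in>insert i I. scal M (a e) e) = scal M (a i) i \<oplus>\<^bsub>M\<^esub> (\<Oplus>\<^bsub>?V\<^esub>e\<in>I. scal M (a e) e)"
        using V.M.finsum_insert[OF insert.hyps, of "\<lambda>e. scal M (a e) e"] cl by simp
      also have "\<dots> = (\<Oplus>\<^bsub>M\<^esub>e\<in>insert i I. scal M (a e) e)"
        using M.M.finsum_insert[OF insert.hyps cl] insert by simp
      finally show ?case .
    qed simp
    then show ?thesis using B(1) by (simp add: V.lincomb_def)
  qed
  have ex1: "\<exists>!a. a \<in> B \<rightarrow>\<^sub>E carrier K \<and> V.lincomb a B = x" if "x \<in> carrier M" for x
    using V.basis_criterion[OF B(1)] B(2) BM that by simp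
  define \<kappa> where "\<kappa> x = (THE a. a \<in> B \<rightarrow>\<^sub>E carrier K \<and> V.lincomb a B = x)" for x
  have \<kappa>: "\<kappa> x \<in> B \<rightarrow>\<^sub>E carrier K" "V.lincomb (\<kappa> x) B = x" if "x \<in> carrier M" for x
    using theI'[OF ex1[OF that]] by (simp_all add: \<kappa>_def)
  have \<kappa>K: "\<kappa> x e \<in> carrier K" if "x \<in> carrier M" "e \<in> B" for x e
    using \<kappa>(1)[OF that(1)] that(2) by auto
  have \<kappa>_sum: "x = (\<Oplus>\<^bsub>M\<^esub>e\<in>B. scal M (\<kappa> x e) e)" if "x \<in> carrier M" for x
    using \<kappa>(2)[OF that] lc[OF \<kappa>K[OF that]] by simp
  have scB: "scal M c e \<in> carrier M" if "c \<in> carrier K" "e \<in> B" for c e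
    using that BM by (intro scal_closed[OF M]) auto
  \<comment> \<open>Coordinates are recognised from any expansion, so additivity, homogeneity and
    the diagonal values each reduce to exhibiting one.\<close>
  have \<kappa>_eq: "\<kappa> x e = a e"
    if x: "x \<in> carrier M" and a: "\<And>e. e \<in> B \<Longrightarrow> a e \<in> carrier K"
      and eq: "x = (\<Oplus>\<^bsub>M\<^esub>e\<in>B. scal M (a e) e)" and e: "e \<in> B" for x a e
  proof -
    have "(\<Oplus>\<^bsub>M\<^esub>e\<in>B. scal M (restrict a B e) e) = (\<Oplus>\<^bsub>M\<^esub>e\<in>B. scal M (a e) e)"
      using scB a by (intro M.M.add.finprod_cong' refl) auto
    then have "V.lincomb (restrict a B) B = x"
      using lc[of "restrict a B"] a eq by simp
    moreover have "restrict a B \<in> B \<rightarrow>\<^sub>E carrier K" using a by auto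
    ultimately have "\<kappa> x = restrict a B" using ex1[OF x] \<kappa>[OF x] by blast
    then show ?thesis using e by simp
  qed
  show ?thesis
  proof (rule that[OF B(1) BM])
    show "card B = V.dim" using V.dim_basis[OF B] by simp
    show "\<kappa> x e \<in> carrier K" if "x \<in> carrier M" "e \<in> B" for x e by (rule \<kappa>K[OF that])
    show "x = (\<Oplus>\<^bsub>M\<^esub>e\<in>B. scal M (\<kappa> x e) e)" if "x \<in> carrier M" for x by (rule \<kappa>_sum[OF that])
    show "\<kappa> (x \<oplus>\<^bsub>M\<^esub> y) e = \<kappa> x e \<oplus>\<^bsub>K\<^esub> \<kappa> y e"
      if x: "x \<in> carrier M" and y: "y \<in> carrier M" and e: "e \<in> B" for x y e
    proof (rule \<kappa>_eq[OF M.M.a_closed[OF x y] _ _ e])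
      have "(\<Oplus>\<^bsub>M\<^esub>e\<in>B. scal M (\<kappa> x e \<oplus>\<^bsub>K\<^esub> \<kappa> y e) e) =
          (\<Oplus>\<^bsub>M\<^esub>e\<in>B. scal M (\<kappa> x e) e \<oplus>\<^bsub>M\<^esub> scal M (\<kappa> y e) e)"
        using \<kappa>K[OF x] \<kappa>K[OF y] BM scB
        by (intro M.M.add.finprod_cong' refl) (auto intro!: scal_add_left[OF M] simp: subset_iff)
      also have "\<dots> = (\<Oplus>\<^bsub>M\<^esub>e\<in>B. scal M (\<kappa> x e) e) \<oplus>\<^bsub>M\<^esub> (\<Oplus>\<^bsub>M\<^esub>e\<in>B. scal M (\<kappa> y e) e)"
        using \<kappa>K[OF x] \<kappa>K[OF y] scB by (intro M.M.finsum_addf) auto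
      finally show "x \<oplus>\<^bsub>M\<^esub> y = (\<Oplus>\<^bsub>M\<^esub>e\<in>B. scal M (\<kappa> x e \<oplus>\<^bsub>K\<^esub> \<kappa> y e) e)"
        using \<kappa>_sum[OF x] \<kappa>_sum[OF y] by simp
    qed (use \<kappa>K x y in blast)
    show "\<kappa> (scal M c x) e = c \<otimes>\<^bsub>K\<^esub> \<kappa> x e"
      if c: "c \<in> carrier K" and x: "x \<in> carrier M" and e: "e \<in> B" for c x e
    proof (rule \<kappa>_eq[OF scal_closed[OF M c x] _ _ e])
      have kl: "klin M M (scal M c)"
        using c by (intro klinI) (simp_all add: scal_closed[OF M] scal_add[OF M] scal_scal[OF M] K.m_comm)
      have "scal M c x = scal M c (\<Oplus>\<^bsub>M\<^esub>e\<in>B. scal M (\<kappa> x e) e)"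
        using \<kappa>_sum[OF x] by (rule arg_cong)
      also have "\<dots> = (\<Oplus>\<^bsub>M\<^esub>e\<in>B. scal M c (scal M (\<kappa> x e) e))"
        by (rule klin_finsum[OF M M kl B(1) scB[OF \<kappa>K[OF x]]])
      also have "\<dots> = (\<Oplus>\<^bsub>M\<^esub>e\<in>B. scal M (c \<otimes>\<^bsub>K\<^esub> \<kappa> x e) e)"
        using \<kappa>K[OF x] BM c scB
        by (intro M.M.add.finprod_cong' refl) (auto intro!: scal_scal[OF M] simp: subset_iff)
      finally show "scal M c x = (\<Oplus>\<^bsub>M\<^esub>e\<in>B. scal M (c \<otimes>\<^bsub>K\<^esub> \<kappa> x e) e)" .
    qed (use \<kappa>K x c in blast)
    show "\<kappa> e e = \<one>\<^bsub>K\<^esub>" if e: "e \<in> B" for e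
    proof -
      have eM: "e \<in> carrier M" using e BM by blast
      have "(\<Oplus>\<^bsub>M\<^esub>e'\<in>B. scal M (if e = e' then \<one>\<^bsub>K\<^esub> else \<zero>\<^bsub>K\<^esub>) e') =
          (\<Oplus>\<^bsub>M\<^esub>e'\<in>B. if e = e' then e' else \<zero>\<^bsub>M\<^esub>)"
        using BM by (intro M.M.add.finprod_cong' refl) (auto simp: scal_one[OF M] scal_zero_left[OF M] subset_iff)
      also have "\<dots> = e"
        using M.M.add.finprod_singleton[OF e B(1), of "\<lambda>x. x"] BM by auto
      finally have "\<kappa> e e = (if e = e then \<one>\<^bsub>K\<^esub> else \<zero>\<^bsub>K\<^esub>)"
        by (intro \<kappa>_eq[OF eM _ _ e]) auto
      then show ?thesis by simp
    qed
  qed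
qed

lemma trivial_module_minus [simp]: "x \<ominus>\<^bsub>trivial_module K G\<^esub> y = x \<ominus>\<^bsub>K\<^esub> y"
  by (simp add: a_minus_def a_inv_def m_inv_def)

text \<open>A cocycle \<open>f\<close> factors through the kernel \<open>W\<close> of the
  augmentation and extends linearly to \<open>b\<close> on \<open>P 0\<close>. The defect of
  invariance of \<open>b\<close> vanishes on \<open>W\<close>, so it is \<open>\<epsilon> x\<close>
  times a function \<open>\<phi>\<close> of the group element, and \<open>\<phi>\<close> is an
  additive character. If it is zero, then \<open>b\<close> is a homomorphism and bounds
  \<open>f\<close>.\<close>

lemma Ext_1_trivial_zero:
  assumes no_char: "\<And>\<phi> g. additive_character G K \<phi> \<Longrightarrow> g \<in> carrier G \<Longrightarrow> \<phi> g = \<zero>\<^bsub>K\<^esub>"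
  shows "\<not> Ext_nonzero KG (trivial_module K G) (trivial_module K G) (Suc 0)"
proof (rule not_Ext_nonzeroI[OF right_module_trivial right_module_trivial])
  let ?T = "trivial_module K G"
  fix P :: "nat \<Rightarrow> ('g \<Rightarrow> 'k, ('k, 'g \<Rightarrow> 'k) syz \<Rightarrow> 'g \<Rightarrow> 'k) module" and d \<epsilon> f
  assume res: "projective_resolution KG ?T P d \<epsilon>"
    and f: "f \<in> LinearCombinations.module_hom KG (P (Suc 0)) ?T"
    and f_cocycle: "\<And>x. x \<in> carrier (P (Suc (Suc 0))) \<Longrightarrow> f (d (Suc 0) x) = \<zero>\<^bsub>?T\<^esub>"
  have P: "right_module KG (P n)" and d: "d n \<in> LinearCombinations.module_hom KG (P (Suc n)) (P n)" for n
    using res by (auto simp: projective_resolution_def projective_module_def)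
  have \<epsilon>: "\<epsilon> \<in> LinearCombinations.module_hom KG (P 0) ?T"
    and \<epsilon>_surj: "\<epsilon> ` carrier (P 0) = carrier K"
    and ker_\<epsilon>: "d 0 ` carrier (P (Suc 0)) = {x \<in> carrier (P 0). \<epsilon> x = \<zero>\<^bsub>K\<^esub>}"
    and ker_d: "d (Suc 0) ` carrier (P (Suc (Suc 0))) = {x \<in> carrier (P (Suc 0)). d 0 x = \<zero>\<^bsub>P 0\<^esub>}"
    using res unfolding projective_resolution_def by simp_all
  note T = right_module_trivial
  interpret P0: right_module KG "P 0" by (rule P)
  interpret P1: right_module KG "P (Suc 0)" by (rule P)
  note \<epsilon>_lin = klin_of_hom(1)[OF \<epsilon>] and f_lin = klin_of_hom(1)[OF f] and d_lin = klin_of_hom(1)[OF d[of 0]]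
  have \<epsilon>K: "\<epsilon> x \<in> carrier K" if "x \<in> carrier (P 0)" for x
    using klinD(1)[OF \<epsilon>_lin that] by simp
  have fK: "f x \<in> carrier K" if "x \<in> carrier (P (Suc 0))" for x
    using klinD(1)[OF f_lin that] by simp
  define W where "W = {x \<in> carrier (P 0). \<epsilon> x = \<zero>\<^bsub>K\<^esub>}"
  have W: "linear_subspace (P 0) W"
    using klinD[OF \<epsilon>_lin] klin_zero[OF P T \<epsilon>_lin] scal_closed[OF P]
    by (auto simp: W_def linear_subspace_def scal_trivial)
  have dW: "d 0 x \<in> W" if "x \<in> carrier (P (Suc 0))" for x
    using ker_\<epsilon> that unfolding W_def by blast
  have f_well: "f x = f y" if x: "x \<in> carrier (P (Suc 0))" and y: "y \<in> carrier (P (Suc 0))" and eq: "d 0 x = d 0 y" for x y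
  proof -
    have "d 0 (x \<ominus>\<^bsub>P (Suc 0)\<^esub> y) = \<zero>\<^bsub>P 0\<^esub>"
      using klin_diff[OF P P d_lin x y] eq klinD(1)[OF d_lin y] by (simp add: P0.M.minus_eq P0.M.r_neg)
    then have "x \<ominus>\<^bsub>P (Suc 0)\<^esub> y \<in> d (Suc 0) ` carrier (P (Suc (Suc 0)))"
      unfolding ker_d using x y by simp
    then have "f (x \<ominus>\<^bsub>P (Suc 0)\<^esub> y) = \<zero>\<^bsub>K\<^esub>" using f_cocycle by auto
    then show ?thesis
      using klin_diff[OF P T f_lin x y] K.minus_equality[of "f x" "\<ominus>\<^bsub>K\<^esub> f y"] fK[OF x] fK[OF y]
      by (simp add: K.minus_eq)
  qed
  \<comment> \<open>The map induced by \<open>f\<close> on the image of \<open>d 0\<close>;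
    \<open>f_well\<close> makes the choice of preimage irrelevant.\<close>
  define \<rho> where "\<rho> w = f (inv_into (carrier (P (Suc 0))) (d 0) w)" for w
  have \<rho>_d: "\<rho> (d 0 x) = f x" if x: "x \<in> carrier (P (Suc 0))" for x
    unfolding \<rho>_def
    by (rule f_well[OF inv_into_into[OF imageI[OF x]] x f_inv_into_f[OF imageI[OF x]]])
  have W_d: "\<exists>x\<in>carrier (P (Suc 0)). w = d 0 x" if "w \<in> W" for w
    using that ker_\<epsilon> unfolding W_def by blast
  obtain \<pi> where \<pi>: "klin (P 0) (P 0) \<pi>" "\<And>x. x \<in> carrier (P 0) \<Longrightarrow> \<pi> x \<in> W" "\<And>w. w \<in> W \<Longrightarrow> \<pi> w = w"
    using linear_retraction[OF P W] by blast
  define b where "b x = \<rho> (\<pi> x)" for x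
  have b_lin: "klin (P 0) ?T b"
  proof (rule klinI)
    fix x assume x: "x \<in> carrier (P 0)"
    then obtain u where u: "u \<in> carrier (P (Suc 0))" "\<pi> x = d 0 u" using \<pi>(2) W_d by blast
    show "b x \<in> carrier ?T" using u \<rho>_d fK by (simp add: b_def)
    show "b (x \<oplus>\<^bsub>P 0\<^esub> y) = b x \<oplus>\<^bsub>?T\<^esub> b y" if y: "y \<in> carrier (P 0)" for y
    proof -
      obtain v where v: "v \<in> carrier (P (Suc 0))" "\<pi> y = d 0 v" using \<pi>(2) W_d y by blast
      have "b (x \<oplus>\<^bsub>P 0\<^esub> y) = \<rho> (d 0 (u \<oplus>\<^bsub>P (Suc 0)\<^esub> v))"
        using klinD(2)[OF \<pi>(1) x y] klinD(2)[OF d_lin u(1) v(1)] u v by (simp add: b_def)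
      also have "\<dots> = f u \<oplus>\<^bsub>?T\<^esub> f v"
        using \<rho>_d[OF P1.M.a_closed[OF u(1) v(1)]] klinD(2)[OF f_lin u(1) v(1)] by simp
      finally show ?thesis using u v \<rho>_d by (simp add: b_def)
    qed
    show "b (scal (P 0) c x) = scal ?T c (b x)" if c: "c \<in> carrier K" for c
    proof -
      have "b (scal (P 0) c x) = \<rho> (d 0 (scal (P (Suc 0)) c u))"
        using klinD(3)[OF \<pi>(1) c x] klinD(3)[OF d_lin c u(1)] u by (simp add: b_def)
      also have "\<dots> = scal ?T c (f u)"
        using \<rho>_d[OF scal_closed[OF P c u(1)]] klinD(3)[OF f_lin c u(1)] by simp
      finally show ?thesis using u \<rho>_d by (simp add: b_def)
    qed
  qed
  have bK: "b x \<in> carrier K" if "x \<in> carrier (P 0)" for x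
    using klinD(1)[OF b_lin that] by simp
  have b_d: "b (d 0 x) = f x" if "x \<in> carrier (P (Suc 0))" for x
    using \<pi>(3)[OF dW[OF that]] \<rho>_d[OF that] by (simp add: b_def)
  have b_W: "b (gact (P 0) g w) = b w" if w: "w \<in> W" and g: "g \<in> carrier G" for w g
  proof -
    obtain u where u: "u \<in> carrier (P (Suc 0))" "w = d 0 u" using W_d w by blast
    have "b (gact (P 0) g w) = b (d 0 (gact (P (Suc 0)) g u))"
      using klin_of_hom(2)[OF d u(1)] u(2) by simp
    also have "\<dots> = f u"
      using b_d[OF gact_closed[OF P u(1)]] klin_of_hom(2)[OF f u(1)] gact_trivial[OF g fK[OF u(1)]] by simp
    finally show ?thesis using b_d[OF u(1)] u(2) by simp
  qed
  obtain x1 where x1: "x1 \<in> carrier (P 0)" "\<epsilon> x1 = \<one>\<^bsub>K\<^esub>"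
    using \<epsilon>_surj K.one_closed by (metis imageE)
  \<comment> \<open>The defect, measured on a vector of augmentation one.\<close>
  define \<phi> where "\<phi> g = b (gact (P 0) g x1) \<ominus>\<^bsub>K\<^esub> b x1" for g
  have gx: "gact (P 0) g x \<in> carrier (P 0)" if "x \<in> carrier (P 0)" for g x
    by (rule gact_closed[OF P that])
  have b_gact: "b (gact (P 0) g x) = b x \<oplus>\<^bsub>K\<^esub> \<epsilon> x \<otimes>\<^bsub>K\<^esub> \<phi> g" if g: "g \<in> carrier G" and x: "x \<in> carrier (P 0)" for g x
  proof -
    \<comment> \<open>Split \<open>x\<close> into a multiple of \<open>x1\<close> with the same
      augmentation and a remainder in \<open>W\<close>; \<open>b_W\<close> shows that only the
      multiple contributes to the defect.\<close>
    let ?s = "scal (P 0) (\<epsilon> x) x1" and ?w = "x \<ominus>\<^bsub>P 0\<^esub> scal (P 0) (\<epsilon> x) x1"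
    have s: "?s \<in> carrier (P 0)" by (rule scal_closed[OF P \<epsilon>K[OF x] x1(1)])
    have w: "?w \<in> carrier (P 0)" using x s by simp
    have "\<epsilon> ?w = \<epsilon> x \<ominus>\<^bsub>?T\<^esub> \<epsilon> ?s" by (rule klin_diff[OF P T \<epsilon>_lin x s])
    also have "\<epsilon> ?s = \<epsilon> x"
      using klinD(3)[OF \<epsilon>_lin \<epsilon>K[OF x] x1(1)] \<epsilon>K[OF x] x1(2) by (simp add: scal_trivial)
    also have "\<epsilon> x \<ominus>\<^bsub>?T\<^esub> \<epsilon> x = \<zero>\<^bsub>K\<^esub>"
      using \<epsilon>K[OF x] by (simp add: K.minus_eq K.r_neg)
    finally have wW: "?w \<in> W" using w by (simp add: W_def)
    have dec: "x = ?w \<oplus>\<^bsub>P 0\<^esub> ?s"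
      using x s by (simp add: a_minus_def P0.M.a_assoc P0.M.l_neg)
    have c: "b x1 \<in> carrier K" "b (gact (P 0) g x1) \<in> carrier K" "b ?w \<in> carrier K" "\<epsilon> x \<in> carrier K"
      using bK gx x1(1) w \<epsilon>K x by blast+
    have bx: "b x = b ?w \<oplus>\<^bsub>K\<^esub> b x1 \<otimes>\<^bsub>K\<^esub> \<epsilon> x"
      using klinD(2)[OF b_lin w s] dec klinD(3)[OF b_lin \<epsilon>K[OF x] x1(1)] \<epsilon>K[OF x] by (simp add: scal_trivial)
    have "b (gact (P 0) g x) = b (gact (P 0) g ?w \<oplus>\<^bsub>P 0\<^esub> scal (P 0) (\<epsilon> x) (gact (P 0) g x1))"
      using gact_add[OF P w s, of g] gact_scal[OF P \<epsilon>K[OF x] g x1(1)] dec by simp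
    also have "\<dots> = b ?w \<oplus>\<^bsub>K\<^esub> b (gact (P 0) g x1) \<otimes>\<^bsub>K\<^esub> \<epsilon> x"
      using klinD(2)[OF b_lin gx[OF w] scal_closed[OF P \<epsilon>K[OF x] gx[OF x1(1)]]]
        klinD(3)[OF b_lin \<epsilon>K[OF x] gx[OF x1(1)]] b_W[OF wW g] \<epsilon>K[OF x] by (simp add: scal_trivial)
    also have "\<dots> = b ?w \<oplus>\<^bsub>K\<^esub> b x1 \<otimes>\<^bsub>K\<^esub> \<epsilon> x \<oplus>\<^bsub>K\<^esub> \<epsilon> x \<otimes>\<^bsub>K\<^esub> (b (gact (P 0) g x1) \<ominus>\<^bsub>K\<^esub> b x1)"
      using c by algebra
    finally show ?thesis unfolding bx \<phi>_def .
  qed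
  have \<phi>K: "\<phi> g \<in> carrier K" for g
    unfolding \<phi>_def using bK gx x1(1) by (intro K.minus_closed) auto
  have \<phi>_gact: "b (gact (P 0) g x1) = b x1 \<oplus>\<^bsub>K\<^esub> \<phi> g" if "g \<in> carrier G" for g
    using b_gact[OF that x1(1)] x1(2) \<phi>K by simp
  have "additive_character G K \<phi>"
  proof (intro additive_character.intro additive_character_axioms.intro)
    fix g h assume g: "g \<in> carrier G" and h: "h \<in> carrier G"
    have \<epsilon>g: "\<epsilon> (gact (P 0) g x1) = \<one>\<^bsub>K\<^esub>"
      using klin_of_hom(2)[OF \<epsilon> x1(1), of g] x1(2) gact_trivial[OF g K.one_closed] by simp
    \<comment> \<open>The action preserves augmentation one, so acting by \<open>g\<close> and then
      by \<open>h\<close> adds the two defects.\<close>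
    have "b x1 \<oplus>\<^bsub>K\<^esub> \<phi> (g \<otimes>\<^bsub>G\<^esub> h) = b (gact (P 0) h (gact (P 0) g x1))"
      using \<phi>_gact[OF G.m_closed[OF g h]] gact_gact[OF P g h x1(1)] by simp
    also have "\<dots> = b x1 \<oplus>\<^bsub>K\<^esub> \<phi> g \<oplus>\<^bsub>K\<^esub> \<phi> h"
      using b_gact[OF h gx[OF x1(1)], of g] \<epsilon>g \<phi>_gact[OF g] \<phi>K by simp
    finally have "b x1 \<oplus>\<^bsub>K\<^esub> \<phi> (g \<otimes>\<^bsub>G\<^esub> h) = b x1 \<oplus>\<^bsub>K\<^esub> (\<phi> g \<oplus>\<^bsub>K\<^esub> \<phi> h)"
      using bK[OF x1(1)] \<phi>K by (simp add: K.a_assoc)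
    then show "\<phi> (g \<otimes>\<^bsub>G\<^esub> h) = \<phi> g \<oplus>\<^bsub>K\<^esub> \<phi> h"
      using K.add.right_cancel[OF bK[OF x1(1)], of "\<phi> (g \<otimes>\<^bsub>G\<^esub> h)" "\<phi> g \<oplus>\<^bsub>K\<^esub> \<phi> h"] bK[OF x1(1)] \<phi>K
      by (simp add: K.a_comm[of "b x1"])
  qed (use \<phi>K G.group_axioms K.abelian_group_axioms in auto)
  then have \<phi>0: "\<phi> g = \<zero>\<^bsub>K\<^esub>" if "g \<in> carrier G" for g using no_char that by blast
  have "b \<in> LinearCombinations.module_hom KG (P 0) ?T"
  proof (rule hom_of_klin[OF P T b_lin])
    fix g x assume g: "g \<in> carrier G" and x: "x \<in> carrier (P 0)"
    show "b (gact (P 0) g x) = gact ?T g (b x)"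
      using b_gact[OF g x] \<phi>0[OF g] bK[OF x] \<epsilon>K[OF x] gact_trivial[OF g bK[OF x]] by simp
  qed
  then show "\<exists>h\<in>LinearCombinations.module_hom KG (P 0) ?T. \<forall>x\<in>carrier (P (Suc 0)). f x = h (d 0 x)"
    using b_d by (intro bexI[of _ b]) auto
qed

text \<open>The trace argument hands exactness over \<open>K\<close> to the counting argument. The
  latter leaves \<open>\<phi>\<close> a one-point image, although that image contains both zero and
  \<open>\<phi> g\<close>.\<close>

lemma Ext_nonzero_if_coordinates:
  fixes M :: "('g \<Rightarrow> 'k, 'm) module"
  assumes M: "right_module KG M" and B: "finite B" "B \<subseteq> carrier M"
    and coord: "\<And>x e. x \<in> carrier M \<Longrightarrow> e \<in> B \<Longrightarrow> \<kappa> x e \<in> carrier K"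
    "\<And>x y e. x \<in> carrier M \<Longrightarrow> y \<in> carrier M \<Longrightarrow> e \<in> B \<Longrightarrow> \<kappa> (x \<oplus>\<^bsub>M\<^esub> y) e = \<kappa> x e \<oplus>\<^bsub>K\<^esub> \<kappa> y e"
    "\<And>c x e. c \<in> carrier K \<Longrightarrow> x \<in> carrier M \<Longrightarrow> e \<in> B \<Longrightarrow> \<kappa> (scal M c x) e = c \<otimes>\<^bsub>K\<^esub> \<kappa> x e"
    "\<And>e. e \<in> B \<Longrightarrow> \<kappa> e e = \<one>\<^bsub>K\<^esub>"
    "\<And>x. x \<in> carrier M \<Longrightarrow> x = (\<Oplus>\<^bsub>M\<^esub>e\<in>B. scal M (\<kappa> x e) e)"
    and n: "[card B] \<cdot>\<^bsub>K\<^esub> \<one>\<^bsub>K\<^esub> \<noteq> \<zero>\<^bsub>K\<^esub>"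
    and \<phi>: "additive_character G K \<phi>" and g: "g \<in> carrier G" "\<phi> g \<noteq> \<zero>\<^bsub>K\<^esub>"
  shows "Ext_nonzero KG M M (Suc k)"
proof (rule ccontr)
  assume "\<not> Ext_nonzero KG M M (Suc k)"
  then have "mexact M M (Suc k)" by (rule mexact_if_Ext_zero[OF M M])
  then have exact: "additive_character.exact_at G K (\<lambda>_. \<zero>\<^bsub>K\<^esub>) K (Suc k)"
    using trivial_exact_if_mexact[of M B \<kappa> "Suc k", OF M B coord n] by blast
  interpret field_character G K \<phi>
    by (intro field_character.intro \<phi> K.field_axioms)
  have "card X = 1" by (rule trivial_if_exact[OF exact])
  moreover have "\<phi> \<one>\<^bsub>G\<^esub> \<in> X" "\<phi> g \<in> X" using g(1) by blast+
  ultimately have "\<phi> g = \<phi> \<one>\<^bsub>G\<^esub>" by (metis card_1_singletonE singletonD)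
  then show False using g(2) char_one by simp
qed

end

theorem corollary2:
  fixes G :: "('g, 'b) monoid_scheme"
    and K :: "('k, 'a) ring_scheme"
    and p :: nat
  assumes "group G" and "finite (carrier G)"
    and "field K" and "has_characteristic K p" and "p > 0"
    and "Ext_nonzero (group_algebra K G) (trivial_module K G) (trivial_module K G) 1"
  shows "(\<forall>n\<ge>1. Ext_nonzero (group_algebra K G) (trivial_module K G) (trivial_module K G) n) \<and>
    (\<forall>M :: ('g \<Rightarrow> 'k, 'm) module.
       right_module (group_algebra K G) M \<longrightarrow>
       vectorspace.fin_dim K (underlying_space K G M) \<longrightarrow>
       \<not> p dvd vectorspace.dim K (underlying_space K G M) \<longrightarrow>
       (\<forall>n\<ge>1. Ext_nonzero (group_algebra K G) M M n))"
proof -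
  interpret K: field K by fact
  interpret finite_group_field_algebra G K
    using assms by (intro finite_group_field_algebra.intro finite_group_algebra.intro
        finite_group_algebra_axioms.intro K.ring_axioms)
  have char: "[n] \<cdot>\<^bsub>K\<^esub> \<one>\<^bsub>K\<^esub> = \<zero>\<^bsub>K\<^esub> \<longleftrightarrow> p dvd n" for n :: nat
    using assms(4) by (simp add: has_characteristic_def)
  obtain \<phi> g where \<phi>: "additive_character G K \<phi>" and g: "g \<in> carrier G" "\<phi> g \<noteq> \<zero>\<^bsub>K\<^esub>"
    using Ext_1_trivial_zero assms(6) by (metis One_nat_def)
  have "Ext_nonzero KG (trivial_module K G) (trivial_module K G) (Suc k)" for k
  \<comment> \<open>The first claim is the case of the trivial module, with basis vector one and
    \<open>x\<close> as its own coordinate. Coordinates are given by hand since the element type is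
    that of the field, not the type variable of the second claim.\<close>
  proof (rule Ext_nonzero_if_coordinates[OF right_module_trivial, of "{\<one>\<^bsub>K\<^esub>}" "\<lambda>x e. x", OF _ _ _ _ _ _ _ _ \<phi> g])
    show "x = (\<Oplus>\<^bsub>trivial_module K G\<^esub>e\<in>{\<one>\<^bsub>K\<^esub>}. scal (trivial_module K G) x e)"
      if "x \<in> carrier (trivial_module K G)" for x
    proof -
      interpret T: right_module KG "trivial_module K G" by (rule right_module_trivial)
      have "(\<Oplus>\<^bsub>trivial_module K G\<^esub>e\<in>{\<one>\<^bsub>K\<^esub>}. scal (trivial_module K G) x e) = scal (trivial_module K G) x \<one>\<^bsub>K\<^esub>"
        using T.M.finsum_insert[of "{}" "\<one>\<^bsub>K\<^esub>" "scal (trivial_module K G) x"] that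
          scal_closed[OF right_module_trivial, of x "\<one>\<^bsub>K\<^esub>"] by (simp add: T.M.r_zero)
      then show ?thesis using that by (simp add: scal_trivial)
    qed
    show "[card {\<one>\<^bsub>K\<^esub>}] \<cdot>\<^bsub>K\<^esub> \<one>\<^bsub>K\<^esub> \<noteq> \<zero>\<^bsub>K\<^esub>" by simp
  qed (simp_all add: scal_trivial K.m_comm)
  moreover have "Ext_nonzero KG M M (Suc k)"
    if M: "right_module KG M" and fd: "vectorspace.fin_dim K (underlying_space K G M)"
      and dim: "\<not> p dvd vectorspace.dim K (underlying_space K G M)" for M :: "('g \<Rightarrow> 'k, 'm) module" and k
  proof (rule finite_basis_coordinates[OF M fd])
    fix B \<kappa>
    assume "finite B" "B \<subseteq> carrier M" and card: "card B = vectorspace.dim K (underlying_space K G M)"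
      and coord: "\<And>x e. x \<in> carrier M \<Longrightarrow> e \<in> B \<Longrightarrow> \<kappa> x e \<in> carrier K"
      "\<And>x y e. x \<in> carrier M \<Longrightarrow> y \<in> carrier M \<Longrightarrow> e \<in> B \<Longrightarrow> \<kappa> (x \<oplus>\<^bsub>M\<^esub> y) e = \<kappa> x e \<oplus>\<^bsub>K\<^esub> \<kappa> y e"
      "\<And>c x e. c \<in> carrier K \<Longrightarrow> x \<in> carrier M \<Longrightarrow> e \<in> B \<Longrightarrow> \<kappa> (scal M c x) e = c \<otimes>\<^bsub>K\<^esub> \<kappa> x e"
      "\<And>e. e \<in> B \<Longrightarrow> \<kappa> e e = \<one>\<^bsub>K\<^esub>"
      "\<And>x. x \<in> carrier M \<Longrightarrow> x = (\<Oplus>\<^bsub>M\<^esub>e\<in>B. scal M (\<kappa> x e) e)"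
    \<comment> \<open>By the characteristic, \<open>p\<close> not dividing the dimension means that
      the dimension is invertible in \<open>K\<close>, as the trace argument requires.\<close>
    moreover have "[card B] \<cdot>\<^bsub>K\<^esub> \<one>\<^bsub>K\<^esub> \<noteq> \<zero>\<^bsub>K\<^esub>" using char dim card by simp
    ultimately show ?thesis by (intro Ext_nonzero_if_coordinates[OF M _ _ coord _ \<phi> g])
  qed
  ultimately show ?thesis
    by (metis One_nat_def Suc_le_D)
qed

end
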